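(* Let $E:=C_{0,\rho}(\Delta,\mathbb K)$, let $f:[0,\infty)\to[1,\infty)$ be an increasing mapping and $m_k=f(k)$, $k\in\mathbb N_0$. Suppose that, for every $k\in\mathbb N$ and $\delta>0$, there exist only a finite number $c_{k,\delta}\in\mathbb N$ of tuples $(n_1,n_2)\in\mathbb N_0^2$ such that $n_1\ne n_2$, $$\bigl|\lfloor m_{k+n_1}\rfloor-\lfloor m_{k+n_2}\rfloor\bigr|\le\delta\quad\text{and, provided } k\ge\max(n_1,n_2),\quad \bigl|\lfloor m_{k-n_1}\rfloor-\lfloor m_{k-n_2}\rfloor\bigr|\le\delta, \qquad ( * )$$ and that the sequence $(c_{k,\delta})_{k\in\mathbb N}$ is bounded for every fixed $\delta>0$. Suppose that there is $t_0\in\Delta'\setminus\{0\}$ such that the following conditions hold for any compact subset $K$ of $\Delta$: (i) For any $\epsilon>0$ there is $N\in\mathbb N$ such that for any finite set $F\subseteq[N,\infty)\cap\mathbb N$ and any $k\in\mathbb N$, $$\sup_{n\in F,\,k\ge n,\,x\in K}\tilde\rho\bigl(x-t_0(\lfloor m_k\rfloor-\lfloor m_{k-n}\rfloor)\bigr)<\epsilon .$$ (ii) For any $\epsilon>0$ there is $N\in\mathbb N$ such that for any finite set $F\subseteq[N,\infty)\cap\mathbb N$ and any $k\in\mathbb N$, $$\sup_{n\in F,\,x\in K}\tilde\rho\bigl(x-t_0(\lfloor m_{k+n}\rfloor-\lfloor m_k\rfloor)\bigr)<\epsilon .$$ (iii) For any $\epsilon>0$ there is $N\in\mathbb N$ such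 that for any finite set $F\subseteq[N,\infty)\cap\mathbb N$, $$\sup_{n\in F,\,x\in K}\rho(x+t_0\lfloor m_n\rfloor)<\epsilon .$$ Then the translation semigroup $(T(t))_{t\in\Delta'}$ on $E$ is $f$-frequently hypercyclic, $(T(te^{i\arg(t_0)}))_{t\ge0}$ is $f$-frequently hypercyclic and the operator $T(t_0)$ is l-$(m_k)$-frequently hypercyclic. In particular, if $f(t)=t^q+1$, $t\ge0$, with $q>1$, and $\rho(t)=(1+|t|)^{-s}$, $t\in\Delta$, where $qs>1$, then the hypothesis on the tuples satisfying $( * )$ holds as well as (i)-(iii); thus $(T(t))_{t\in\Delta'}$ satisfies all the conclusions given above.
   Context: $\mathbb K\in\{\mathbb R,\mathbb C\}$. Each of $\Delta,\Delta'$ is one of $[0,\infty)$, $\mathbb R$, $\mathbb C$, or $\Delta(\alpha):=\{re^{i\theta}: r\ge 0,\ \theta\in[-\alpha,\alpha]\}$ for some $\alpha\in(0,\pi/2]$, and $\Delta'\subseteq\Delta$. The function $\rho:\Delta\to(0,\infty)$ is an admissible weight function: it is measurable and there are $M\ge1$, $\omega\in\mathbb R$ with $\rho(t)\le Me^{\omega|t'|}\rho(t+t')$ for all $t,t'\in\Delta$. $\tilde\rho:\mathbb C\to[0,\infty)$ equals $\rho$ on $\Delta$ and $0$ elsewhere. $C_{0,\rho}(\Delta,\mathbb K)$ is the Banach space of continuous $u:\Delta\to\mathbb K$ with $\lim_{t\to\infty}u(t)\rho(t)=0$, normed by $\|u\|:=\sup_{t\in\Delta}|u(t)\rho(t)|$.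 The translation semigroup is $(T(t)u)(x):=u(x+t)$, $x\in\Delta$, $t\in\Delta'$; it is a $C_0$-semigroup on this space. Suprema over empty index sets are $0$. With $m(\cdot)$ Lebesgue measure on the index set $\Delta'$ and $\Delta'_s:=\{t\in\Delta':|t|\le s\}$: for $A\subseteq\Delta'$, $\underline d_f(A):=\liminf_{t\to\infty}m(A\cap\Delta'_{f(t)})/t$; for $A\subseteq\mathbb N$, $\underline d_{m_k}(A):=\liminf_{n\to\infty}|A\cap[1,m_n]|/n$. The semigroup $(T(t))_{t\in\Delta'}$ is $f$-frequently hypercyclic if there is $x\in E$ with $\underline d_f(\{t\in\Delta':T(t)x\in V\})>0$ for every open non-empty $V\subseteq E$; for $(T(te^{i\arg(t_0)}))_{t\ge0}$ this is used with index set $[0,\infty)$. An operator $T$ on $E$ is l-$(m_k)$-frequently hypercyclic if there is $x\in E$ with $\underline d_{m_k}(\{n\in\mathbb N:T^nx\in V\})>0$ for every open non-empty $V\subseteq E$.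
   Formalization: The sign in (ii) is corrected to ρ̃(x + t0(⌊m_{k+n}⌋ − ⌊m_k⌋)), and the two general semigroup conclusions additionally assume some c>0 with |t0| f(ct) ≤ f(t) for all large t (automatic if |t0| ≤ 1); without these changes the claim is false. *)

theory Defs
  imports "HOL-Analysis.Analysis" "HOL-Library.Nonpos_Ints"
begin

section \<open>Index sets\<close>

text \<open>All index sets are subsets of the complex plane; \<open>[0,\<infinity>)\<close> and the real line are
  \<open>\<real>\<^sub>\<ge>\<^sub>0\<close> and \<open>\<real>\<close> in type \<^typ>\<open>complex\<close>.\<close>

definition sector :: "real \<Rightarrow> complex set" where
  "sector \<alpha> = {of_real r * cis \<theta> | r \<theta>. 0 \<le> r \<and> -\<alpha> \<le> \<theta> \<and> \<theta> \<le> \<alpha>}"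

definition index_sets :: "complex set set" where
  "index_sets = {\<real>\<^sub>\<ge>\<^sub>0, \<real>, UNIV} \<union> {sector \<alpha> | \<alpha>. 0 < \<alpha> \<and> \<alpha> \<le> pi/2}"

text \<open>Lebesgue measure on an index set is one-dimensional on \<open>[0,\<infinity>)\<close> and the real line,
  and two-dimensional on sectors and on the whole plane.\<close>

definition index_measure :: "complex set \<Rightarrow> complex measure" where
  "index_measure D =
     restrict_space (if D \<subseteq> \<real> then embed_measure lebesgue complex_of_real else lebesgue) D"


section \<open>Weighted spaces of continuous functions and translations\<close>

definition admissible_weight :: "complex set \<Rightarrow> (complex \<Rightarrow> real) \<Rightarrow> bool" where
  "admissible_weight \<Delta> \<rho> \<longleftrightarrow>
     (\<forall>t\<in>\<Delta>. 0 < \<rho> t) \<and> \<rho> \<in> borel_measurable (index_measure \<Delta>) \<and>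
     (\<exists>M \<omega>. 1 \<le> M \<and> (\<forall>t\<in>\<Delta>. \<forall>t'\<in>\<Delta>. \<rho> t \<le> M * exp (\<omega> * cmod t') * \<rho> (t + t')))"

definition extend0 :: "complex set \<Rightarrow> (complex \<Rightarrow> real) \<Rightarrow> complex \<Rightarrow> real" where
  "extend0 \<Delta> \<rho> z = (if z \<in> \<Delta> then \<rho> z else 0)"

text \<open>The scalar field \<open>\<K>\<close> is \<open>\<real>\<close> or \<^term>\<open>UNIV\<close>, as a subset of \<^typ>\<open>complex\<close>. The limit is
  the one for \<open>\<bar>t\<bar> \<rightarrow> \<infinity>\<close> within \<open>\<Delta>\<close>.\<close>

definition C0_weighted :: "complex set \<Rightarrow> complex set \<Rightarrow> (complex \<Rightarrow> real) \<Rightarrow> (complex \<Rightarrow> complex) set"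
  where
  "C0_weighted \<Delta> \<K> \<rho> = {u \<in> \<Delta> \<rightarrow>\<^sub>E \<K>. continuous_on \<Delta> u \<and>
     ((\<lambda>t. u t * of_real (\<rho> t)) \<longlongrightarrow> 0) (inf at_infinity (principal \<Delta>))}"

definition C0_norm :: "complex set \<Rightarrow> (complex \<Rightarrow> real) \<Rightarrow> (complex \<Rightarrow> complex) \<Rightarrow> real" where
  "C0_norm \<Delta> \<rho> u = (SUP t\<in>\<Delta>. cmod (u t * of_real (\<rho> t)))"

text \<open>The case distinction only serves the locale \<^locale>\<open>Metric_space\<close>, whose symmetry and
  nonnegativity axioms are not relativised to the carrier.\<close>

definition C0_dist ::
  "complex set \<Rightarrow> complex set \<Rightarrow> (complex \<Rightarrow> real) \<Rightarrow> (complex \<Rightarrow> complex) \<Rightarrow> (complex \<Rightarrow> complex) \<Rightarrow> real"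
  where
  "C0_dist \<Delta> \<K> \<rho> u v =
     (if u \<in> C0_weighted \<Delta> \<K> \<rho> \<and> v \<in> C0_weighted \<Delta> \<K> \<rho>
      then C0_norm \<Delta> \<rho> (\<lambda>t. u t - v t) else 0)"

definition C0_topology ::
  "complex set \<Rightarrow> complex set \<Rightarrow> (complex \<Rightarrow> real) \<Rightarrow> (complex \<Rightarrow> complex) topology" where
  "C0_topology \<Delta> \<K> \<rho> = Metric_space.mtopology (C0_weighted \<Delta> \<K> \<rho>) (C0_dist \<Delta> \<K> \<rho>)"

definition translation :: "complex set \<Rightarrow> complex \<Rightarrow> (complex \<Rightarrow> complex) \<Rightarrow> complex \<Rightarrow> complex" where
  "translation \<Delta> t u = (\<lambda>x\<in>\<Delta>. u (x + t))"


section \<open>Lower densities and frequent hypercyclicity\<close>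

definition lower_density :: "complex set \<Rightarrow> (real \<Rightarrow> real) \<Rightarrow> complex set \<Rightarrow> ennreal" where
  "lower_density D f A =
     Liminf at_top (\<lambda>t. emeasure (index_measure D) (A \<inter> {z \<in> D. cmod z \<le> f t}) / ennreal t)"

definition lower_density_seq :: "(nat \<Rightarrow> real) \<Rightarrow> nat set \<Rightarrow> ereal" where
  "lower_density_seq m A =
     liminf (\<lambda>n. ereal (real (card {j \<in> A. 1 \<le> j \<and> real j \<le> m n}) / real n))"

definition frequently_hypercyclic ::
  "'a topology \<Rightarrow> complex set \<Rightarrow> (real \<Rightarrow> real) \<Rightarrow> (complex \<Rightarrow> 'a \<Rightarrow> 'a) \<Rightarrow> bool" where
  "frequently_hypercyclic X D f T \<longleftrightarrow>
     (\<exists>x\<in>topspace X. \<forall>V. openin X V \<and> V \<noteq> {} \<longrightarrow> 0 < lower_density D f {t \<in> D. T t x \<in> V})"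

definition l_frequently_hypercyclic ::
  "'a topology \<Rightarrow> (nat \<Rightarrow> real) \<Rightarrow> ('a \<Rightarrow> 'a) \<Rightarrow> bool" where
  "l_frequently_hypercyclic X m T \<longleftrightarrow>
     (\<exists>x\<in>topspace X. \<forall>V. openin X V \<and> V \<noteq> {} \<longrightarrow>
        0 < lower_density_seq m {n. 1 \<le> n \<and> (T ^^ n) x \<in> V})"


section \<open>The conditions on the sequence and on the weight\<close>

definition close_tuples :: "(nat \<Rightarrow> real) \<Rightarrow> nat \<Rightarrow> real \<Rightarrow> (nat \<times> nat) set" where
  "close_tuples m k \<delta> = {(n1, n2). n1 \<noteq> n2 \<and>
     of_int \<bar>\<lfloor>m (k + n1)\<rfloor> - \<lfloor>m (k + n2)\<rfloor>\<bar> \<le> \<delta> \<and>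
     (max n1 n2 \<le> k \<longrightarrow> of_int \<bar>\<lfloor>m (k - n1)\<rfloor> - \<lfloor>m (k - n2)\<rfloor>\<bar> \<le> \<delta>)}"

definition tuple_condition :: "(nat \<Rightarrow> real) \<Rightarrow> bool" where
  "tuple_condition m \<longleftrightarrow> (\<forall>\<delta>>0. (\<forall>k\<ge>1. finite (close_tuples m k \<delta>)) \<and>
     (\<exists>C. \<forall>k\<ge>1. card (close_tuples m k \<delta>) \<le> C))"

text \<open>The suprema are taken in \<^typ>\<open>ennreal\<close>, where the supremum of the empty set is \<open>0\<close>.\<close>

definition backward_condition ::
  "complex set \<Rightarrow> (complex \<Rightarrow> real) \<Rightarrow> (nat \<Rightarrow> real) \<Rightarrow> complex \<Rightarrow> complex set \<Rightarrow> bool" where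
  "backward_condition \<Delta> \<rho> m t0 K \<longleftrightarrow>
     (\<forall>\<epsilon>>0. \<exists>N\<ge>1. \<forall>F k. finite F \<and> F \<subseteq> {N..} \<and> 1 \<le> k \<longrightarrow>
        (SUP (n, x) \<in> {(n, x). n \<in> F \<and> n \<le> k \<and> x \<in> K}.
           ennreal (extend0 \<Delta> \<rho> (x - t0 * of_int (\<lfloor>m k\<rfloor> - \<lfloor>m (k - n)\<rfloor>)))) < ennreal \<epsilon>)"

text \<open>The shift here is by \<open>+t\<^sub>0\<close>. With \<open>-t\<^sub>0\<close> the condition would be redundant, following from
  \<open>backward_condition\<close> applied to \<open>k + n\<close>, and it would not control
  \<open>T(\<lfloor>m\<^sub>k\<rfloor>t\<^sub>0)\<close> on functions supported in \<open>K + \<lfloor>m\<^bsub>k+n\<^esub>\<rfloor>t\<^sub>0\<close>.\<close>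

definition forward_condition ::
  "complex set \<Rightarrow> (complex \<Rightarrow> real) \<Rightarrow> (nat \<Rightarrow> real) \<Rightarrow> complex \<Rightarrow> complex set \<Rightarrow> bool" where
  "forward_condition \<Delta> \<rho> m t0 K \<longleftrightarrow>
     (\<forall>\<epsilon>>0. \<exists>N\<ge>1. \<forall>F k. finite F \<and> F \<subseteq> {N..} \<and> 1 \<le> k \<longrightarrow>
        (SUP (n, x) \<in> F \<times> K.
           ennreal (extend0 \<Delta> \<rho> (x + t0 * of_int (\<lfloor>m (k + n)\<rfloor> - \<lfloor>m k\<rfloor>)))) < ennreal \<epsilon>)"

definition orbit_condition ::
  "(complex \<Rightarrow> real) \<Rightarrow> (nat \<Rightarrow> real) \<Rightarrow> complex \<Rightarrow> complex set \<Rightarrow> bool" where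
  "orbit_condition \<rho> m t0 K \<longleftrightarrow>
     (\<forall>\<epsilon>>0. \<exists>N\<ge>1. \<forall>F. finite F \<and> F \<subseteq> {N..} \<longrightarrow>
        (SUP (n, x) \<in> F \<times> K. ennreal (\<rho> (x + t0 * of_int \<lfloor>m n\<rfloor>))) < ennreal \<epsilon>)"


section \<open>The weighted spaces are metric spaces\<close>

lemma sector_absorbs:
  assumes \<alpha>: "0 < \<alpha>" "\<alpha> \<le> pi/2" and R: "0 \<le> R"
  shows "\<exists>p\<in>sector \<alpha>. \<forall>t\<in>sector \<alpha>. cmod t \<le> R \<longrightarrow> p - t \<in> sector \<alpha>"
proof (intro bexI ballI impI)
  have sa: "0 < sin \<alpha>" "0 \<le> cos \<alpha>" "sin \<alpha> \<le> 1"
    using \<alpha> by (auto intro!: sin_gt_zero cos_ge_zero)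
  define p where "p = R / sin \<alpha>"
  have p: "p * sin \<alpha> = R" "0 \<le> p" using sa R by (auto simp: p_def)
  show "of_real p \<in> sector \<alpha>"
    unfolding sector_def using p \<alpha> by (intro CollectI exI[of _ p] exI[of _ 0]) auto
  fix t assume t: "t \<in> sector \<alpha>" and tR: "cmod t \<le> R"
  from t obtain r \<theta> where r: "t = of_real r * cis \<theta>" "0 \<le> r" "-\<alpha> \<le> \<theta>" "\<theta> \<le> \<alpha>"
    by (auto simp: sector_def)
  have rR: "r \<le> R" using tR r by (simp add: norm_mult)
  have Rp: "R \<le> p" using p sa mult_left_mono[of "sin \<alpha>" 1 p] by simp
  define z where "z = complex_of_real p - t"
  have Re: "Re z = p - r * cos \<theta>" and Im: "Im z = - r * sin \<theta>"
    by (simp_all add: z_def r)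
  have "r * cos \<theta> \<le> r" using r mult_left_mono[of "cos \<theta>" 1 r] by simp
  then have Re0: "0 \<le> Re z" using Re rR Rp by linarith
  have key: "\<bar>Im z\<bar> * cos \<alpha> \<le> Re z * sin \<alpha>"
  proof -
    have s1: "r * sin (\<alpha> + \<theta>) \<le> r * 1" "r * sin (\<alpha> - \<theta>) \<le> r * 1"
      using r by (intro mult_left_mono; simp)+
    have "r * sin \<theta> * cos \<alpha> \<le> (p - r * cos \<theta>) * sin \<alpha>"
      "- (r * sin \<theta> * cos \<alpha>) \<le> (p - r * cos \<theta>) * sin \<alpha>"
      using s1 rR p by (simp_all add: sin_add sin_diff algebra_simps)
    then show ?thesis using sa unfolding Re Im by (auto simp: abs_if)
  qed
  show "complex_of_real p - t \<in> sector \<alpha>"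
  proof (cases "z = 0")
    case True
    then show ?thesis unfolding z_def[symmetric] sector_def using \<alpha>
      by (intro CollectI exI[of _ 0] exI[of _ 0]) auto
  next
    case False
    define \<phi> where "\<phi> = Arg z"
    have zz: "z = of_real (cmod z) * cis \<phi>"
      using rcis_cmod_Arg[of z] by (simp add: rcis_def \<phi>_def)
    have Re': "Re z = cmod z * cos \<phi>" and Im': "Im z = cmod z * sin \<phi>"
      by (subst zz, simp)+
    have b: "-pi < \<phi>" "\<phi> \<le> pi" using Arg_bounded[of z] by (auto simp: \<phi>_def)
    have cz: "0 < cmod z" using False by simp
    have "0 \<le> cos \<phi>" using Re0 Re' cz by (simp add: zero_le_mult_iff)
    have h: "\<bar>\<phi>\<bar> \<le> pi/2"
      using Re0 Arg_Re_nonneg[of z] by (simp add: \<phi>_def)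
    have "\<bar>\<phi>\<bar> \<le> \<alpha>"
    proof (rule ccontr)
      assume "\<not> \<bar>\<phi>\<bar> \<le> \<alpha>"
      then have "0 < sin (\<bar>\<phi>\<bar> - \<alpha>)" using h \<alpha> by (intro sin_gt_zero) linarith+
      moreover have "cmod z * sin (\<bar>\<phi>\<bar> - \<alpha>) \<le> 0"
      proof -
        have "0 \<le> sin \<bar>\<phi>\<bar>" using h pi_gt_zero by (intro sin_ge_zero) linarith+
        then have "\<bar>sin \<phi>\<bar> = sin \<bar>\<phi>\<bar>" by (cases "\<phi> < 0") (auto simp: abs_if)
        moreover have "cos \<bar>\<phi>\<bar> = cos \<phi>" by (simp add: abs_if)
        ultimately show ?thesis
          using key unfolding Re' Im' by (simp add: sin_diff abs_mult algebra_simps)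
      qed
      ultimately show False using cz by (simp add: mult_le_0_iff)
    qed
    then show ?thesis unfolding z_def[symmetric] sector_def using zz
      by (intro CollectI exI[of _ "cmod z"] exI[of _ \<phi>]) auto
  qed
qed

lemma index_set_absorbs:
  assumes "\<Delta> \<in> index_sets" "0 \<le> R"
  shows "\<exists>p\<in>\<Delta>. \<forall>t\<in>\<Delta>. cmod t \<le> R \<longrightarrow> p - t \<in> \<Delta>"
proof -
  consider "\<Delta> = \<real>\<^sub>\<ge>\<^sub>0" | "\<Delta> = \<real> \<or> \<Delta> = UNIV" | \<alpha> where "\<Delta> = sector \<alpha>" "0 < \<alpha>" "\<alpha> \<le> pi/2"
    using assms(1) by (auto simp: index_sets_def)
  then show ?thesis
  proof cases
    case 1
    show ?thesis unfolding 1 using assms(2)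
      by (intro bexI[of _ "of_real R"]) (auto simp: nonneg_Reals_def simp flip: of_real_diff)
  next
    case 2
    then show ?thesis by (intro bexI[of _ 0]) auto
  next
    case 3
    then show ?thesis using sector_absorbs assms(2) by simp
  qed
qed

lemma compact_index_set_Int_cball:
  assumes "\<Delta> \<in> index_sets"
  shows "compact (\<Delta> \<inter> cball 0 R)"
proof -
  consider "\<Delta> = \<real>\<^sub>\<ge>\<^sub>0" | "\<Delta> = \<real>" | "\<Delta> = UNIV" | \<alpha> where "\<Delta> = sector \<alpha>"
    using assms by (auto simp: index_sets_def)
  then show ?thesis
  proof cases
    case 4
    have "\<Delta> \<inter> cball 0 R = (\<lambda>(r, \<theta>). of_real r * cis \<theta>) ` ({0..R} \<times> {-\<alpha>..\<alpha>})"
      unfolding 4 sector_def by (force simp: norm_mult image_iff)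
    then show ?thesis
      by (auto intro!: compact_continuous_image compact_Times continuous_intros
               simp: case_prod_unfold)
  qed (auto intro!: closed_Int_compact closed_complex_Reals)
qed

lemma C0_weighted_bounded:
  assumes \<Delta>: "\<Delta> \<in> index_sets" and \<rho>: "admissible_weight \<Delta> \<rho>" and u: "u \<in> C0_weighted \<Delta> \<K> \<rho>"
  shows "\<exists>B. \<forall>t\<in>\<Delta>. cmod (u t * of_real (\<rho> t)) \<le> B"
proof -
  from \<rho> obtain M \<omega> where M: "1 \<le> M" and pos: "\<And>t. t \<in> \<Delta> \<Longrightarrow> 0 < \<rho> t"
    and adm: "\<And>t t'. t \<in> \<Delta> \<Longrightarrow> t' \<in> \<Delta> \<Longrightarrow> \<rho> t \<le> M * exp (\<omega> * cmod t') * \<rho> (t + t')"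
    unfolding admissible_weight_def by blast
  have "\<forall>\<^sub>F t in inf at_infinity (principal \<Delta>). cmod (u t * of_real (\<rho> t)) < 1"
    using u tendstoD[of "\<lambda>t. u t * of_real (\<rho> t)" 0 _ 1] by (auto simp: C0_weighted_def)
  then obtain R0 where R0: "\<And>t. R0 \<le> cmod t \<Longrightarrow> t \<in> \<Delta> \<Longrightarrow> cmod (u t * of_real (\<rho> t)) < 1"
    unfolding eventually_inf_principal eventually_at_infinity by blast
  define R where "R = max R0 0"
  obtain p where p: "p \<in> \<Delta>" "\<And>t. t \<in> \<Delta> \<Longrightarrow> cmod t \<le> R \<Longrightarrow> p - t \<in> \<Delta>"
    using index_set_absorbs[OF \<Delta>, of R] by (auto simp: R_def)
  have "compact (u ` (\<Delta> \<inter> cball 0 R))"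
    using u by (intro compact_continuous_image compact_index_set_Int_cball \<Delta>)
      (auto simp: C0_weighted_def intro: continuous_on_subset)
  then obtain B where B: "\<And>t. t \<in> \<Delta> \<Longrightarrow> cmod t \<le> R \<Longrightarrow> cmod (u t) \<le> B"
    using compact_imp_bounded[of "u ` (\<Delta> \<inter> cball 0 R)"] unfolding bounded_iff
    by (metis IntI image_eqI mem_cball_0)
  define C where "C = M * exp (\<bar>\<omega>\<bar> * (cmod p + R)) * \<rho> p"
  have C: "\<rho> t \<le> C" if t: "t \<in> \<Delta>" "cmod t \<le> R" for t
  proof -
    have "\<omega> * cmod (p - t) \<le> \<bar>\<omega>\<bar> * cmod (p - t)" by (simp add: mult_right_mono)
    also have "\<dots> \<le> \<bar>\<omega>\<bar> * (cmod p + R)"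
      using t norm_triangle_ineq4[of p t] by (intro mult_left_mono) auto
    finally have "M * exp (\<omega> * cmod (p - t)) * \<rho> p \<le> C"
      unfolding C_def using M pos[OF p(1)] by (intro mult_right_mono mult_left_mono) auto
    then show ?thesis using adm[OF t(1) p(2)[OF t]] by simp
  qed
  have "cmod (u t * of_real (\<rho> t)) \<le> max 1 (B * C)" if t: "t \<in> \<Delta>" for t
  proof (cases "cmod t \<le> R")
    case True
    have "cmod (u t) * \<rho> t \<le> B * C"
      using B[OF t True] C[OF t True] pos[OF t] order_trans[OF norm_ge_zero B[OF t True]]
      by (intro mult_mono) auto
    then show ?thesis using pos[OF t] by (simp add: norm_mult)
  next
    case False
    then have "R0 \<le> cmod t" by (simp add: R_def)
    then show ?thesis using R0[of t] t by linarith
  qed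
  then show ?thesis by blast
qed

lemma Metric_space_C0_weighted:
  assumes \<Delta>: "\<Delta> \<in> index_sets" and \<rho>: "admissible_weight \<Delta> \<rho>"
  shows "Metric_space (C0_weighted \<Delta> \<K> \<rho>) (C0_dist \<Delta> \<K> \<rho>)"
proof -
  let ?E = "C0_weighted \<Delta> \<K> \<rho>"
  let ?g = "\<lambda>u v t. cmod ((u t - v t) * of_real (\<rho> t))"
  have pos: "\<And>t. t \<in> \<Delta> \<Longrightarrow> 0 < \<rho> t" using \<rho> by (auto simp: admissible_weight_def)
  obtain p where p: "p \<in> \<Delta>" using index_set_absorbs[OF \<Delta>, of 0] by auto
  have bdd: "bdd_above (?g u v ` \<Delta>)" if uv: "u \<in> ?E" "v \<in> ?E" for u v
  proof -
    obtain A B where "\<forall>t\<in>\<Delta>. cmod (u t * of_real (\<rho> t)) \<le> A" "\<forall>t\<in>\<Delta>. cmod (v t * of_real (\<rho> t)) \<le> B"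
      using C0_weighted_bounded[OF \<Delta> \<rho>] uv by meson
    then have "?g u v t \<le> A + B" if "t \<in> \<Delta>" for t
      using that norm_triangle_ineq4[of "u t * of_real (\<rho> t)" "v t * of_real (\<rho> t)"]
      by (fastforce simp: left_diff_distrib)
    then show ?thesis by (auto simp: bdd_above_def)
  qed
  have le: "?g u v t \<le> C0_dist \<Delta> \<K> \<rho> u v" if "u \<in> ?E" "v \<in> ?E" "t \<in> \<Delta>" for u v t
    using that cSUP_upper[OF that(3) bdd[OF that(1,2)]] by (simp add: C0_dist_def C0_norm_def)
  have least: "C0_dist \<Delta> \<K> \<rho> u v \<le> c"
    if "u \<in> ?E" "v \<in> ?E" "\<And>t. t \<in> \<Delta> \<Longrightarrow> ?g u v t \<le> c" for u v c
    using that p by (auto simp: C0_dist_def C0_norm_def intro!: cSUP_least)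
  show ?thesis
  proof
    fix u v
    show "0 \<le> C0_dist \<Delta> \<K> \<rho> u v"
      using le[of u v p] p norm_ge_zero[of "(u p - v p) * of_real (\<rho> p)"]
      by (cases "u \<in> ?E \<and> v \<in> ?E") (linarith, auto simp: C0_dist_def)
    show "C0_dist \<Delta> \<K> \<rho> u v = C0_dist \<Delta> \<K> \<rho> v u"
      by (auto simp: C0_dist_def C0_norm_def norm_mult norm_minus_commute)
  next
    fix u v assume uv: "u \<in> ?E" "v \<in> ?E"
    show "C0_dist \<Delta> \<K> \<rho> u v = 0 \<longleftrightarrow> u = v"
    proof
      assume 0: "C0_dist \<Delta> \<K> \<rho> u v = 0"
      show "u = v"
      proof (rule PiE_ext)
        show "u \<in> \<Delta> \<rightarrow>\<^sub>E \<K>" "v \<in> \<Delta> \<rightarrow>\<^sub>E \<K>" using uv by (auto simp: C0_weighted_def)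
        fix t assume "t \<in> \<Delta>"
        then show "u t = v t" using le[OF uv, of t] 0 pos[of t] by (auto simp: norm_mult mult_le_0_iff)
      qed
    next
      assume "u = v"
      moreover have "\<Delta> \<noteq> {}" using p by blast
      ultimately show "C0_dist \<Delta> \<K> \<rho> u v = 0"
        using uv by (simp add: C0_dist_def C0_norm_def)
    qed
  next
    fix u v w assume uvw: "u \<in> ?E" "v \<in> ?E" "w \<in> ?E"
    show "C0_dist \<Delta> \<K> \<rho> u w \<le> C0_dist \<Delta> \<K> \<rho> u v + C0_dist \<Delta> \<K> \<rho> v w"
    proof (rule least)
      fix t assume t: "t \<in> \<Delta>"
      have "?g u w t \<le> ?g u v t + ?g v w t"
        using norm_triangle_ineq[of "(u t - v t) * of_real (\<rho> t)" "(v t - w t) * of_real (\<rho> t)"]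
        by (simp add: algebra_simps)
      then show "?g u w t \<le> C0_dist \<Delta> \<K> \<rho> u v + C0_dist \<Delta> \<K> \<rho> v w"
        using le[OF uvw(1,2) t] le[OF uvw(2,3) t] by linarith
    qed (use uvw in auto)
  qed
qed

lemma topspace_C0_topology [simp]:
  assumes "\<Delta> \<in> index_sets" "admissible_weight \<Delta> \<rho>"
  shows "topspace (C0_topology \<Delta> \<K> \<rho>) = C0_weighted \<Delta> \<K> \<rho>"
  using Metric_space.topspace_mtopology[OF Metric_space_C0_weighted[OF assms]]
  by (simp add: C0_topology_def)

end

theory Submission
  imports Defs
begin

text \<open>Condition \<open>(*)\<close> for \<open>k = 1\<close> forces the gaps of \<open>\<lfloor>m\<^sub>k\<rfloor>\<close> to tend to infinity. Take a sequence of
  compactly supported functions \<open>\<phi>\<^sub>p\<close> that is dense in \<open>E\<close> and disjoint sets \<open>A\<^sub>p \<subseteq> \<nat>\<close> of positive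
  lower density such that points of \<open>A\<^sub>p\<close> and \<open>A\<^sub>q\<close> are far apart. The translates of \<open>\<phi>\<^sub>p\<close> to
  \<open>t\<^sub>0\<lfloor>m\<^sub>k\<rfloor>\<close>, \<open>k \<in> A\<^sub>p\<close>, then have pairwise disjoint supports, so the weighted norm of their
  superposition \<open>u\<close> is a supremum over single translates, and the conditions on the weight give both
  \<open>u \<in> E\<close> and \<open>T(t\<^sub>0\<lfloor>m\<^sub>k\<rfloor>)u \<approx> \<phi>\<^sub>p\<close> for \<open>k \<in> A\<^sub>p\<close>. By strong continuity, every such time can be thickened
  to a set whose Lebesgue measure is bounded from below.\<close>

section \<open>Separated sets of positive lower density\<close>

text \<open>Two obstacles shape the construction. At a time belonging to class \<open>p\<close> the
  translates of all other classes \<open>q\<close> contribute errors, and these must be small on the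
  scale of \<open>p\<close>. A distance that grows with the class index while each class keeps
  positive density comes from the 2-adic valuation, which takes the value \<open>r\<close> on a set
  of density 2^-(r+1). The second obstacle is the time scale. A return time near \<open>t0\<close>
  times the floor of \<open>m k\<close> has modulus about \<open>cmod t0 * f k\<close>, whereas the
  density in continuous time measures up to \<open>f t\<close>. The premise
  \<open>cmod t0 * f (c * t) \<le> f t\<close> for large \<open>t\<close> bridges the two; for
  \<open>cmod t0 \<le> 1\<close> it holds with \<open>c = 1\<close>. Counting iterates of
  T(\<open>t0\<close>) does not see this modulus.\<close>

definition ruler_sum :: "nat \<Rightarrow> nat" where
  "ruler_sum n = (\<Sum>j=1..n. multiplicity 2 j)"

text \<open>The sum is the exponent of 2 in n!, so this is Legendre's bound. Odd numbers contribute
  nothing and halving the even ones gives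
  \<open>ruler_sum n = n div 2 + ruler_sum (n div 2)\<close>; strong induction finishes.\<close>

lemma ruler_sum_le: "ruler_sum n \<le> n"
proof -
  have odd0: "multiplicity 2 (Suc (2 * n)) = 0" for n :: nat
    by (rule not_dvd_imp_multiplicity_0) simp
  have step: "ruler_sum (Suc n) = ruler_sum n + multiplicity 2 (Suc n)" for n
    by (simp add: ruler_sum_def)
  have dbl: "ruler_sum (2 * n) = n + ruler_sum n" for n
  proof (induction n)
    case (Suc n)
    have "multiplicity 2 (2 * Suc n) = Suc (multiplicity 2 (Suc n))"
      by (rule multiplicity_times_same) auto
    then show ?case
      using Suc step[of "Suc (2 * n)"] step[of "2 * n"] step[of n] odd0[of n] by simp
  qed (simp add: ruler_sum_def)
  show ?thesis
  proof (induction n rule: less_induct)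
    case (less n)
    show ?case
    proof (cases "n = 0")
      case True
      then show ?thesis by (simp add: ruler_sum_def)
    next
      case False
      have "ruler_sum n = n div 2 + ruler_sum (n div 2)"
      proof (cases "even n")
        case True
        then show ?thesis using dbl[of "n div 2"] by simp
      next
        case False
        then obtain k where "n = Suc (2 * k)" by (metis oddE Suc_eq_plus1)
        then show ?thesis using dbl[of k] step[of "2 * k"] odd0[of k] by simp
      qed
      then show ?thesis using less.IH[of "n div 2"] False by simp
    qed
  qed
qed

text \<open>Position of the \<open>i\<close>-th marker on a line when each \<open>i\<close> reserves a margin of
  \<open>multiplicity 2 i\<close> on both of its sides.\<close>

definition ruler_pos :: "nat \<Rightarrow> nat" where
  "ruler_pos i = ruler_sum (i - 1) + ruler_sum i + i"

lemma ruler_pos_le: "ruler_pos i \<le> 3 * i"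
  using ruler_sum_le[of i] ruler_sum_le[of "i - 1"] by (simp add: ruler_pos_def)

lemma ruler_pos_ge: "1 \<le> i \<Longrightarrow> multiplicity 2 i + 1 \<le> ruler_pos i"
  by (cases i) (auto simp: ruler_pos_def ruler_sum_def)

text \<open>Of the two sums in \<open>ruler_pos\<close>, the one ending at \<open>i - 1\<close>
  grows by at least the valuation of \<open>i\<close> on the way to \<open>j\<close>, the one ending
  at \<open>i\<close> by at least the valuation of \<open>j\<close>. The summand \<open>i\<close>
  makes the inequality strict.\<close>

lemma ruler_pos_separated:
  assumes "1 \<le> i" "i < j"
  shows "ruler_pos i + multiplicity 2 i + multiplicity 2 j < ruler_pos j"
proof -
  have mono: "ruler_sum a \<le> ruler_sum b" if "a \<le> b" for a b
    unfolding ruler_sum_def using that by (intro sum_mono2) auto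
  obtain i' j' where ij: "i = Suc i'" "j = Suc j'" using assms by (metis Suc_le_D less_imp_Suc_add One_nat_def)
  have "ruler_sum (Suc i') \<le> ruler_sum j'" using assms ij by (intro mono) auto
  then show ?thesis
    using assms ij by (simp add: ruler_pos_def ruler_sum_def)
qed

text \<open>\<open>A r\<close> consists of the markers whose number has valuation \<open>r\<close>,
  that is, odd multiples of 2^r; \<open>ruler_pos i \<le> 3 * i\<close> preserves their positive
  density. The index \<open>r\<close> is itself the guaranteed distance, so prescribed distances are
  obtained later by selecting suitable indices. Density is stated by integer division to keep limits
  out of the construction.\<close>

lemma separated_sets:
  obtains A :: "nat \<Rightarrow> nat set"
  where "\<forall>r. \<exists>D>0. \<forall>n. n div D \<le> card (A r \<inter> {1..n})"
    and "\<forall>r s i j. i \<in> A r \<longrightarrow> j \<in> A s \<longrightarrow> i < j \<longrightarrow> i + max r s \<le> j"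
    and "\<forall>r s i. i \<in> A r \<longrightarrow> i \<in> A s \<longrightarrow> r = s"
    and "\<forall>r i. i \<in> A r \<longrightarrow> max 1 r \<le> i"
proof -
  define A where "A r = ruler_pos ` {i. 1 \<le> i \<and> multiplicity 2 i = r}" for r
  have inj: "i = j" if "ruler_pos i = ruler_pos j" "1 \<le> i" "1 \<le> j" for i j
    using that ruler_pos_separated[of i j] ruler_pos_separated[of j i] by (metis not_add_less1 linorder_cases add.assoc)
  show ?thesis
  proof (rule that[of A]; intro allI impI)
    show "\<exists>D>0. \<forall>n. n div D \<le> card (A r \<inter> {1..n})" for r
    proof (intro exI[of _ "6 * 2 ^ r"] conjI allI)
      \<comment> \<open>The divisor is 6 * 2^r because
        \<open>3 * h l \<le> 6 * 2^r * (l + 1)\<close>: the l-th odd multiple of 2^r, spread out by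
        the factor 3 of \<open>ruler_pos_le\<close>, is still at most \<open>n\<close> for all
        \<open>l < L\<close>.\<close>
      fix n :: nat
      define L where "L = n div (6 * 2 ^ r)"
      define h :: "nat \<Rightarrow> nat" where "h l = 2 ^ r * (2 * l + 1)" for l
      have h1: "1 \<le> h l" for l by (simp add: h_def Suc_le_eq)
      have mult: "multiplicity 2 (h l) = r" for l
      proof (rule multiplicity_eqI)
        show "2 ^ r dvd h l" by (simp add: h_def)
        show "\<not> 2 ^ Suc r dvd h l"
          unfolding h_def power_Suc2 by (subst dvd_times_left_cancel_iff) auto
      qed
      have inj_h: "inj_on (\<lambda>l. ruler_pos (h l)) {..<L}"
        by (rule inj_onI) (use inj h1 in \<open>force simp: h_def\<close>)
      have "(\<lambda>l. ruler_pos (h l)) ` {..<L} \<subseteq> A r \<inter> {1..n}"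
      proof (intro image_subsetI IntI)
        fix l assume "l \<in> {..<L}"
        then have "3 * h l \<le> (6 * 2 ^ r) * L"
          using mult_le_mono2[of "Suc l" L "6 * 2 ^ r"] by (simp add: h_def)
        also have "\<dots> \<le> n" by (simp add: L_def)
        finally have "ruler_pos (h l) \<le> n" using ruler_pos_le[of "h l"] by linarith
        then show "ruler_pos (h l) \<in> {1..n}" using ruler_pos_ge[OF h1[of l]] by simp
        show "ruler_pos (h l) \<in> A r" using h1 mult by (auto simp: A_def)
      qed
      from card_mono[OF _ this] show "n div (6 * 2 ^ r) \<le> card (A r \<inter> {1..n})"
        using inj_h by (simp add: card_image L_def)
    qed simp
    show "i + max r s \<le> j" if ij: "i \<in> A r" "j \<in> A s" "i < j" for r s i j
    proof -
      obtain a b where ab: "i = ruler_pos a" "j = ruler_pos b" "1 \<le> a" "1 \<le> b"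
        "multiplicity 2 a = r" "multiplicity 2 b = s" using ij by (auto simp: A_def)
      have "a < b" using ij(3) ab ruler_pos_separated[of b a] by (cases a b rule: linorder_cases) auto
      then show ?thesis using ruler_pos_separated[of a b] ab by auto
    qed
    show "r = s" if "i \<in> A r" "i \<in> A s" for r s i
      using that inj by (auto simp: A_def)
    show "max 1 r \<le> i" if "i \<in> A r" for r i
      using that ruler_pos_ge by (force simp: A_def)
  qed
qed


section \<open>Index sets\<close>

text \<open>The inequality is sin(\<alpha> - |\<theta>|) \<ge> 0 times the modulus. In this linear
  form the sector is visibly a closed convex cone, which the polar definition hides; closure under
  addition and scaling and closedness are read off from it.\<close>

lemma sector_iff:
  assumes \<alpha>: "0 < \<alpha>" "\<alpha> \<le> pi/2"
  shows "z \<in> sector \<alpha> \<longleftrightarrow> 0 \<le> Re z \<and> \<bar>Im z\<bar> * cos \<alpha> \<le> Re z * sin \<alpha>"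
proof
  assume "z \<in> sector \<alpha>"
  then obtain r \<theta> where z: "z = of_real r * cis \<theta>" "0 \<le> r" "-\<alpha> \<le> \<theta>" "\<theta> \<le> \<alpha>"
    by (auto simp: sector_def)
  have c: "0 \<le> cos \<theta>" using z \<alpha> by (intro cos_ge_zero) auto
  have "0 \<le> r * sin (\<alpha> - \<theta>)" "0 \<le> r * sin (\<alpha> + \<theta>)"
    using z \<alpha> by (intro mult_nonneg_nonneg sin_ge_zero; linarith)+
  then show "0 \<le> Re z \<and> \<bar>Im z\<bar> * cos \<alpha> \<le> Re z * sin \<alpha>"
    using z(2) c by (auto simp: z(1) abs_if sin_diff sin_add algebra_simps)
next
  assume R: "0 \<le> Re z \<and> \<bar>Im z\<bar> * cos \<alpha> \<le> Re z * sin \<alpha>"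
  define \<phi> where "\<phi> = Arg z"
  have zz: "z = of_real (cmod z) * cis \<phi>"
    using rcis_cmod_Arg[of z] by (simp add: rcis_def \<phi>_def)
  have Re': "Re z = cmod z * cos \<phi>" and Im': "Im z = cmod z * sin \<phi>"
    by (subst zz, simp)+
  have h: "\<bar>\<phi>\<bar> \<le> pi/2"
    using R Arg_Re_nonneg[of z] by (simp add: \<phi>_def)
  have "\<bar>\<phi>\<bar> \<le> \<alpha>" if "z \<noteq> 0"
  proof (rule ccontr)
    assume "\<not> \<bar>\<phi>\<bar> \<le> \<alpha>"
    then have "0 < cmod z * sin (\<bar>\<phi>\<bar> - \<alpha>)"
      using h \<alpha> that by (intro mult_pos_pos sin_gt_zero) auto
    moreover have "\<bar>sin \<phi>\<bar> = sin \<bar>\<phi>\<bar>"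
      using h pi_gt_zero sin_ge_zero[of "\<bar>\<phi>\<bar>"] by (cases "\<phi> < 0") (auto simp: abs_if)
    moreover have "cos \<bar>\<phi>\<bar> = cos \<phi>" by (simp add: abs_if)
    ultimately show False
      using R unfolding Re' Im' by (simp add: sin_diff abs_mult algebra_simps)
  qed
  moreover have "\<phi> = 0" if "z = 0" using that by (simp add: \<phi>_def Arg_zero)
  ultimately have "\<bar>\<phi>\<bar> \<le> \<alpha>" using \<alpha> by fastforce
  then show "z \<in> sector \<alpha>"
    unfolding sector_def using zz by (intro CollectI exI[of _ "cmod z"] exI[of _ \<phi>]) auto
qed

lemma index_set_cases [consumes 1, case_names nonneg Reals UNIV sector]:
  assumes "D \<in> index_sets"
  obtains "D = \<real>\<^sub>\<ge>\<^sub>0" | "D = \<real>" | "D = UNIV"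
    | \<alpha> where "D = sector \<alpha>" "0 < \<alpha>" "\<alpha> \<le> pi/2"
  using assms by (auto simp: index_sets_def)

lemma index_set_zero: "D \<in> index_sets \<Longrightarrow> 0 \<in> D"
  by (cases rule: index_set_cases) (auto simp: sector_iff)

lemma index_set_add:
  assumes "D \<in> index_sets" and xy: "x \<in> D" "y \<in> D"
  shows "x + y \<in> D"
  using assms(1)
proof (cases rule: index_set_cases)
  case (sector \<alpha>)
  have "0 \<le> cos \<alpha>" using sector by (intro cos_ge_zero) auto
  then have "\<bar>Im x + Im y\<bar> * cos \<alpha> \<le> \<bar>Im x\<bar> * cos \<alpha> + \<bar>Im y\<bar> * cos \<alpha>"
    by (metis abs_triangle_ineq distrib_right mult_right_mono)
  then show ?thesis using xy sector by (simp add: sector_iff distrib_right)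
qed (use xy in auto)

lemma index_set_scale:
  assumes "D \<in> index_sets" and xr: "x \<in> D" "0 \<le> r"
  shows "x * of_real r \<in> D"
  using assms(1)
proof (cases rule: index_set_cases)
  case (sector \<alpha>)
  show ?thesis
    using sector xr mult_left_mono[of "\<bar>Im x\<bar> * cos \<alpha>" "Re x * sin \<alpha>" r]
    by (simp add: sector_iff abs_mult mult_ac)
qed (use xr in auto)

lemma index_set_of_nat: "D \<in> index_sets \<Longrightarrow> x \<in> D \<Longrightarrow> x * of_nat n \<in> D"
  using index_set_scale[of D x "real n"] by simp

lemma closed_index_set:
  assumes "D \<in> index_sets"
  shows "closed D"
  using assms
proof (cases rule: index_set_cases)
  case (sector \<alpha>)
  have "D = {z. 0 \<le> Re z} \<inter> {z. \<bar>Im z\<bar> * cos \<alpha> \<le> Re z * sin \<alpha>}"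
    using sector by (auto simp: sector_iff)
  also have "closed \<dots>" by (intro closed_Int closed_Collect_le continuous_intros)
  finally show ?thesis .
qed (auto intro: closed_complex_Reals)

lemma not_Reals_sector:
  assumes "0 < \<alpha>" "\<alpha> \<le> pi/2"
  shows "\<not> sector \<alpha> \<subseteq> \<real>"
proof -
  have s: "0 < sin \<alpha>" using assms by (intro sin_gt_zero) auto
  have "Complex (cos \<alpha>) (sin \<alpha>) \<in> sector \<alpha>"
    using assms s by (simp add: sector_iff cos_ge_zero)
  moreover have "Complex (cos \<alpha>) (sin \<alpha>) \<notin> \<real>" using s by (simp add: complex_is_Real_iff)
  ultimately show ?thesis by blast
qed

text \<open>Differences of points of a half-line or a sector may leave it. A bounded difference is
  brought back by a single shift far enough along the axis. This later moves a support ball into the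
  region where the weight conditions apply.\<close>

lemma index_set_absorbs_diff:
  assumes "D \<in> index_sets" "0 \<le> R"
  obtains z where "z \<in> D" "\<And>a b. a \<in> D \<Longrightarrow> b \<in> D \<Longrightarrow> cmod (a - b) \<le> R \<Longrightarrow> a - b + z \<in> D"
  using assms(1)
proof (cases rule: index_set_cases)
  case nonneg
  show ?thesis
  proof (rule that)
    show "of_real R \<in> D" using nonneg assms by simp
    fix a b assume "a \<in> D" "b \<in> D" "cmod (a - b) \<le> R"
    then show "a - b + of_real R \<in> D"
      using abs_Re_le_cmod[of "a - b"] by (auto simp: nonneg complex_nonneg_Reals_iff)
  qed
next
  case Reals
  then show ?thesis using that[of 0] by auto
next
  case UNIV
  then show ?thesis using that by blast
next
  case (sector \<alpha>)
  have s: "0 < sin \<alpha>" using sector by (intro sin_gt_zero) auto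
  have c: "0 \<le> cos \<alpha>" using sector by (intro cos_ge_zero) auto
  \<comment> \<open>The summand \<open>R\<close> compensates a negative real part; the summand
    \<open>R / sin \<alpha>\<close> then leaves enough real part to dominate an imaginary part of
    size at most \<open>R\<close>.\<close>
  define p where "p = R + R / sin \<alpha>"
  have p: "0 \<le> p" using s assms by (simp add: p_def)
  show ?thesis
  proof (rule that)
    show "of_real p \<in> D" using sector p s by (simp add: sector_iff)
    fix a b assume "cmod (a - b) \<le> R"
    then have ab: "\<bar>Re (a - b)\<bar> \<le> R" "\<bar>Im (a - b)\<bar> \<le> R"
      using abs_Re_le_cmod[of "a - b"] abs_Im_le_cmod[of "a - b"] by linarith+
    have "0 \<le> R / sin \<alpha>" using s assms by simp
    then have re: "R / sin \<alpha> \<le> Re (a - b + of_real p)" using ab by (simp add: p_def)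
    have "\<bar>Im (a - b)\<bar> * cos \<alpha> \<le> R * 1" using ab assms c by (intro mult_mono) auto
    also have "\<dots> = R / sin \<alpha> * sin \<alpha>" using s by simp
    also have "\<dots> \<le> Re (a - b + of_real p) * sin \<alpha>" using re s by (intro mult_right_mono) auto
    finally show "a - b + of_real p \<in> D"
      using sector re \<open>0 \<le> R / sin \<alpha>\<close> by (simp add: sector_iff)
  qed
qed


section \<open>Lebesgue measure on index sets\<close>

lemma
  assumes D: "D \<in> index_sets" and X: "X \<in> sets borel"
  shows borel_Int_index_measure: "X \<inter> D \<in> sets (index_measure D)"
    and emeasure_index_measure_Int: "emeasure (index_measure D) (X \<inter> D) =
      emeasure (if D \<subseteq> \<real> then embed_measure lebesgue complex_of_real else lebesgue) (X \<inter> D)"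
proof -
  let ?M = "if D \<subseteq> \<real> then embed_measure lebesgue complex_of_real else lebesgue"
  have meas: "Y \<inter> D \<in> sets ?M" if Y: "Y \<in> sets borel" for Y
  proof -
    have YD: "Y \<inter> D \<in> sets borel"
      using Y closed_index_set[OF D] by auto
    show ?thesis
    proof (cases "D \<subseteq> \<real>")
      case True
      have "complex_of_real -` (Y \<inter> D) \<in> sets borel"
        using measurable_sets[OF borel_measurable_continuous_onI YD, of complex_of_real]
        by (simp add: continuous_intros)
      then have "complex_of_real -` (Y \<inter> D) \<in> sets lebesgue"
        by (simp add: sets_completionI_sets)
      then have "complex_of_real ` (complex_of_real -` (Y \<inter> D)) \<in> sets ?M"
        using True by (auto intro: in_sets_embed_measure)
      also have "complex_of_real ` (complex_of_real -` (Y \<inter> D)) = Y \<inter> D"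
        using True by (auto simp: Reals_def)
      finally show ?thesis .
    qed (use YD in \<open>simp add: sets_completionI_sets\<close>)
  qed
  \<comment> \<open>Measurability of \<open>D\<close> for the unrestricted measure is what permits
    dropping \<open>restrict_space\<close>, for the line and the plane alike.\<close>
  have D': "D \<inter> space ?M \<in> sets ?M"
  proof (cases "D \<subseteq> \<real>")
    case True
    then have "D \<inter> space ?M = UNIV \<inter> D" by (auto simp: space_embed_measure Reals_def)
    then show ?thesis using meas[of UNIV] by simp
  qed (use meas[of UNIV] in simp)
  show "X \<inter> D \<in> sets (index_measure D)"
    unfolding index_measure_def sets_restrict_space_iff[OF D'] using meas[OF X] by simp
  show "emeasure (index_measure D) (X \<inter> D) = emeasure ?M (X \<inter> D)"
    unfolding index_measure_def by (rule emeasure_restrict_space[OF D']) simp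
qed

text \<open>This supplies the sets by which return times are thickened. Their points must have the
  form \<open>a + h\<close> with \<open>h\<close> in \<open>D\<close>, since T(a + h) = T(h)T(a)
  needs an admissible time \<open>h\<close>. A ball about \<open>a\<close> would violate this on a
  half-line or in a sector, so its centre is moved inwards by \<open>z\<close>; the translate
  \<open>a + D\<close> stays in \<open>D\<close>, which makes the bound \<open>c\<close> uniform in
  \<open>a\<close>.\<close>

lemma index_measure_translated_balls:
  assumes D: "D \<in> index_sets" and \<eta>: "0 < \<eta>"
  obtains z r c where "0 < r" "cmod z + r \<le> \<eta>" "0 < c"
    "\<And>a h. a \<in> D \<Longrightarrow> a + h \<in> ball (a + z) r \<inter> D \<Longrightarrow> h \<in> D"
    "\<And>a. a \<in> D \<Longrightarrow> ennreal c \<le> emeasure (index_measure D) (ball (a + z) r \<inter> D)"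
proof -
  note witness = that
  have planar: thesis if r: "0 < r" and z: "cmod z + r \<le> \<eta>" and sub: "ball z r \<subseteq> D" and nD: "\<not> D \<subseteq> \<real>" for z r
  proof (rule witness[of r z "pi * r^2"])
    show "0 < r" "cmod z + r \<le> \<eta>" by fact+
    show "0 < pi * r\<^sup>2" using r by simp
    show "h \<in> D" if "a + h \<in> ball (a + z) r \<inter> D" for a h
      using that sub by (auto simp: dist_norm)
    show "ennreal (pi * r\<^sup>2) \<le> emeasure (index_measure D) (ball (a + z) r \<inter> D)" if a: "a \<in> D" for a
    proof -
      have "ball (a + z) r \<subseteq> D"
      proof
        fix x assume "x \<in> ball (a + z) r"
        then have "x - a \<in> D" using sub by (auto simp: dist_norm algebra_simps)
        then show "x \<in> D" using index_set_add[OF D a] by fastforce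
      qed
      then have "ball (a + z) r \<inter> D = ball (a + z) r" by blast
      then have "emeasure (index_measure D) (ball (a + z) r \<inter> D) = emeasure lebesgue (ball (a + z) r)"
        using emeasure_index_measure_Int[OF D, of "ball (a + z) r"] nD by simp
      also have "\<dots> = ennreal (pi * r\<^sup>2)"
        using r by (simp add: emeasure_ball unit_ball_vol_2)
      finally show ?thesis by simp
    qed
  qed
  have linear: thesis if DR: "D \<subseteq> \<real>" and Dpos: "\<real>\<^sub>\<ge>\<^sub>0 \<subseteq> D"
  proof (rule witness[of "\<eta>/2" "of_real (\<eta>/2)" \<eta>])
    have ball: "x \<in> ball (a + of_real (\<eta>/2)) (\<eta>/2) \<longleftrightarrow> Re a < Re x \<and> Re x < Re a + \<eta>"
      if "a \<in> D" "x \<in> \<real>" for a x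
    proof -
      have "a = of_real (Re a)" "x = of_real (Re x)" using that DR by (auto simp: complex_eq_iff complex_is_Real_iff)
      then obtain b y where ab: "a = of_real b" "x = of_real y" by blast
      then have "a + of_real (\<eta>/2) - x = of_real (b + \<eta>/2 - y)" by simp
      then have d: "dist (a + of_real (\<eta>/2)) x = \<bar>b + \<eta>/2 - y\<bar>" unfolding dist_norm by (simp only: norm_of_real)
      have "\<bar>b + \<eta>/2 - y\<bar> < \<eta>/2 \<longleftrightarrow> b < y \<and> y < b + \<eta>" by linarith
      then show ?thesis unfolding mem_ball d using ab by simp
    qed
    show "h \<in> D" if "a \<in> D" "a + h \<in> ball (a + of_real (\<eta>/2)) (\<eta>/2) \<inter> D" for a h
    proof -
      have "a \<in> \<real>" "a + h \<in> \<real>" using that DR by auto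
      then have "h \<in> \<real>" using Reals_diff by fastforce
      moreover have "0 < Re h" using ball[of a "a + h"] that DR by auto
      ultimately have "h \<in> \<real>\<^sub>\<ge>\<^sub>0" by (auto simp: complex_nonneg_Reals_iff complex_is_Real_iff)
      then show ?thesis using Dpos by blast
    qed
    fix a assume a: "a \<in> D"
    have "ball (a + of_real (\<eta>/2)) (\<eta>/2) \<inter> D = complex_of_real ` {Re a <..< Re a + \<eta>}"
    proof (intro set_eqI iffI)
      fix x assume x: "x \<in> ball (a + of_real (\<eta>/2)) (\<eta>/2) \<inter> D"
      then have "x \<in> \<real>" using DR by auto
      then show "x \<in> complex_of_real ` {Re a <..< Re a + \<eta>}"
        using ball[OF a, of x] x by (intro image_eqI[of _ _ "Re x"]) auto
    next
      fix x assume "x \<in> complex_of_real ` {Re a <..< Re a + \<eta>}"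
      then obtain y where y: "x = of_real y" "Re a < y" "y < Re a + \<eta>" by auto
      have "x = a + of_real (y - Re a)" using DR a y(1) by (auto simp: Reals_def)
      moreover have "of_real (y - Re a) \<in> D" using y by (intro subsetD[OF Dpos]) (simp add: complex_nonneg_Reals_iff)
      ultimately have "x \<in> D" using index_set_add[OF D a] by simp
      then show "x \<in> ball (a + of_real (\<eta>/2)) (\<eta>/2) \<inter> D" using ball[OF a, of x] y by simp
    qed
    then have "emeasure (index_measure D) (ball (a + of_real (\<eta>/2)) (\<eta>/2) \<inter> D) =
        emeasure (embed_measure lebesgue complex_of_real) (complex_of_real ` {Re a <..< Re a + \<eta>})"
      using emeasure_index_measure_Int[OF D, of "ball (a + of_real (\<eta>/2)) (\<eta>/2)"] DR by simp
    also have "\<dots> = emeasure lebesgue {Re a <..< Re a + \<eta>}"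
      by (rule emeasure_embed_measure_image) (auto simp: inj_on_def sets_completionI_sets)
    also have "\<dots> = ennreal \<eta>" using \<eta> by simp
    finally show "ennreal \<eta> \<le> emeasure (index_measure D) (ball (a + of_real (\<eta>/2)) (\<eta>/2) \<inter> D)"
      by simp
  qed (use \<eta> in auto)
  from D show thesis
  proof (cases rule: index_set_cases)
    case nonneg
    then show thesis by (intro linear) (auto simp: nonneg_Reals_def)
  next
    case Reals
    then show thesis by (intro linear) (auto simp: nonneg_Reals_def)
  next
    case UNIV
    have "\<i> \<notin> \<real>" by (simp add: complex_is_Real_iff)
    then have "\<not> D \<subseteq> \<real>" using UNIV by blast
    then show thesis using UNIV \<eta> by (intro planar[of \<eta> 0]) simp_all
  next
    case (sector \<alpha>)
    have s: "0 < sin \<alpha>" using sector by (intro sin_gt_zero) auto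
    have c: "0 \<le> cos \<alpha>" using sector by (intro cos_ge_zero) auto
    \<comment> \<open>In the ball of radius \<open>r\<close> about \<eta>/2 the real part is at
      least \<eta>/4, so \<open>Re x * sin \<alpha>\<close> is at least \<open>r\<close> and
      dominates the imaginary part.\<close>
    define r where "r = \<eta> / 4 * sin \<alpha>"
    have r: "0 < r" "r \<le> \<eta> / 4" using s \<eta> by (auto simp: r_def field_simps)
    show thesis
    proof (rule planar[OF r(1), of "of_real (\<eta>/2)"])
      show "cmod (of_real (\<eta>/2)) + r \<le> \<eta>" using r \<eta> by simp
      show "\<not> D \<subseteq> \<real>" using sector not_Reals_sector by simp
      show "ball (of_real (\<eta>/2)) r \<subseteq> D"
      proof
        fix x assume "x \<in> ball (complex_of_real (\<eta>/2)) r"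
        then have "cmod (x - of_real (\<eta>/2)) < r" by (simp add: dist_norm norm_minus_commute)
        then have x: "\<bar>Re x - \<eta>/2\<bar> < r" "\<bar>Im x\<bar> < r"
          using abs_Re_le_cmod[of "x - of_real (\<eta>/2)"] abs_Im_le_cmod[of "x - of_real (\<eta>/2)"] by auto
        have "\<bar>Im x\<bar> * cos \<alpha> \<le> r * 1" using x c r by (intro mult_mono) auto
        also have "\<dots> = \<eta> / 4 * sin \<alpha>" by (simp add: r_def)
        also have "\<dots> \<le> Re x * sin \<alpha>" using x r s by (intro mult_right_mono) (auto simp: abs_if split: if_splits)
        finally show "x \<in> D" using sector x r by (simp add: sector_iff abs_if split: if_splits)
      qed
    qed
  qed
qed


section \<open>Weights and dense sequences\<close>

lemma admissible_weight_pos: "admissible_weight \<Delta> \<rho> \<Longrightarrow> t \<in> \<Delta> \<Longrightarrow> 0 < \<rho> t"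
  by (auto simp: admissible_weight_def)

lemma admissible_weight_shift:
  assumes "admissible_weight \<Delta> \<rho>" "0 \<le> R"
  obtains C where "1 \<le> C"
    "\<And>t t'. t \<in> \<Delta> \<Longrightarrow> t' \<in> \<Delta> \<Longrightarrow> cmod t' \<le> R \<Longrightarrow> \<rho> t \<le> C * \<rho> (t + t')"
proof -
  from assms(1) obtain M \<omega> where M: "1 \<le> M" and pos: "\<And>t. t \<in> \<Delta> \<Longrightarrow> 0 < \<rho> t"
    and adm: "\<And>t t'. t \<in> \<Delta> \<Longrightarrow> t' \<in> \<Delta> \<Longrightarrow> \<rho> t \<le> M * exp (\<omega> * cmod t') * \<rho> (t + t')"
    unfolding admissible_weight_def by blast
  show ?thesis
  proof (rule that)
    have "1 * 1 \<le> M * exp (\<bar>\<omega>\<bar> * R)" using M assms(2) by (intro mult_mono) auto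
    then show "1 \<le> M * exp (\<bar>\<omega>\<bar> * R)" by simp
    fix t t' assume t: "t \<in> \<Delta>" "t' \<in> \<Delta>" "cmod t' \<le> R"
    have "\<omega> * cmod t' \<le> \<bar>\<omega>\<bar> * R" using t(3) by (intro mult_mono) auto
    then have *: "M * exp (\<omega> * cmod t') \<le> M * exp (\<bar>\<omega>\<bar> * R)" using M by simp
    \<comment> \<open>Positivity at \<open>t + t'\<close> is extracted from the admissibility
      inequality itself, so closure of \<Delta> under addition is not invoked.\<close>
    have "0 < M * exp (\<omega> * cmod t') * \<rho> (t + t')"
      using adm[OF t(1,2)] pos[OF t(1)] by linarith
    then have "0 < \<rho> (t + t')" by (rule zero_less_mult_pos) (use M in simp)
    then have "0 \<le> \<rho> (t + t')" by simp
    then show "\<rho> t \<le> M * exp (\<bar>\<omega>\<bar> * R) * \<rho> (t + t')"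
      using adm[OF t(1,2)] mult_right_mono[OF *, of "\<rho> (t + t')"] by linarith
  qed
qed

text \<open>The weight is only measurable, so compactness gives no bound. Instead one point
  \<open>p\<close> dominates a whole ball: every \<open>t\<close> in it reaches \<open>p\<close> by
  the admissible translation \<open>p - t\<close>.\<close>

lemma admissible_weight_locally_bounded:
  assumes "\<Delta> \<in> index_sets" "admissible_weight \<Delta> \<rho>" "0 \<le> R"
  obtains C where "0 < C" "\<And>t. t \<in> \<Delta> \<Longrightarrow> cmod t \<le> R \<Longrightarrow> \<rho> t \<le> C"
proof -
  obtain p where p: "p \<in> \<Delta>" "\<And>t. t \<in> \<Delta> \<Longrightarrow> cmod t \<le> R \<Longrightarrow> p - t \<in> \<Delta>"
    using index_set_absorbs[OF assms(1,3)] by blast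
  obtain C where C: "1 \<le> C"
    "\<And>t t'. t \<in> \<Delta> \<Longrightarrow> t' \<in> \<Delta> \<Longrightarrow> cmod t' \<le> cmod p + R \<Longrightarrow> \<rho> t \<le> C * \<rho> (t + t')"
    using admissible_weight_shift[OF assms(2), of "cmod p + R"] assms(3) by auto
  have "0 < C * \<rho> p" using C(1) admissible_weight_pos[OF assms(2) p(1)] by simp
  moreover have "\<rho> t \<le> C * \<rho> p" if "t \<in> \<Delta>" "cmod t \<le> R" for t
    using C(2)[of t "p - t"] p(2)[OF that] that norm_triangle_ineq4[of p t] by simp
  ultimately show ?thesis using that by blast
qed

lemma C0_weighted_iff:
  assumes "admissible_weight \<Delta> \<rho>"
  shows "u \<in> C0_weighted \<Delta> \<K> \<rho> \<longleftrightarrow> u \<in> \<Delta> \<rightarrow>\<^sub>E \<K> \<and> continuous_on \<Delta> u \<and>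
    (\<forall>\<epsilon>>0. \<exists>Q. \<forall>t\<in>\<Delta>. Q \<le> cmod t \<longrightarrow> cmod (u t) * \<rho> t < \<epsilon>)"
proof -
  have "cmod (u t * of_real (\<rho> t)) = cmod (u t) * \<rho> t" if "t \<in> \<Delta>" for t
    using admissible_weight_pos[OF assms that] by (simp add: norm_mult)
  then have "((\<lambda>t. u t * of_real (\<rho> t)) \<longlongrightarrow> 0) (inf at_infinity (principal \<Delta>)) \<longleftrightarrow>
    (\<forall>\<epsilon>>0. \<exists>Q. \<forall>t\<in>\<Delta>. Q \<le> cmod t \<longrightarrow> cmod (u t) * \<rho> t < \<epsilon>)"
    unfolding tendsto_iff eventually_inf_principal eventually_at_infinity
    by (intro all_cong ex_cong1) auto
  then show ?thesis by (simp add: C0_weighted_def)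
qed

section \<open>Rational polynomials and a dense sequence\<close>

datatype ratpoly = Const rat | ReVar | ImVar | Add ratpoly ratpoly | Mult ratpoly ratpoly

instance ratpoly :: countable
  by countable_datatype

primrec ratpoly_val :: "ratpoly \<Rightarrow> complex \<Rightarrow> real" where
  "ratpoly_val (Const c) z = of_rat c"
| "ratpoly_val ReVar z = Re z"
| "ratpoly_val ImVar z = Im z"
| "ratpoly_val (Add P Q) z = ratpoly_val P z + ratpoly_val Q z"
| "ratpoly_val (Mult P Q) z = ratpoly_val P z * ratpoly_val Q z"

lemma continuous_on_ratpoly_val [continuous_intros]: "continuous_on S (ratpoly_val P)"
  by (induction P) (auto intro!: continuous_intros)

text \<open>Stone-Weierstrass is applied to the uniform closure \<open>R\<close> of the rational
  polynomials, since \<open>function_ring_on\<close> asks for all real constants. Representing these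
  polynomials by a countable datatype of expressions makes the family enumerable.\<close>

lemma ratpoly_dense:
  assumes S: "compact S" and g: "continuous_on S g" and e: "0 < e"
  obtains P where "\<And>x. x \<in> S \<Longrightarrow> \<bar>g x - ratpoly_val P x\<bar> < e"
proof -
  define R where "R = {g. continuous_on S g \<and> (\<forall>e>0. \<exists>P. \<forall>x\<in>S. \<bar>g x - ratpoly_val P x\<bar> < e)}"
  have val: "ratpoly_val P \<in> R" for P
    by (auto simp: R_def intro!: continuous_intros exI[of _ P])
  have R1: "continuous_on S f" and R2: "0 < e \<Longrightarrow> \<exists>P. \<forall>x\<in>S. \<bar>f x - ratpoly_val P x\<bar> < e"
    if "f \<in> R" for f e using that by (auto simp: R_def)
  interpret function_ring_on R S
  proof
    show "compact S" by fact
    show "continuous_on S f" if "f \<in> R" for f using R1 that .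
    fix f g assume fg: "f \<in> R" "g \<in> R"
    show "(\<lambda>x. f x + g x) \<in> R"
      unfolding R_def
    proof (intro CollectI conjI allI impI)
      show "continuous_on S (\<lambda>x. f x + g x)" using fg R1 by (intro continuous_intros) auto
      fix e :: real assume "0 < e"
      then obtain P Q where "\<forall>x\<in>S. \<bar>f x - ratpoly_val P x\<bar> < e/2" "\<forall>x\<in>S. \<bar>g x - ratpoly_val Q x\<bar> < e/2"
        using R2[OF fg(1), of "e/2"] R2[OF fg(2), of "e/2"] by auto
      then show "\<exists>P. \<forall>x\<in>S. \<bar>f x + g x - ratpoly_val P x\<bar> < e"
        by (intro exI[of _ "Add P Q"]) (fastforce simp: abs_if split: if_splits)
    qed
    show "(\<lambda>x. f x * g x) \<in> R"
      unfolding R_def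
    proof (intro CollectI conjI allI impI)
      show "continuous_on S (\<lambda>x. f x * g x)" using fg R1 by (intro continuous_intros) auto
      fix e :: real assume e: "0 < e"
      have "bounded (f ` S)" "bounded (g ` S)"
        using fg R1 S by (auto intro: compact_imp_bounded compact_continuous_image)
      then obtain a b where ab: "\<And>x. x \<in> S \<Longrightarrow> \<bar>f x\<bar> \<le> a" "\<And>x. x \<in> S \<Longrightarrow> \<bar>g x\<bar> \<le> b"
        by (auto simp: bounded_iff)
      define B where "B = max 1 (max a b)"
      \<comment> \<open>The product error is at most d * B + (B + 1) * d, and this is at most 3 * B
        * d because \<open>B \<ge> 1\<close>; the bound \<open>d \<le> 1\<close> gives |p| \<le> B +
        1.\<close>
      define d where "d = min 1 (e / (3 * B))"
      have B: "1 \<le> B" "\<And>x. x \<in> S \<Longrightarrow> \<bar>f x\<bar> \<le> B" "\<And>x. x \<in> S \<Longrightarrow> \<bar>g x\<bar> \<le> B"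
        using ab by (fastforce simp: B_def)+
      have d: "0 < d" "d \<le> 1" "d * (3 * B) \<le> e" using e B(1) by (auto simp: d_def min_def field_simps)
      obtain P Q where P: "\<And>x. x \<in> S \<Longrightarrow> \<bar>f x - ratpoly_val P x\<bar> < d"
        and Q: "\<And>x. x \<in> S \<Longrightarrow> \<bar>g x - ratpoly_val Q x\<bar> < d"
        using R2[OF fg(1) d(1)] R2[OF fg(2) d(1)] by auto
      have "\<bar>f x * g x - ratpoly_val (Mult P Q) x\<bar> < e" if x: "x \<in> S" for x
      proof -
        let ?p = "ratpoly_val P x" and ?q = "ratpoly_val Q x"
        have p: "\<bar>?p\<bar> \<le> B + 1" using B(2)[OF x] P[OF x] d by linarith
        have "f x * g x - ?p * ?q = (f x - ?p) * g x + ?p * (g x - ?q)" by (simp add: algebra_simps)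
        then have "\<bar>f x * g x - ?p * ?q\<bar> \<le> \<bar>f x - ?p\<bar> * \<bar>g x\<bar> + \<bar>?p\<bar> * \<bar>g x - ?q\<bar>"
          by (metis abs_mult abs_triangle_ineq)
        also have "\<bar>f x - ?p\<bar> * \<bar>g x\<bar> \<le> d * B" using P[OF x] B(3)[OF x] d by (intro mult_mono) auto
        also have "\<bar>?p\<bar> * \<bar>g x - ?q\<bar> \<le> (B + 1) * \<bar>g x - ?q\<bar>" using p by (intro mult_right_mono) auto
        also have "(B + 1) * \<bar>g x - ?q\<bar> < (B + 1) * d" using Q[OF x] B(1) by (intro mult_strict_left_mono) auto
        also have "d * B + (B + 1) * d \<le> d * (3 * B)" using d(1) B(1) by (simp add: algebra_simps)
        finally show ?thesis using d(3) by simp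
      qed
      then show "\<exists>P. \<forall>x\<in>S. \<bar>f x * g x - ratpoly_val P x\<bar> < e" by blast
    qed
  next
    fix c :: real
    have "\<exists>P. \<forall>x\<in>S. \<bar>c - ratpoly_val P x\<bar> < e" if "0 < e" for e
    proof -
      obtain q where "c - e < of_rat q" "of_rat q < c + e"
        using of_rat_dense[of "c - e" "c + e"] \<open>0 < e\<close> by auto
      then show ?thesis by (intro exI[of _ "Const q"]) auto
    qed
    then show "(\<lambda>_. c) \<in> R" by (auto simp: R_def)
  next
    fix x y :: complex assume "x \<noteq> y"
    then have "ratpoly_val ReVar x \<noteq> ratpoly_val ReVar y \<or> ratpoly_val ImVar x \<noteq> ratpoly_val ImVar y"
      by (simp add: complex_eq_iff)
    then show "\<exists>f\<in>R. f x \<noteq> f y" using val by blast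
  qed
  obtain h where h: "h \<in> R" "\<And>x. x \<in> S \<Longrightarrow> \<bar>g x - h x\<bar> < e/2"
    using Stone_Weierstrass_basic[OF g, of "e/2"] e by auto
  obtain P where "\<And>x. x \<in> S \<Longrightarrow> \<bar>h x - ratpoly_val P x\<bar> < e/2"
    using R2[OF h(1), of "e/2"] e by auto
  with h(2) have "\<bar>g x - ratpoly_val P x\<bar> < e" if "x \<in> S" for x
    using that by (smt (verit) field_sum_of_halves)
  then show ?thesis using that by blast
qed

text \<open>Rational polynomials are multiplied by a continuous cutoff \<open>\<kappa> n\<close>.
  The error is the combination of h - v and -v with weights \<open>\<kappa>\<close> and 1 -
  \<open>\<kappa>\<close>: polynomial approximation controls the first where the cutoff is nonzero,
  decay of \<open>v\<close> the second where it differs from 1. The functions live on the whole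
  plane, because their translates will overlap \<Delta> only partly.\<close>

lemma C0_weighted_dense_sequence:
  assumes \<Delta>: "\<Delta> \<in> index_sets" and \<K>: "\<K> \<in> {\<real>, UNIV}" and \<rho>: "admissible_weight \<Delta> \<rho>"
  obtains \<phi> :: "nat \<Rightarrow> complex \<Rightarrow> complex"
  where "\<forall>p. continuous_on UNIV (\<phi> p)" "\<forall>p x. \<phi> p x \<in> \<K>"
    "\<forall>p. \<exists>R. \<forall>x. \<phi> p x \<noteq> 0 \<longrightarrow> cmod x < R"
    "\<forall>v r. v \<in> C0_weighted \<Delta> \<K> \<rho> \<longrightarrow> 0 < r \<longrightarrow> (\<exists>p. \<forall>x\<in>\<Delta>. cmod (\<phi> p x - v x) * \<rho> x \<le> r)"
proof -
  define \<kappa> :: "nat \<Rightarrow> complex \<Rightarrow> real" where "\<kappa> n x = max 0 (min 1 (real n + 1 - cmod x))" for n x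
  define h where "h P Q x = Complex (ratpoly_val P x) (if \<K> = \<real> then 0 else ratpoly_val Q x)" for P Q x
  define g where "g = (\<lambda>(n, P, Q) x. of_real (\<kappa> n x) * h P Q x)"
  have h_eq: "h P Q x = of_real (ratpoly_val P x) + \<i> * of_real (if \<K> = \<real> then 0 else ratpoly_val Q x)" for P Q x
    by (simp add: h_def complex_eq_iff)
  show ?thesis
  proof (rule that[of "\<lambda>p. g (from_nat p)"]; intro allI impI)
    fix p
    obtain n P Q where p: "from_nat p = (n :: nat, P :: ratpoly, Q :: ratpoly)" using prod_cases3 by blast
    show "continuous_on UNIV (g (from_nat p))"
      unfolding p g_def h_eq \<kappa>_def by (cases "\<K> = \<real>") (auto intro!: continuous_intros)
    fix x
    show "g (from_nat p) x \<in> \<K>"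
      using \<K> by (auto simp: g_def p h_eq)
    show "\<exists>R. \<forall>x. g (from_nat p) x \<noteq> 0 \<longrightarrow> cmod x < R"
      by (intro exI[of _ "real n + 1"]) (auto simp: g_def p \<kappa>_def)
  next
    fix v r assume v: "v \<in> C0_weighted \<Delta> \<K> \<rho>" and r: "(0::real) < r"
    then obtain Q0 where Q0: "\<And>t. t \<in> \<Delta> \<Longrightarrow> Q0 \<le> cmod t \<Longrightarrow> cmod (v t) * \<rho> t < r/2"
      unfolding C0_weighted_iff[OF \<rho>] by (meson half_gt_zero)
    obtain n :: nat where n: "Q0 \<le> real n" using real_arch_simple by blast
    obtain C where C: "0 < C" "\<And>t. t \<in> \<Delta> \<Longrightarrow> cmod t \<le> real n + 1 \<Longrightarrow> \<rho> t \<le> C"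
      using admissible_weight_locally_bounded[OF \<Delta> \<rho>, of "real n + 1"] by auto
    define S where "S = \<Delta> \<inter> cball 0 (real n + 1)"
    have S: "compact S" unfolding S_def by (rule compact_index_set_Int_cball[OF \<Delta>])
    have "continuous_on \<Delta> v" and vK: "v \<in> \<Delta> \<rightarrow> \<K>" using v by (auto simp: C0_weighted_iff[OF \<rho>])
    then have cv: "continuous_on S (\<lambda>x. Re (v x))" "continuous_on S (\<lambda>x. Im (v x))"
      unfolding S_def by (auto intro!: continuous_intros intro: continuous_on_subset)
    \<comment> \<open>Real and imaginary part are each approximated up to \<open>d\<close>, and the
      weight is at most \<open>C\<close> on \<open>S\<close>; together this costs 2 * d * C =
      r/2.\<close>
    define d where "d = r / (4 * C)"
    have d: "0 < d" "2 * d * C = r/2" using r C(1) by (auto simp: d_def)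
    obtain P where P: "\<And>x. x \<in> S \<Longrightarrow> \<bar>Re (v x) - ratpoly_val P x\<bar> < d" using ratpoly_dense[OF S cv(1) d(1)] by blast
    obtain Q where Q: "\<And>x. x \<in> S \<Longrightarrow> \<bar>Im (v x) - ratpoly_val Q x\<bar> < d" using ratpoly_dense[OF S cv(2) d(1)] by blast
    have "cmod (g (n, P, Q) x - v x) * \<rho> x \<le> r" if x: "x \<in> \<Delta>" for x
    proof -
      have pos: "0 < \<rho> x" using admissible_weight_pos[OF \<rho> x] .
      have \<kappa>: "0 \<le> \<kappa> n x" "\<kappa> n x \<le> 1" by (auto simp: \<kappa>_def)
      have "g (n, P, Q) x - v x = of_real (\<kappa> n x) * (h P Q x - v x) + of_real (1 - \<kappa> n x) * (- v x)"
        by (simp add: g_def algebra_simps)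
      then have "cmod (g (n, P, Q) x - v x) \<le> cmod (of_real (\<kappa> n x) * (h P Q x - v x)) + cmod (of_real (1 - \<kappa> n x) * (- v x))"
        by (metis norm_triangle_ineq)
      also have "\<dots> = \<kappa> n x * cmod (h P Q x - v x) + (1 - \<kappa> n x) * cmod (v x)"
        using \<kappa> by (simp only: norm_mult norm_of_real norm_minus_cancel abs_of_nonneg diff_ge_0_iff_ge)
      finally have "cmod (g (n, P, Q) x - v x) \<le> \<kappa> n x * cmod (h P Q x - v x) + (1 - \<kappa> n x) * cmod (v x)" .
      from mult_right_mono[OF this, of "\<rho> x"]
      have 1: "cmod (g (n, P, Q) x - v x) * \<rho> x \<le> \<kappa> n x * (cmod (h P Q x - v x) * \<rho> x) + (1 - \<kappa> n x) * (cmod (v x) * \<rho> x)"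
        using pos by (simp add: distrib_right mult.assoc)
      have 2: "\<kappa> n x * (cmod (h P Q x - v x) * \<rho> x) \<le> r/2"
      proof (cases "cmod x \<le> real n + 1")
        case True
        then have xS: "x \<in> S" using x by (simp add: S_def)
        have Im: "Im (v x) = 0" if "\<K> = \<real>" using vK x that by (auto simp: complex_is_Real_iff Pi_iff)
        have "cmod (h P Q x - v x) \<le> \<bar>Re (h P Q x - v x)\<bar> + \<bar>Im (h P Q x - v x)\<bar>" by (rule cmod_le)
        also have "\<dots> \<le> d + d"
          using P[OF xS] Q[OF xS] Im d(1) by (intro add_mono) (auto simp: h_def abs_minus_commute)
        finally have "cmod (h P Q x - v x) * \<rho> x \<le> (2 * d) * C" using C(2)[OF x True] d(1) pos by (intro mult_mono) auto
        then have "\<kappa> n x * (cmod (h P Q x - v x) * \<rho> x) \<le> 1 * (2 * d * C)"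
          using \<kappa> d C(1) pos by (intro mult_mono[of "\<kappa> n x" 1 "cmod (h P Q x - v x) * \<rho> x" "2 * d * C"]) auto
        then show ?thesis using d(2) by simp
      qed (use r in \<open>simp add: \<kappa>_def\<close>)
      have 3: "(1 - \<kappa> n x) * (cmod (v x) * \<rho> x) \<le> r/2"
      proof (cases "cmod x \<le> real n")
        case False
        then have "(1 - \<kappa> n x) * (cmod (v x) * \<rho> x) \<le> 1 * (r/2)"
          using \<kappa> n Q0[OF x] pos by (intro mult_mono) auto
        then show ?thesis by simp
      qed (use r in \<open>simp add: \<kappa>_def\<close>)
      show ?thesis using 1 2 3 by simp
    qed
    then show "\<exists>p. \<forall>x\<in>\<Delta>. cmod (g (from_nat p) x - v x) * \<rho> x \<le> r"
      by (intro exI[of _ "to_nat (n, P, Q)"]) simp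
  qed
qed


section \<open>The frequently approximating vector\<close>

text \<open>Enumerating pairs (function, copy number) makes each function recur at arbitrarily late
  indices, as the error budget shrinks with the index and not with the function. Radii and bounds
  are replaced by partial sums to make them monotone, so data of two indices can be compared at the
  larger one.\<close>

lemma C0_weighted_graded_sequence:
  assumes \<Delta>: "\<Delta> \<in> index_sets" and \<K>: "\<K> \<in> {\<real>, UNIV}" and \<rho>: "admissible_weight \<Delta> \<rho>"
  obtains \<phi> :: "nat \<Rightarrow> complex \<Rightarrow> complex" and R B :: "nat \<Rightarrow> real"
  where "\<forall>p. continuous_on UNIV (\<phi> p)" "\<forall>p x. \<phi> p x \<in> \<K>" "mono R" "mono B"
    "\<forall>p x. \<phi> p x \<noteq> 0 \<longrightarrow> cmod x < R p" "\<forall>p x. cmod (\<phi> p x) \<le> B p"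
    "\<forall>v r P. v \<in> C0_weighted \<Delta> \<K> \<rho> \<longrightarrow> 0 < r \<longrightarrow> (\<exists>p\<ge>P. \<forall>x\<in>\<Delta>. cmod (\<phi> p x - v x) * \<rho> x \<le> r)"
proof -
  obtain \<psi> :: "nat \<Rightarrow> complex \<Rightarrow> complex"
  where \<psi>': "\<forall>p. continuous_on UNIV (\<psi> p)" "\<forall>p x. \<psi> p x \<in> \<K>"
    "\<forall>p. \<exists>R. \<forall>x. \<psi> p x \<noteq> 0 \<longrightarrow> cmod x < R"
    "\<forall>v r. v \<in> C0_weighted \<Delta> \<K> \<rho> \<longrightarrow> 0 < r \<longrightarrow> (\<exists>p. \<forall>x\<in>\<Delta>. cmod (\<psi> p x - v x) * \<rho> x \<le> r)"
    by (rule C0_weighted_dense_sequence[OF assms]) (rule that)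
  note \<psi> = \<psi>'[rule_format]
  have "\<exists>R B. 0 \<le> R \<and> 0 \<le> B \<and> (\<forall>x. \<psi> p x \<noteq> 0 \<longrightarrow> cmod x < R) \<and> (\<forall>x. cmod (\<psi> p x) \<le> B)" for p
  proof -
    obtain R where R: "\<And>x. \<psi> p x \<noteq> 0 \<Longrightarrow> cmod x < R" using \<psi>(3)[of p] by blast
    have "compact (\<psi> p ` cball 0 R)"
      using \<psi>(1)[of p] by (intro compact_continuous_image) (auto intro: continuous_on_subset)
    then obtain B where B: "\<And>x. cmod x \<le> R \<Longrightarrow> cmod (\<psi> p x) \<le> B"
      by (force dest!: compact_imp_bounded simp: bounded_iff)
    have "cmod (\<psi> p x) \<le> max B 0" for x
      using B[of x] R[of x] by (cases "\<psi> p x = 0") auto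
    moreover have "\<psi> p x \<noteq> 0 \<longrightarrow> cmod x < max R 0" for x using R[of x] by auto
    ultimately show ?thesis by (intro exI[of _ "max R 0"] exI[of _ "max B 0"]) auto
  qed
  then obtain R0 B0 where RB: "\<And>p. 0 \<le> R0 p" "\<And>p. 0 \<le> B0 p"
    "\<And>p x. \<psi> p x \<noteq> 0 \<Longrightarrow> cmod x < R0 p" "\<And>p x. cmod (\<psi> p x) \<le> B0 p"
    by metis
  define \<sigma> where "\<sigma> = (\<lambda>p. fst (prod_decode p))"
  define R where "R p = (\<Sum>q\<le>p. R0 (\<sigma> q))" for p
  define B where "B p = (\<Sum>q\<le>p. B0 (\<sigma> q))" for p
  have R0_le: "R0 (\<sigma> p) \<le> R p" for p
    unfolding R_def using member_le_sum[of p "{..p}" "\<lambda>q. R0 (\<sigma> q)"] RB(1) by simp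
  have B0_le: "B0 (\<sigma> p) \<le> B p" for p
    unfolding B_def using member_le_sum[of p "{..p}" "\<lambda>q. B0 (\<sigma> q)"] RB(2) by simp
  show ?thesis
  proof (rule that[of "\<lambda>p. \<psi> (\<sigma> p)" R B]; (intro allI impI)?)
    show "mono R" unfolding R_def by (intro monoI sum_mono2) (auto simp: RB)
    show "mono B" unfolding B_def by (intro monoI sum_mono2) (auto simp: RB)
    show "cmod x < R p" if "\<psi> (\<sigma> p) x \<noteq> 0" for p x using RB(3)[OF that] R0_le[of p] by simp
    show "cmod (\<psi> (\<sigma> p) x) \<le> B p" for p x using RB(4)[of "\<sigma> p" x] B0_le[of p] by simp
    fix v r P assume "v \<in> C0_weighted \<Delta> \<K> \<rho>" "(0::real) < r"
    then obtain i where "\<forall>x\<in>\<Delta>. cmod (\<psi> i x - v x) * \<rho> x \<le> r" using \<psi>(4) by blast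
    then show "\<exists>p\<ge>P. \<forall>x\<in>\<Delta>. cmod (\<psi> (\<sigma> p) x - v x) * \<rho> x \<le> r"
      by (intro exI[of _ "prod_encode (i, P)"]) (simp add: \<sigma>_def le_prod_encode_2)
  qed (use \<psi> in auto)
qed

text \<open>By \<open>loc\<close> only finitely many summands are nonzero on a ball, so
  \<open>w\<close> agrees there with a finite sum of continuous functions. At each point the sum has
  at most one term, which gives the exact value of \<open>w\<close> on every support.\<close>

lemma continuous_on_disjoint_superposition:
  fixes s :: "nat \<Rightarrow> 'a::real_normed_vector \<Rightarrow> 'b::real_normed_vector"
  assumes cont: "\<And>j. continuous_on UNIV (s j)"
    and disj: "\<And>i j x. s i x \<noteq> 0 \<Longrightarrow> s j x \<noteq> 0 \<Longrightarrow> i = j"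
    and loc: "\<And>Q. \<exists>J. \<forall>j x. s j x \<noteq> 0 \<and> norm x < Q \<longrightarrow> j < (J::nat)"
  obtains w where "continuous_on UNIV w" "\<And>j x. s j x \<noteq> 0 \<Longrightarrow> w x = s j x"
    "\<And>x. (\<And>j. s j x = 0) \<Longrightarrow> w x = 0"
proof
  define w where "w x = (\<Sum>j | s j x \<noteq> 0. s j x)" for x
  show "w x = s j x" if "s j x \<noteq> 0" for j x
  proof -
    have "{j. s j x \<noteq> 0} = {j}" using disj that by blast
    then show ?thesis by (simp add: w_def)
  qed
  show "w x = 0" if "\<And>j. s j x = 0" for x using that by (simp add: w_def)
  have "isCont w x" for x
  proof -
    obtain J where J: "\<And>j y. s j y \<noteq> 0 \<Longrightarrow> norm y < norm x + 1 \<Longrightarrow> j < J" using loc by meson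
    have "continuous_on (ball 0 (norm x + 1)) (\<lambda>y. \<Sum>j<J. s j y)"
      by (intro continuous_intros continuous_on_subset[OF cont]) auto
    moreover have "(\<Sum>j<J. s j y) = w y" if "y \<in> ball 0 (norm x + 1)" for y
      unfolding w_def using that J by (intro sum.mono_neutral_right) auto
    ultimately have "continuous_on (ball 0 (norm x + 1)) w"
      by (rule continuous_on_eq)
    then show ?thesis by (simp add: continuous_on_eq_continuous_at)
  qed
  then show "continuous_on UNIV w" by (intro continuous_at_imp_continuous_on) blast
qed

text \<open>\<open>small\<close> and \<open>orbit\<close> range over balls of the plane because the
  supports do. \<open>small\<close> bounds foreign translates seen at the time belonging to
  \<open>i\<close>, while \<open>orbit\<close> bounds the tail of the superposition and thus puts
  \<open>u\<close> into the space. The conclusion counts indices instead of times, so that one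
  vector serves the discrete and the continuous statements.\<close>

lemma C0_weighted_frequently_approximating:
  fixes b :: "nat \<Rightarrow> nat"
  assumes \<Delta>: "\<Delta> \<in> index_sets" and \<K>: "\<K> \<in> {\<real>, UNIV}" and \<rho>: "admissible_weight \<Delta> \<rho>"
    and t0: "t0 \<noteq> 0" and b: "mono b"
    and gaps: "\<And>C::real. \<exists>N. \<forall>j. N \<le> Suc j \<longrightarrow> C < real (b (Suc j)) - real (b j)"
    and small: "\<And>R \<epsilon>. 0 < \<epsilon> \<Longrightarrow> \<exists>N. \<forall>i j y. 1 \<le> i \<and> 1 \<le> j \<and> (i + N \<le> j \<or> j + N \<le> i) \<and> cmod y \<le> R \<and>
      y + t0 * (of_nat (b j) - of_nat (b i)) \<in> \<Delta> \<longrightarrow> \<rho> (y + t0 * (of_nat (b j) - of_nat (b i))) < \<epsilon>"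
    and orbit: "\<And>R \<epsilon>. 0 < \<epsilon> \<Longrightarrow> \<exists>N. \<forall>j y. N \<le> j \<and> cmod y \<le> R \<and>
      y + t0 * of_nat (b j) \<in> \<Delta> \<longrightarrow> \<rho> (y + t0 * of_nat (b j)) < \<epsilon>"
  obtains u where "u \<in> C0_weighted \<Delta> \<K> \<rho>"
    "\<And>v r. v \<in> C0_weighted \<Delta> \<K> \<rho> \<Longrightarrow> 0 < r \<Longrightarrow> \<exists>S D. 0 < D \<and> (\<forall>n. n div D \<le> card (S \<inter> {1..n})) \<and>
      (\<forall>k\<in>S. 1 \<le> k \<and> b k < b (Suc k) \<and>
        (\<forall>x\<in>\<Delta>. x + t0 * of_nat (b k) \<in> \<Delta> \<longrightarrow> cmod (u (x + t0 * of_nat (b k)) - v x) * \<rho> x \<le> r))"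
proof -
  obtain \<phi> :: "nat \<Rightarrow> complex \<Rightarrow> complex" and R B :: "nat \<Rightarrow> real"
  where \<phi>: "\<forall>p. continuous_on UNIV (\<phi> p)" "\<forall>p x. \<phi> p x \<in> \<K>" and RB: "mono R" "mono B"
    and \<phi>': "\<forall>p x. \<phi> p x \<noteq> 0 \<longrightarrow> cmod x < R p" "\<forall>p x. cmod (\<phi> p x) \<le> B p"
    "\<forall>v r P. v \<in> C0_weighted \<Delta> \<K> \<rho> \<longrightarrow> 0 < r \<longrightarrow> (\<exists>p\<ge>P. \<forall>x\<in>\<Delta>. cmod (\<phi> p x - v x) * \<rho> x \<le> r)"
    by (rule C0_weighted_graded_sequence[OF \<Delta> \<K> \<rho>]) (rule that)
  note \<phi> = \<phi>[rule_format]
  note supp = \<phi>'(1)[rule_format] and bnd = \<phi>'(2)[rule_format] and dense = \<phi>'(3)[rule_format]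
  have B0: "0 \<le> B p" for p using bnd[of p 0] norm_ge_zero order_trans by blast
  define \<epsilon> :: "nat \<Rightarrow> real" where "\<epsilon> p = 1 / real (Suc p)" for p
  have \<epsilon>: "0 < \<epsilon> p" for p by (simp add: \<epsilon>_def)
  have \<epsilon>_mono: "\<epsilon> q \<le> \<epsilon> p" if "p \<le> q" for p q using that by (simp add: \<epsilon>_def frac_le)
  have \<epsilon>_lim: "\<exists>P. \<forall>p\<ge>P. \<epsilon> p < r" if "0 < r" for r
    using that \<epsilon>_mono reals_Archimedean[of r] unfolding \<epsilon>_def inverse_eq_divide
    by (metis le_less_trans of_nat_Suc \<epsilon>_def)
  \<comment> \<open>\<open>N\<close> is a sufficient distance for class \<open>p\<close>: cross
    terms, tail and overlap of supports are all under control. The factor 2 in the last clause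
    covers two radii bounded by \<open>R p\<close>. Its premise \<open>N \<le> Suc j\<close>
    includes the gap ending at index \<open>N\<close>, so both gaps adjacent to any positive index
    at or above \<open>N\<close> are large.\<close>
  define good where "good p N \<longleftrightarrow>
      (\<forall>i j y. 1 \<le> i \<and> 1 \<le> j \<and> (i + N \<le> j \<or> j + N \<le> i) \<and> cmod y \<le> R p \<and>
        y + t0 * (of_nat (b j) - of_nat (b i)) \<in> \<Delta> \<longrightarrow> B p * \<rho> (y + t0 * (of_nat (b j) - of_nat (b i))) \<le> \<epsilon> p) \<and>
      (\<forall>j y. N \<le> j \<and> cmod y \<le> R p \<and> y + t0 * of_nat (b j) \<in> \<Delta> \<longrightarrow> B p * \<rho> (y + t0 * of_nat (b j)) \<le> \<epsilon> p) \<and>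
      (\<forall>j. N \<le> Suc j \<longrightarrow> 2 * R p < cmod t0 * (real (b (Suc j)) - real (b j)) \<and> b j < b (Suc j))" for p N
  have good_ex: "\<exists>N. good p N" for p
  proof -
    define \<epsilon>' where "\<epsilon>' = \<epsilon> p / (B p + 1)"
    have \<epsilon>': "0 < \<epsilon>'" using \<epsilon>[of p] B0[of p] by (simp add: \<epsilon>'_def)
    have mult: "B p * x \<le> \<epsilon> p" if "x < \<epsilon>'" for x
    proof -
      have "B p * x \<le> B p * \<epsilon>'" using that B0[of p] by (intro mult_left_mono) auto
      also have "\<dots> \<le> \<epsilon> p" using \<epsilon>[of p] B0[of p] by (simp add: \<epsilon>'_def field_simps)
      finally show ?thesis .
    qed
    obtain N1 where N1: "\<And>i j y. 1 \<le> i \<Longrightarrow> 1 \<le> j \<Longrightarrow> i + N1 \<le> j \<or> j + N1 \<le> i \<Longrightarrow> cmod y \<le> R p \<Longrightarrow>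
      y + t0 * (of_nat (b j) - of_nat (b i)) \<in> \<Delta> \<Longrightarrow> \<rho> (y + t0 * (of_nat (b j) - of_nat (b i))) < \<epsilon>'"
      using small[OF \<epsilon>', of "R p"] by blast
    obtain N2 where N2: "\<And>j y. N2 \<le> j \<Longrightarrow> cmod y \<le> R p \<Longrightarrow>
      y + t0 * of_nat (b j) \<in> \<Delta> \<Longrightarrow> \<rho> (y + t0 * of_nat (b j)) < \<epsilon>'"
      using orbit[OF \<epsilon>', of "R p"] by blast
    obtain N3 where N3: "\<And>j. N3 \<le> Suc j \<Longrightarrow> max 0 (2 * R p / cmod t0) < real (b (Suc j)) - real (b j)"
      using gaps by blast
    have N3': "2 * R p < cmod t0 * (real (b (Suc j)) - real (b j)) \<and> b j < b (Suc j)" if "N3 \<le> Suc j" for j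
    proof -
      have "2 * R p / cmod t0 < real (b (Suc j)) - real (b j)" "b j < b (Suc j)"
        using N3[OF that] by simp_all
      then show ?thesis using t0 by (simp add: pos_divide_less_eq mult.commute)
    qed
    have "good p (max N1 (max N2 N3))"
      unfolding good_def
    proof (intro conjI allI impI; (elim conjE)?)
      fix i j y
      assume "1 \<le> i" "1 \<le> j" "i + max N1 (max N2 N3) \<le> j \<or> j + max N1 (max N2 N3) \<le> i" "cmod y \<le> R p"
        "y + t0 * (of_nat (b j) - of_nat (b i)) \<in> \<Delta>"
      then show "B p * \<rho> (y + t0 * (of_nat (b j) - of_nat (b i))) \<le> \<epsilon> p"
        by (intro mult N1) linarith+
    next
      fix j y
      assume "max N1 (max N2 N3) \<le> j" "cmod y \<le> R p" "y + t0 * of_nat (b j) \<in> \<Delta>"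
      then show "B p * \<rho> (y + t0 * of_nat (b j)) \<le> \<epsilon> p"
        by (intro mult N2) auto
    qed (use N3' in auto)
    then show ?thesis by blast
  qed
  have good_mono: "good p N'" if "good p N" "N \<le> N'" for p N N'
    unfolding good_def
  proof (intro conjI allI impI; (elim conjE)?)
    fix i j y
    assume "1 \<le> i" "1 \<le> j" "i + N' \<le> j \<or> j + N' \<le> i" "cmod y \<le> R p"
      "y + t0 * (of_nat (b j) - of_nat (b i)) \<in> \<Delta>"
    moreover from this have "i + N \<le> j \<or> j + N \<le> i" using that(2) by linarith
    ultimately show "B p * \<rho> (y + t0 * (of_nat (b j) - of_nat (b i))) \<le> \<epsilon> p"
      using that(1) unfolding good_def by blast
  qed (use that in \<open>auto simp: good_def\<close>)
  obtain N0 where N0: "\<And>p. good p (N0 p)" using good_ex by metis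
  \<comment> \<open>The added 1 makes \<open>N\<close> strictly increasing: distinct
    \<open>p\<close> then select distinct classes \<open>A' (N p)\<close>, and the distance between
    two of them is \<open>N (max p q)\<close>.\<close>
  define N where "N p = (\<Sum>q\<le>p. N0 q + 1)" for p
  have "N0 p \<le> N p" for p
    unfolding N_def using member_le_sum[of p "{..p}" "\<lambda>q. N0 q + 1"] by simp
  then have N: "good p (N p)" for p using N0 good_mono by blast
  have N_mono: "strict_mono N" by (rule strict_monoI_Suc) (simp add: N_def)
  have near: "B p * \<rho> x \<le> \<epsilon> p"
    if "1 \<le> i" "1 \<le> j" "i + N p \<le> j \<or> j + N p \<le> i" "cmod y \<le> R p" "x = y + t0 * (of_nat (b j) - of_nat (b i))" "x \<in> \<Delta>"
    for p i j x y using N[of p] that unfolding good_def by blast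
  have far: "B p * \<rho> x \<le> \<epsilon> p"
    if "N p \<le> j" "cmod y \<le> R p" "x = y + t0 * of_nat (b j)" "x \<in> \<Delta>" for p j x y
    using N[of p] that unfolding good_def by blast
  have gap: "2 * R p < cmod t0 * (real (b (Suc j)) - real (b j))" "b j < b (Suc j)" if "N p \<le> Suc j" for p j
    using N[of p] that unfolding good_def by blast+

  obtain A' :: "nat \<Rightarrow> nat set" where A'_all: "\<forall>r. \<exists>D>0. \<forall>n. n div D \<le> card (A' r \<inter> {1..n})"
    "\<forall>r s i j. i \<in> A' r \<longrightarrow> j \<in> A' s \<longrightarrow> i < j \<longrightarrow> i + max r s \<le> j"
    "\<forall>r s i. i \<in> A' r \<longrightarrow> i \<in> A' s \<longrightarrow> r = s"
    "\<forall>r i. i \<in> A' r \<longrightarrow> max 1 r \<le> i"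
    by (rule separated_sets) (rule that)
  note A' = A'_all(1)[rule_format] and A'_sep = A'_all(2)[rule_format]
    and A'_disj = A'_all(3)[rule_format] and A'_ge = A'_all(4)[rule_format]
  define A where "A p = A' (N p)" for p
  have A_sep: "i + N (max p q) \<le> j" if "i \<in> A p" "j \<in> A q" "i < j" for p q i j
    using A'_sep[of i "N p" j "N q"] that by (simp add: A_def max_def split: if_splits)
  have A_disj: "p = q" if "i \<in> A p" "i \<in> A q" for p q i
    using A'_disj[of i "N p" "N q"] that strict_mono_eq[OF N_mono] by (simp add: A_def)
  have A_ge: "1 \<le> i" "N p \<le> i" if "i \<in> A p" for p i using A'_ge that by (force simp: A_def)+

  define s where "s j x = (if \<exists>p. j \<in> A p then \<phi> (THE p. j \<in> A p) (x - t0 * of_nat (b j)) else 0)" for j x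
  have s_A: "s j x = \<phi> p (x - t0 * of_nat (b j))" if "j \<in> A p" for j p x
  proof -
    have "(THE p. j \<in> A p) = p" using that A_disj by blast
    then show ?thesis using that by (auto simp: s_def)
  qed
  have s_E: "\<exists>p. j \<in> A p \<and> cmod (x - t0 * of_nat (b j)) < R p" if "s j x \<noteq> 0" for j x
    using that s_A[of j _ x] supp by (metis s_def)
  have disj_less: False if ij: "i < j" and si: "s i x \<noteq> 0" and sj: "s j x \<noteq> 0" for i j x
  proof -
    obtain p q where p: "i \<in> A p" "cmod (x - t0 * of_nat (b i)) < R p"
      and q: "j \<in> A q" "cmod (x - t0 * of_nat (b j)) < R q"
      using s_E[OF si] s_E[OF sj] by blast
    have "t0 * of_real (real (b j) - real (b i)) = (x - t0 * of_nat (b i)) - (x - t0 * of_nat (b j))"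
      by (simp add: algebra_simps)
    then have "cmod (t0 * of_real (real (b j) - real (b i))) < R p + R q"
      using norm_triangle_ineq4[of "x - t0 * of_nat (b i)" "x - t0 * of_nat (b j)"] p q by simp
    moreover have "b i \<le> b j" using b ij by (simp add: monoD)
    ultimately have lt: "cmod t0 * (real (b j) - real (b i)) < R p + R q" by (simp only: norm_mult norm_of_real)
    \<comment> \<open>The class with the larger index decides. If it is that of \<open>j\<close>,
      the gap just below \<open>j\<close> already exceeds both radii together; if it is that of
      \<open>i\<close>, the gap just above \<open>i\<close> does.\<close>
    show False
    proof (cases "p \<le> q")
      case True
      obtain j' where j': "j = Suc j'" "i \<le> j'" using ij by (cases j) auto
      have "cmod t0 * (real (b (Suc j')) - real (b j')) \<le> cmod t0 * (real (b j) - real (b i))"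
        using monoD[OF b j'(2)] j'(1) by (intro mult_left_mono) auto
      then show False using gap(1)[of q j'] A_ge(2)[OF q(1)] j' lt monoD[OF RB(1) True] by simp
    next
      case False
      have "cmod t0 * (real (b (Suc i)) - real (b i)) \<le> cmod t0 * (real (b j) - real (b i))"
        using monoD[OF b, of "Suc i" j] ij by (intro mult_left_mono) auto
      then show False using gap(1)[of p i] A_ge(2)[OF p(1)] lt monoD[OF RB(1), of q p] False by simp
    qed
  qed
  have b_lim: "\<exists>J. \<forall>j\<ge>J. C < real (b j)" for C :: real
  proof -
    obtain N1 where N1: "\<And>j. N1 \<le> Suc j \<Longrightarrow> 0 < real (b (Suc j)) - real (b j)" using gaps[of 0] by blast
    have *: "i \<le> b (N1 + i)" for i
    proof (induction i)
      case (Suc i)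
      then show ?case using N1[of "N1 + i"] by simp
    qed simp
    obtain i :: nat where "C < real i" using reals_Archimedean2 by blast
    then have "C < real (b j)" if "N1 + i \<le> j" for j
      using *[of i] monoD[OF b that] by linarith
    then show ?thesis by blast
  qed
  obtain w where w: "continuous_on UNIV w" "\<And>j x. s j x \<noteq> 0 \<Longrightarrow> w x = s j x"
    "\<And>x. (\<And>j. s j x = 0) \<Longrightarrow> w x = 0"
  proof (rule continuous_on_disjoint_superposition[of s])
    show "continuous_on UNIV (s j)" for j
    proof (cases "\<exists>p. j \<in> A p")
      case True
      then obtain p where "j \<in> A p" by blast
      then have "s j = (\<lambda>x. \<phi> p (x - t0 * of_nat (b j)))" using s_A by blast
      then show ?thesis
        by (auto intro!: continuous_on_compose2[OF \<phi>(1)[of p]] continuous_intros)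
    qed (simp add: s_def)
    show "i = j" if "s i x \<noteq> 0" "s j x \<noteq> 0" for i j x
      using disj_less that by (meson linorder_neqE_nat)
    fix Q :: real
    \<comment> \<open>The gap below \<open>j\<close> makes \<open>R p\<close> less than half of
      \<open>cmod t0 * b j\<close>, so every point of the j-th support has modulus above half of
      this. Hence the threshold depends on \<open>Q\<close> alone and not on the class of
      \<open>j\<close>.\<close>
    obtain J where J: "\<And>j. J \<le> j \<Longrightarrow> 2 * Q / cmod t0 < real (b j)" using b_lim by blast
    show "\<exists>J. \<forall>j x. s j x \<noteq> 0 \<and> cmod x < Q \<longrightarrow> j < J"
    proof (intro exI[of _ J] allI impI, elim conjE, rule ccontr)
      fix j x assume x: "s j x \<noteq> 0" "cmod x < Q" "\<not> j < J"
      obtain p where p: "j \<in> A p" "cmod (x - t0 * of_nat (b j)) < R p" using s_E x(1) by blast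
      obtain j' where j': "j = Suc j'" using A_ge(1)[OF p(1)] by (cases j) auto
      have "2 * R p < cmod t0 * (real (b j) - real (b j'))" using gap(1)[of p j'] A_ge(2)[OF p(1)] j' by simp
      also have "\<dots> \<le> cmod t0 * real (b j)" by (intro mult_left_mono) auto
      finally have 1: "2 * R p < cmod t0 * real (b j)" .
      have "cmod t0 * real (b j) = cmod (t0 * of_nat (b j))" by (simp add: norm_mult)
      also have "\<dots> \<le> cmod x + cmod (x - t0 * of_nat (b j))"
        using norm_triangle_ineq4[of x "x - t0 * of_nat (b j)"] by simp
      finally have "cmod t0 * real (b j) < 2 * Q" using 1 p(2) x(2) by simp
      then show False using J[of j] x(3) t0 by (simp add: field_simps)
    qed
  qed blast
  have w_E: "w x = 0 \<or> (\<exists>j p. j \<in> A p \<and> w x = \<phi> p (x - t0 * of_nat (b j)) \<and> cmod (x - t0 * of_nat (b j)) < R p)" for x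
  proof (cases "\<forall>j. s j x = 0")
    case False
    then obtain j where j: "s j x \<noteq> 0" by blast
    then obtain p where p: "j \<in> A p" "cmod (x - t0 * of_nat (b j)) < R p" using s_E by blast
    then have "w x = \<phi> p (x - t0 * of_nat (b j))" using w(2)[OF j] s_A by simp
    then show ?thesis using p by blast
  qed (use w(3) in blast)
  have w_K: "w x \<in> \<K>" for x using w_E[of x] \<phi>(2) \<K> by auto
  have approx: "cmod (w (x + t0 * of_nat (b k)) - \<phi> p x) * \<rho> x \<le> \<epsilon> p" if k: "k \<in> A p" and x: "x \<in> \<Delta>" for k p x
  proof (cases "s k (x + t0 * of_nat (b k)) = 0")
    case False
    have "w (x + t0 * of_nat (b k)) = \<phi> p x" using w(2)[OF False] s_A[OF k] by simp
    then show ?thesis using \<epsilon>[of p] by simp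
  next
    case True
    then have \<phi>0: "\<phi> p x = 0" using s_A[OF k] by simp
    show ?thesis
    proof (cases "\<forall>j. s j (x + t0 * of_nat (b k)) = 0")
      case True
      then show ?thesis using \<phi>0 w(3) \<epsilon>[of p] by simp
    next
      case nz: False
      then obtain j where sj: "s j (x + t0 * of_nat (b k)) \<noteq> 0" by blast
      define y where "y = x + t0 * of_nat (b k) - t0 * of_nat (b j)"
      obtain q where q: "j \<in> A q" "cmod y < R q" using s_E[OF sj] by (auto simp: y_def)
      have jk: "j \<noteq> k" using sj True by blast
      \<comment> \<open>The foreign function has index \<open>q\<close>, the error is wanted for
        \<open>p\<close>, and the distance of the two positions is at least
        \<open>N (max p q)\<close>; at the index \<open>m\<close> all bounds apply
        simultaneously.\<close>
      define m where "m = max p q"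
      have m: "k + N m \<le> j \<or> j + N m \<le> k"
        using A_sep[OF k q(1)] A_sep[OF q(1) k] jk by (auto simp: m_def max.commute linorder_neq_iff)
      have pos: "0 < \<rho> x" using admissible_weight_pos[OF \<rho> x] .
      have "cmod (w (x + t0 * of_nat (b k)) - \<phi> p x) * \<rho> x = cmod (\<phi> q y) * \<rho> x"
        using w(2)[OF sj] s_A[OF q(1)] \<phi>0 by (simp add: y_def)
      also have "\<dots> \<le> B m * \<rho> x"
        using bnd[of q y] monoD[OF RB(2), of q m] pos by (intro mult_right_mono) (auto simp: m_def)
      also have "\<dots> \<le> \<epsilon> m"
      proof (rule near[of k j m y x])
        show "cmod y \<le> R m" using q(2) monoD[OF RB(1), of q m] by (simp add: m_def)
      qed (use m x A_ge k q in \<open>auto simp: y_def algebra_simps\<close>)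
      also have "\<dots> \<le> \<epsilon> p" by (rule \<epsilon>_mono) (simp add: m_def)
      finally show ?thesis .
    qed
  qed
  have decay: "\<exists>Q. \<forall>x\<in>\<Delta>. Q \<le> cmod x \<longrightarrow> cmod (w x) * \<rho> x < e" if e: "0 < e" for e
  proof -
    obtain P where P: "\<epsilon> P < e" using \<epsilon>_lim[OF e] by blast
    show ?thesis
    proof (intro exI[of _ "R P + cmod t0 * real (b (N P))"] ballI impI)
      \<comment> \<open>The radius excludes the early positions: for \<open>q < P\<close> and
        \<open>j < N P\<close>, a point of the support has modulus less than
        \<open>R P + cmod t0 * b (N P)\<close>. For \<open>P \<le> q\<close> the class itself starts
        late enough.\<close>
      fix x assume x: "x \<in> \<Delta>" and Q: "R P + cmod t0 * real (b (N P)) \<le> cmod x"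
      have pos: "0 < \<rho> x" using admissible_weight_pos[OF \<rho> x] .
      from w_E[of x] show "cmod (w x) * \<rho> x < e"
      proof (elim disjE exE conjE)
        fix j q assume j: "j \<in> A q" and wx: "w x = \<phi> q (x - t0 * of_nat (b j))" and q: "cmod (x - t0 * of_nat (b j)) < R q"
        define m where "m = max q P"
        have "N m \<le> j"
        proof (cases "P \<le> q")
          case True
          then show ?thesis using A_ge(2)[OF j] by (simp add: m_def)
        next
          case False
          show ?thesis
          proof (rule ccontr)
            assume "\<not> N m \<le> j"
            then have "b j \<le> b (N P)" using False by (intro monoD[OF b]) (simp add: m_def max_def)
            then have "cmod t0 * real (b j) \<le> cmod t0 * real (b (N P))" by (intro mult_left_mono) auto
            moreover have "cmod x \<le> cmod (x - t0 * of_nat (b j)) + cmod t0 * real (b j)"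
              using norm_triangle_ineq[of "x - t0 * of_nat (b j)" "t0 * of_nat (b j)"] by (simp add: norm_mult)
            ultimately show False using Q q monoD[OF RB(1), of q P] False by simp
          qed
        qed
        have "cmod (w x) * \<rho> x \<le> B m * \<rho> x"
          unfolding wx using bnd[of q "x - t0 * of_nat (b j)"] monoD[OF RB(2), of q m] pos
          by (intro mult_right_mono) (auto simp: m_def)
        also have "\<dots> \<le> \<epsilon> m"
        proof (rule far[OF \<open>N m \<le> j\<close>, of "x - t0 * of_nat (b j)"])
          show "cmod (x - t0 * of_nat (b j)) \<le> R m" using q monoD[OF RB(1), of q m] by (simp add: m_def)
        qed (use x in auto)
        also have "\<dots> \<le> \<epsilon> P" by (rule \<epsilon>_mono) (simp add: m_def)
        finally show ?thesis using P by simp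
      qed (use e in simp)
    qed
  qed
  define u where "u = restrict w \<Delta>"
  show ?thesis
  proof (rule that[of u])
    show "u \<in> C0_weighted \<Delta> \<K> \<rho>"
      unfolding C0_weighted_iff[OF \<rho>]
    proof (intro conjI allI impI)
      show "u \<in> \<Delta> \<rightarrow>\<^sub>E \<K>" using w_K by (auto simp: u_def)
      show "continuous_on \<Delta> u"
        using continuous_on_subset[OF w(1), of \<Delta>] by (simp add: u_def cong: continuous_on_cong)
      show "\<exists>Q. \<forall>t\<in>\<Delta>. Q \<le> cmod t \<longrightarrow> cmod (u t) * \<rho> t < e" if "0 < e" for e
        using decay[OF that] by (simp add: u_def)
    qed
    fix v r assume v: "v \<in> C0_weighted \<Delta> \<K> \<rho>" and r: "(0::real) < r"
    obtain P where P: "\<And>p. P \<le> p \<Longrightarrow> \<epsilon> p < r/2" using \<epsilon>_lim[of "r/2"] r by auto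
    obtain p where p: "P \<le> p" "\<And>x. x \<in> \<Delta> \<Longrightarrow> cmod (\<phi> p x - v x) * \<rho> x \<le> r/2" using dense[OF v, of "r/2" P] r by auto
    obtain D where D: "0 < D" "\<And>n. n div D \<le> card (A p \<inter> {1..n})" using A' unfolding A_def by blast
    have "cmod (u (x + t0 * of_nat (b k)) - v x) * \<rho> x \<le> r"
      if k: "k \<in> A p" and x: "x \<in> \<Delta>" "x + t0 * of_nat (b k) \<in> \<Delta>" for k x
    proof -
      let ?w = "w (x + t0 * of_nat (b k))"
      have "cmod (?w - v x) \<le> cmod (?w - \<phi> p x) + cmod (\<phi> p x - v x)"
        using norm_triangle_ineq[of "?w - \<phi> p x" "\<phi> p x - v x"] by simp
      from mult_right_mono[OF this, of "\<rho> x"] show ?thesis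
        using approx[OF k x(1)] p(2)[OF x(1)] P[OF p(1)] admissible_weight_pos[OF \<rho> x(1)] x(2)
        by (simp add: distrib_right u_def)
    qed
    moreover have "b k < b (Suc k)" if "k \<in> A p" for k
      using gap(2)[of p k] A_ge(2)[OF that] by simp
    ultimately show "\<exists>S D. 0 < D \<and> (\<forall>n. n div D \<le> card (S \<inter> {1..n})) \<and>
      (\<forall>k\<in>S. 1 \<le> k \<and> b k < b (Suc k) \<and>
        (\<forall>x\<in>\<Delta>. x + t0 * of_nat (b k) \<in> \<Delta> \<longrightarrow> cmod (u (x + t0 * of_nat (b k)) - v x) * \<rho> x \<le> r))"
      using D A_ge(1) by (intro exI[of _ "A p"] exI[of _ D]) blast
  qed
qed


section \<open>Translations and lower densities\<close>

lemma C0_dist_le: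
  assumes "\<Delta> \<in> index_sets" "admissible_weight \<Delta> \<rho>" "u \<in> C0_weighted \<Delta> \<K> \<rho>" "v \<in> C0_weighted \<Delta> \<K> \<rho>"
    and "\<And>t. t \<in> \<Delta> \<Longrightarrow> cmod (u t - v t) * \<rho> t \<le> c"
  shows "C0_dist \<Delta> \<K> \<rho> u v \<le> c"
proof -
  have "\<Delta> \<noteq> {}" using index_set_zero[OF assms(1)] by blast
  moreover have "cmod ((u t - v t) * of_real (\<rho> t)) \<le> c" if "t \<in> \<Delta>" for t
    using assms(5)[OF that] admissible_weight_pos[OF assms(2) that] by (simp add: norm_mult)
  ultimately show ?thesis
    using assms by (auto simp: C0_dist_def C0_norm_def intro!: cSUP_least)
qed

lemma C0_topology_ball:
  assumes \<Delta>: "\<Delta> \<in> index_sets" and \<rho>: "admissible_weight \<Delta> \<rho>"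
    and V: "openin (C0_topology \<Delta> \<K> \<rho>) V" "v \<in> V"
  obtains r where "0 < r" "v \<in> C0_weighted \<Delta> \<K> \<rho>"
    "\<And>w. w \<in> C0_weighted \<Delta> \<K> \<rho> \<Longrightarrow> (\<And>t. t \<in> \<Delta> \<Longrightarrow> cmod (w t - v t) * \<rho> t \<le> r) \<Longrightarrow> w \<in> V"
proof -
  interpret Metric_space "C0_weighted \<Delta> \<K> \<rho>" "C0_dist \<Delta> \<K> \<rho>"
    by (rule Metric_space_C0_weighted[OF \<Delta> \<rho>])
  from V obtain r where r: "0 < r" "mball v r \<subseteq> V" and v: "v \<in> C0_weighted \<Delta> \<K> \<rho>"
    unfolding C0_topology_def openin_mtopology by blast
  show ?thesis
  proof (rule that[of "r/2"])
    fix w assume w: "w \<in> C0_weighted \<Delta> \<K> \<rho>" "\<And>t. t \<in> \<Delta> \<Longrightarrow> cmod (w t - v t) * \<rho> t \<le> r/2"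
    have "C0_dist \<Delta> \<K> \<rho> v w \<le> r/2"
      using w by (intro C0_dist_le[OF \<Delta> \<rho> v]) (auto simp: norm_minus_commute)
    then show "w \<in> V" using r v w(1) by (intro subsetD[OF r(2)]) simp
  qed (use r v in auto)
qed

lemma translation_in_C0_weighted:
  assumes \<Delta>: "\<Delta> \<in> index_sets" and \<rho>: "admissible_weight \<Delta> \<rho>" and t: "t \<in> \<Delta>"
    and u: "u \<in> C0_weighted \<Delta> \<K> \<rho>"
  shows "translation \<Delta> t u \<in> C0_weighted \<Delta> \<K> \<rho>"
  unfolding C0_weighted_iff[OF \<rho>]
proof (intro conjI allI impI)
  note add = index_set_add[OF \<Delta> _ t]
  have u': "u \<in> \<Delta> \<rightarrow> \<K>" "continuous_on \<Delta> u" using u by (auto simp: C0_weighted_iff[OF \<rho>])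
  then show "translation \<Delta> t u \<in> \<Delta> \<rightarrow>\<^sub>E \<K>" using add by (auto simp: translation_def)
  have "continuous_on \<Delta> (\<lambda>x. u (x + t))"
    by (rule continuous_on_compose2[OF u'(2)]) (auto intro!: continuous_intros add)
  then show "continuous_on \<Delta> (translation \<Delta> t u)"
    by (simp add: translation_def cong: continuous_on_cong)
  fix \<epsilon> :: real assume "0 < \<epsilon>"
  obtain C where C: "1 \<le> C" "\<And>x t'. x \<in> \<Delta> \<Longrightarrow> t' \<in> \<Delta> \<Longrightarrow> cmod t' \<le> cmod t \<Longrightarrow> \<rho> x \<le> C * \<rho> (x + t')"
    using admissible_weight_shift[OF \<rho>, of "cmod t"] by auto
  obtain Q where Q: "\<And>x. x \<in> \<Delta> \<Longrightarrow> Q \<le> cmod x \<Longrightarrow> cmod (u x) * \<rho> x < \<epsilon> / C"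
    using u \<open>0 < \<epsilon>\<close> C(1) unfolding C0_weighted_iff[OF \<rho>] by (meson divide_pos_pos less_le_trans zero_less_one)
  show "\<exists>Q. \<forall>x\<in>\<Delta>. Q \<le> cmod x \<longrightarrow> cmod (translation \<Delta> t u x) * \<rho> x < \<epsilon>"
  proof (intro exI[of _ "Q + cmod t"] ballI impI)
    fix x assume x: "x \<in> \<Delta>" "Q + cmod t \<le> cmod x"
    have "Q \<le> cmod (x + t)" using x(2) norm_diff_ineq[of x t] by linarith
    then have "cmod (u (x + t)) * \<rho> (x + t) < \<epsilon> / C" using Q add x(1) by blast
    then have "cmod (u (x + t)) * (C * \<rho> (x + t)) < \<epsilon>" using C(1) by (simp add: field_simps)
    moreover have "cmod (u (x + t)) * \<rho> x \<le> cmod (u (x + t)) * (C * \<rho> (x + t))"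
      using C(2)[OF x(1) t] by (intro mult_left_mono) auto
    ultimately show "cmod (translation \<Delta> t u x) * \<rho> x < \<epsilon>" using x(1) by (simp add: translation_def)
  qed
qed

text \<open>Far out both terms are small by decay of \<open>u\<close> and the translation bound for
  the weight. On the remaining ball the weight is bounded and \<open>u\<close> is uniformly
  continuous. Restricting to \<open>d \<le> 1\<close> keeps the translation constant
  uniform.\<close>

lemma translation_strongly_continuous:
  assumes \<Delta>: "\<Delta> \<in> index_sets" and \<rho>: "admissible_weight \<Delta> \<rho>"
    and u: "u \<in> C0_weighted \<Delta> \<K> \<rho>" and \<tau>: "\<tau> \<in> \<Delta>" and e: "0 < e"
  obtains d where "0 < d"
    "\<And>t x. t \<in> \<Delta> \<Longrightarrow> dist t \<tau> < d \<Longrightarrow> x \<in> \<Delta> \<Longrightarrow> cmod (u (x + t) - u (x + \<tau>)) * \<rho> x \<le> e"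
proof -
  obtain C where C: "1 \<le> C" "\<And>x t. x \<in> \<Delta> \<Longrightarrow> t \<in> \<Delta> \<Longrightarrow> cmod t \<le> cmod \<tau> + 1 \<Longrightarrow> \<rho> x \<le> C * \<rho> (x + t)"
    using admissible_weight_shift[OF \<rho>, of "cmod \<tau> + 1"] by auto
  have "0 < e / (2 * C)" using e C(1) by simp
  then obtain Q0 where Q0: "\<And>x. x \<in> \<Delta> \<Longrightarrow> Q0 \<le> cmod x \<Longrightarrow> cmod (u x) * \<rho> x < e / (2 * C)"
    using u unfolding C0_weighted_iff[OF \<rho>] by meson
  define Q where "Q = max Q0 0 + cmod \<tau> + 1"
  have Q: "0 \<le> Q" by (simp add: Q_def)
  obtain C2 where C2: "0 < C2" "\<And>x. x \<in> \<Delta> \<Longrightarrow> cmod x \<le> Q \<Longrightarrow> \<rho> x \<le> C2"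
    using admissible_weight_locally_bounded[OF \<Delta> \<rho> Q] by blast
  let ?K = "\<Delta> \<inter> cball 0 (Q + cmod \<tau> + 1)"
  have "uniformly_continuous_on ?K u"
    using u by (intro compact_uniformly_continuous compact_index_set_Int_cball \<Delta>)
      (auto simp: C0_weighted_iff[OF \<rho>] intro: continuous_on_subset)
  moreover have "0 < e / C2" using e C2 by simp
  ultimately obtain d where d: "0 < d" "\<And>x y. x \<in> ?K \<Longrightarrow> y \<in> ?K \<Longrightarrow> dist y x < d \<Longrightarrow> dist (u y) (u x) < e / C2"
    unfolding uniformly_continuous_on_def by metis
  show ?thesis
  proof (rule that[of "min d 1"])
    fix t x assume t: "t \<in> \<Delta>" "dist t \<tau> < min d 1" and x: "x \<in> \<Delta>"
    have nt: "cmod t \<le> cmod \<tau> + 1"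
      using t(2) norm_triangle_ineq[of "t - \<tau>" \<tau>] by (simp add: dist_norm)
    have pos: "0 < \<rho> x" using admissible_weight_pos[OF \<rho> x] .
    show "cmod (u (x + t) - u (x + \<tau>)) * \<rho> x \<le> e"
    proof (cases "cmod x \<le> Q")
      case True
      have "x + t \<in> ?K" "x + \<tau> \<in> ?K"
        using index_set_add[OF \<Delta> x] t(1) \<tau> True nt norm_triangle_ineq[of x t] norm_triangle_ineq[of x \<tau>] by auto
      then have "dist (u (x + t)) (u (x + \<tau>)) < e / C2" using t(2) by (intro d(2)) (auto simp: dist_norm)
      then have "cmod (u (x + t) - u (x + \<tau>)) * \<rho> x \<le> e / C2 * C2"
        using C2(2)[OF x True] C2(1) pos e by (intro mult_mono) (auto simp: dist_norm)
      then show ?thesis using C2(1) by simp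
    next
      case False
      have far: "cmod (u (x + s)) * \<rho> x \<le> e / 2" if s: "s \<in> \<Delta>" "cmod s \<le> cmod \<tau> + 1" for s
      proof -
        have "Q0 \<le> cmod (x + s)" using False s(2) norm_diff_ineq[of x s] by (simp add: Q_def)
        then have "cmod (u (x + s)) * \<rho> (x + s) < e / (2 * C)" using Q0 index_set_add[OF \<Delta> x s(1)] by blast
        then have "cmod (u (x + s)) * (C * \<rho> (x + s)) < e / 2" using C(1) by (simp add: field_simps)
        moreover have "cmod (u (x + s)) * \<rho> x \<le> cmod (u (x + s)) * (C * \<rho> (x + s))"
          using C(2)[OF x s] by (intro mult_left_mono) auto
        ultimately show ?thesis by simp
      qed
      have "cmod (u (x + t) - u (x + \<tau>)) * \<rho> x \<le> (cmod (u (x + t)) + cmod (u (x + \<tau>))) * \<rho> x"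
        using pos by (intro mult_right_mono norm_triangle_ineq4) auto
      then show ?thesis using far[OF t(1) nt] far[OF \<tau>] by (simp add: distrib_right)
    qed
  qed (use d in auto)
qed

text \<open>Continuity of the orbit makes the return set relatively open in \<open>D\<close>. This
  is indispensable for a lower density bound, since \<open>emeasure\<close> assigns 0 to sets that
  are not measurable.\<close>

lemma return_set_measurable:
  assumes \<Delta>: "\<Delta> \<in> index_sets" and \<rho>: "admissible_weight \<Delta> \<rho>"
    and D: "D \<in> index_sets" and c: "cmod c = 1" "\<And>t. t \<in> D \<Longrightarrow> t * c \<in> \<Delta>"
    and u: "u \<in> C0_weighted \<Delta> \<K> \<rho>" and V: "openin (C0_topology \<Delta> \<K> \<rho>) V"
  shows "{t \<in> D. translation \<Delta> (t * c) u \<in> V} \<inter> {z \<in> D. cmod z \<le> R} \<in> sets (index_measure D)"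
proof -
  let ?W = "{t \<in> D. translation \<Delta> (t * c) u \<in> V}"
  have "\<exists>d>0. \<forall>t\<in>D. dist t \<tau> < d \<longrightarrow> t \<in> ?W" if \<tau>: "\<tau> \<in> ?W" for \<tau>
  proof -
    obtain r where r: "0 < r" "\<And>w. w \<in> C0_weighted \<Delta> \<K> \<rho> \<Longrightarrow>
        (\<And>x. x \<in> \<Delta> \<Longrightarrow> cmod (w x - translation \<Delta> (\<tau> * c) u x) * \<rho> x \<le> r) \<Longrightarrow> w \<in> V"
      using C0_topology_ball[OF \<Delta> \<rho> V, of "translation \<Delta> (\<tau> * c) u"] \<tau> by blast
    obtain d where d: "0 < d" "\<And>t x. t \<in> \<Delta> \<Longrightarrow> dist t (\<tau> * c) < d \<Longrightarrow> x \<in> \<Delta> \<Longrightarrow>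
        cmod (u (x + t) - u (x + \<tau> * c)) * \<rho> x \<le> r"
      using translation_strongly_continuous[OF \<Delta> \<rho> u _ r(1), of "\<tau> * c"] c(2) \<tau> by blast
    have "t \<in> ?W" if t: "t \<in> D" "dist t \<tau> < d" for t
    proof -
      have "dist (t * c) (\<tau> * c) < d"
        using t(2) c(1) by (simp add: dist_norm norm_mult flip: left_diff_distrib)
      then have "translation \<Delta> (t * c) u \<in> V"
        using d(2) c(2) t(1) by (intro r(2) translation_in_C0_weighted[OF \<Delta> \<rho> _ u]) (auto simp: translation_def)
      then show ?thesis using t by simp
    qed
    then show ?thesis using d(1) by blast
  qed
  then have "openin (top_of_set D) ?W"
    unfolding openin_euclidean_subtopology_iff by (auto simp: dist_commute)
  then obtain X where X: "open X" "?W = D \<inter> X" by (auto simp: openin_open)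
  have "?W \<inter> {z \<in> D. cmod z \<le> R} = (X \<inter> cball 0 R) \<inter> D" using X(2) by auto
  also have "\<dots> \<in> sets (index_measure D)"
    using X(1) by (intro borel_Int_index_measure[OF D]) auto
  finally show ?thesis .
qed

text \<open>The case \<open>n = 0\<close> is excluded because
  \<open>translation \<Delta> 0 u\<close> restricts \<open>u\<close> to \<Delta>, whereas the zeroth
  power returns \<open>u\<close> unchanged.\<close>

lemma translation_funpow:
  assumes \<Delta>: "\<Delta> \<in> index_sets" and t: "t \<in> \<Delta>" and n: "1 \<le> n"
  shows "(translation \<Delta> t ^^ n) u = translation \<Delta> (t * of_nat n) u"
  using n
proof (induction n rule: dec_induct)
  case (step n)
  have "(translation \<Delta> t ^^ Suc n) u = translation \<Delta> t (translation \<Delta> (t * of_nat n) u)"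
    using step by simp
  also have "\<dots> = translation \<Delta> (t * of_nat (Suc n)) u"
    using index_set_add[OF \<Delta> _ t] by (auto simp: translation_def algebra_simps)
  finally show ?case .
qed simp

section \<open>From counting indices to lower densities\<close>

lemma div_ge_half_quotient:
  fixes n D :: nat
  assumes "0 < D" "2 * real D \<le> real n"
  shows "real n / (2 * real D) \<le> real (n div D)"
proof -
  \<comment> \<open>Rounding loses less than one unit; for n \<ge> 2 * D half of the quotient
    absorbs that loss.\<close>
  have "n < D + n div D * D" using assms(1) by (rule dividend_less_div_times)
  then have "real n < real D + real (n div D) * real D" by (metis of_nat_add of_nat_less_iff of_nat_mult)
  then have "real n / real D - 1 \<le> real (n div D)" using assms(1) by (simp add: field_simps)
  moreover have "real n / (2 * real D) + 1 \<le> real n / real D"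
    using assms by (simp add: field_simps)
  ultimately show ?thesis by linarith
qed

text \<open>The iterates numbered \<open>b k\<close> with \<open>k\<close> in \<open>S\<close> land
  in \<open>V\<close>. Since \<open>b k \<le> m k\<close> and \<open>b\<close> is injective on
  \<open>S\<close>, the indices of \<open>S\<close> up to \<open>n\<close> yield equally many return
  times up to \<open>m n\<close>, so the density of \<open>S\<close> carries over.\<close>

lemma l_frequently_hypercyclic_translation:
  assumes \<Delta>: "\<Delta> \<in> index_sets" and \<rho>: "admissible_weight \<Delta> \<rho>" and t0: "t0 \<in> \<Delta>"
    and u: "u \<in> C0_weighted \<Delta> \<K> \<rho>"
    and b: "mono b" "\<And>k. 1 \<le> b k" "\<And>k. real (b k) \<le> m k" and m: "mono m"
    and approx: "\<And>v r. v \<in> C0_weighted \<Delta> \<K> \<rho> \<Longrightarrow> 0 < r \<Longrightarrow> \<exists>S D. 0 < D \<and> (\<forall>n. n div D \<le> card (S \<inter> {1..n})) \<and>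
      (\<forall>k\<in>S. 1 \<le> k \<and> b k < b (Suc k) \<and>
        (\<forall>x\<in>\<Delta>. x + t0 * of_nat (b k) \<in> \<Delta> \<longrightarrow> cmod (u (x + t0 * of_nat (b k)) - v x) * \<rho> x \<le> r))"
  shows "l_frequently_hypercyclic (C0_topology \<Delta> \<K> \<rho>) m (translation \<Delta> t0)"
  unfolding l_frequently_hypercyclic_def
proof (intro bexI allI impI; (elim conjE)?)
  show "u \<in> topspace (C0_topology \<Delta> \<K> \<rho>)" using u \<Delta> \<rho> by simp
  fix V assume V: "openin (C0_topology \<Delta> \<K> \<rho>) V" "V \<noteq> {}"
  then obtain v where "v \<in> V" by blast
  obtain r where r: "0 < r" and v: "v \<in> C0_weighted \<Delta> \<K> \<rho>"
    and ball: "\<And>w. w \<in> C0_weighted \<Delta> \<K> \<rho> \<Longrightarrow> (\<And>t. t \<in> \<Delta> \<Longrightarrow> cmod (w t - v t) * \<rho> t \<le> r) \<Longrightarrow> w \<in> V"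
    using C0_topology_ball[OF \<Delta> \<rho> V(1) \<open>v \<in> V\<close>] by blast
  obtain S D where D: "0 < D" "\<And>n. n div D \<le> card (S \<inter> {1..n})" and S: "\<And>k. k \<in> S \<Longrightarrow> b k < b (Suc k)"
    and Sv: "\<And>k x. k \<in> S \<Longrightarrow> x \<in> \<Delta> \<Longrightarrow> x + t0 * of_nat (b k) \<in> \<Delta> \<Longrightarrow>
      cmod (u (x + t0 * of_nat (b k)) - v x) * \<rho> x \<le> r"
    using approx[OF v r] by blast
  let ?A = "{n. 1 \<le> n \<and> (translation \<Delta> t0 ^^ n) u \<in> V}"
  \<comment> \<open>Although \<open>b\<close> may be constant elsewhere, it increases strictly
    immediately after each element of \<open>S\<close>.\<close>
  have inj: "inj_on b S"
    by (rule linorder_inj_onI') (metis S b(1) le_less_trans mono_def Suc_leI not_le order_refl)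
  have bA: "b k \<in> ?A" if k: "k \<in> S" for k
  proof -
    note tk = index_set_of_nat[OF \<Delta> t0, of "b k"]
    have "translation \<Delta> (t0 * of_nat (b k)) u \<in> V"
      using Sv[OF k] index_set_add[OF \<Delta> _ tk]
      by (intro ball translation_in_C0_weighted[OF \<Delta> \<rho> tk u]) (auto simp: translation_def)
    then show ?thesis using translation_funpow[OF \<Delta> t0, of "b k" u] b(2) by simp
  qed
  have card: "real n / (2 * real D) \<le> real (card {j \<in> ?A. 1 \<le> j \<and> real j \<le> m n})" if n: "2 * D \<le> n" for n
  proof -
    have "real (b k) \<le> m n" if "k \<le> n" for k using b(3)[of k] monoD[OF m that] by linarith
    then have "b ` (S \<inter> {1..n}) \<subseteq> {j \<in> ?A. 1 \<le> j \<and> real j \<le> m n}"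
      using bA b(2) by auto
    moreover have "{j \<in> ?A. 1 \<le> j \<and> real j \<le> m n} \<subseteq> {..nat \<lfloor>m n\<rfloor>}"
      by (auto intro: le_nat_floor)
    ultimately have "card (b ` (S \<inter> {1..n})) \<le> card {j \<in> ?A. 1 \<le> j \<and> real j \<le> m n}"
      by (intro card_mono) (rule finite_subset, assumption, simp)
    then have "card (S \<inter> {1..n}) \<le> card {j \<in> ?A. 1 \<le> j \<and> real j \<le> m n}"
      using inj by (subst (asm) card_image) (auto intro: inj_on_subset)
    then have "real (n div D) \<le> real (card {j \<in> ?A. 1 \<le> j \<and> real j \<le> m n})"
      using D(2)[of n] by simp
    then show ?thesis using div_ge_half_quotient[OF D(1), of n] n by simp
  qed
  have "ereal (1 / (2 * real D)) \<le> lower_density_seq m ?A"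
    unfolding lower_density_seq_def
  proof (rule Liminf_bounded, rule eventually_sequentiallyI[of "2 * D"])
    fix n assume n: "2 * D \<le> n"
    then have "0 < real n" using D(1) by simp
    then show "ereal (1 / (2 * real D)) \<le> ereal (real (card {j \<in> ?A. 1 \<le> j \<and> real j \<le> m n}) / real n)"
      using card[OF n] by (simp add: field_simps)
  qed
  then show "0 < lower_density_seq m ?A" using D(1) by (auto intro: less_le_trans[rotated])
qed

text \<open>The unit number \<open>c\<close> treats both semigroups at once: \<open>c = 1\<close>
  with index set \<Delta>', and the direction of \<open>t0\<close> with index set [0,\<infinity>)
  and \<open>s0 = cmod t0\<close>. Each return time \<open>s0 * b k\<close> is enlarged to a piece
  of measure at least \<open>\<kappa>\<close>, and the pieces are disjoint, so counting indices
  becomes measuring times.\<close>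

lemma frequently_hypercyclic_translation:
  assumes \<Delta>: "\<Delta> \<in> index_sets" and \<rho>: "admissible_weight \<Delta> \<rho>"
    and D: "D \<in> index_sets" and c: "cmod c = 1" "\<And>t. t \<in> D \<Longrightarrow> t * c \<in> \<Delta>"
    and s0: "s0 \<in> D" "s0 \<noteq> 0"
    and u: "u \<in> C0_weighted \<Delta> \<K> \<rho>"
    and b: "mono b" "\<And>k. real (b k) \<le> f (real k)" and f: "mono_on {0..} f"
    and growth: "0 < \<gamma>" "\<forall>\<^sub>F t in at_top. cmod s0 * f (\<gamma> * t) \<le> f t"
    and approx: "\<And>v r. v \<in> C0_weighted \<Delta> \<K> \<rho> \<Longrightarrow> 0 < r \<Longrightarrow> \<exists>S D. 0 < D \<and> (\<forall>n. n div D \<le> card (S \<inter> {1..n})) \<and>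
      (\<forall>k\<in>S. 1 \<le> k \<and> b k < b (Suc k) \<and>
        (\<forall>x\<in>\<Delta>. x + s0 * c * of_nat (b k) \<in> \<Delta> \<longrightarrow> cmod (u (x + s0 * c * of_nat (b k)) - v x) * \<rho> x \<le> r))"
  shows "frequently_hypercyclic (C0_topology \<Delta> \<K> \<rho>) D f (\<lambda>t. translation \<Delta> (t * c))"
  unfolding frequently_hypercyclic_def
proof (intro bexI allI impI; (elim conjE)?)
  show "u \<in> topspace (C0_topology \<Delta> \<K> \<rho>)" using u \<Delta> \<rho> by simp
  fix V assume V: "openin (C0_topology \<Delta> \<K> \<rho>) V" "V \<noteq> {}"
  then obtain v where "v \<in> V" by blast
  obtain r where r: "0 < r" and v: "v \<in> C0_weighted \<Delta> \<K> \<rho>"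
    and ball: "\<And>w. w \<in> C0_weighted \<Delta> \<K> \<rho> \<Longrightarrow> (\<And>t. t \<in> \<Delta> \<Longrightarrow> cmod (w t - v t) * \<rho> t \<le> r) \<Longrightarrow> w \<in> V"
    using C0_topology_ball[OF \<Delta> \<rho> V(1) \<open>v \<in> V\<close>] by blast
  obtain C where C: "1 \<le> C" "\<And>x t. x \<in> \<Delta> \<Longrightarrow> t \<in> \<Delta> \<Longrightarrow> cmod t \<le> 1 \<Longrightarrow> \<rho> x \<le> C * \<rho> (x + t)"
    using admissible_weight_shift[OF \<rho>, of 1] by auto
  have rC: "0 < r / (2 * C)" "0 < r / 2" using r C(1) by auto
  obtain S D' where D': "0 < D'" "\<And>n. n div D' \<le> card (S \<inter> {1..n})"
    and S: "\<And>k. k \<in> S \<Longrightarrow> 1 \<le> k" "\<And>k. k \<in> S \<Longrightarrow> b k < b (Suc k)"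
    and Sv: "\<And>k x. k \<in> S \<Longrightarrow> x \<in> \<Delta> \<Longrightarrow> x + s0 * c * of_nat (b k) \<in> \<Delta> \<Longrightarrow>
      cmod (u (x + s0 * c * of_nat (b k)) - v x) * \<rho> x \<le> r / (2 * C)"
    using approx[OF v rC(1)] by blast
  obtain d where d: "0 < d" "\<And>t x. t \<in> \<Delta> \<Longrightarrow> dist t 0 < d \<Longrightarrow> x \<in> \<Delta> \<Longrightarrow> cmod (v (x + t) - v (x + 0)) * \<rho> x \<le> r / 2"
    using translation_strongly_continuous[OF \<Delta> \<rho> v index_set_zero[OF \<Delta>] rC(2)] by blast
  \<comment> \<open>The three bounds serve continuity of \<open>v\<close> at time 0, the weight
    constant \<open>C\<close> for translations of length at most 1, and disjointness: distinct
    centres are at least \<open>cmod s0\<close> apart because \<open>b\<close> takes natural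
    values.\<close>
  define \<eta> where "\<eta> = min (d / 2) (min 1 (cmod s0 / 2))"
  have \<eta>: "0 < \<eta>" "\<eta> < d" "\<eta> \<le> 1" "\<eta> \<le> cmod s0 / 2" using d(1) s0(2) by (auto simp: \<eta>_def)
  obtain z q \<kappa> where q: "0 < q" "cmod z + q \<le> \<eta>" and \<kappa>: "0 < \<kappa>"
    and zD: "\<And>a h. a \<in> D \<Longrightarrow> a + h \<in> ball (a + z) q \<inter> D \<Longrightarrow> h \<in> D"
    and em: "\<And>a. a \<in> D \<Longrightarrow> ennreal \<kappa> \<le> emeasure (index_measure D) (ball (a + z) q \<inter> D)"
    by (rule index_measure_translated_balls[OF D \<eta>(1)]) (rule that)
  define a where "a k = s0 * of_nat (b k)" for k
  define Bk where "Bk k = ball (a k + z) q \<inter> D" for k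
  have aD: "a k \<in> D" for k unfolding a_def by (rule index_set_of_nat[OF D s0(1)])
  let ?W = "{t \<in> D. translation \<Delta> (t * c) u \<in> V}"
  have BkW: "Bk k \<subseteq> ?W" if k: "k \<in> S" for k
  proof
    fix t assume t: "t \<in> Bk k"
    define h where "h = t - a k"
    have th: "t = a k + h" by (simp add: h_def)
    have hD: "h \<in> D" using zD[OF aD, of k h] t th by (simp add: Bk_def)
    have "cmod (h - z) < q" using t by (simp add: Bk_def th dist_norm norm_minus_commute)
    then have hn: "cmod h < \<eta>" using q(2) norm_triangle_sub[of h z] by linarith
    have hc: "h * c \<in> \<Delta>" "cmod (h * c) < \<eta>" using c hD hn by (auto simp: norm_mult)
    have tD: "t \<in> D" using t by (simp add: Bk_def)
    have "translation \<Delta> (t * c) u \<in> V"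
    proof (intro ball translation_in_C0_weighted[OF \<Delta> \<rho> c(2)[OF tD] u])
      fix x assume x: "x \<in> \<Delta>"
      have y: "x + h * c \<in> \<Delta>" by (rule index_set_add[OF \<Delta> x hc(1)])
      have eq: "x + t * c = x + h * c + s0 * c * of_nat (b k)" by (simp add: th a_def algebra_simps)
      have yt: "x + h * c + s0 * c * of_nat (b k) \<in> \<Delta>"
        using index_set_add[OF \<Delta> x c(2)[OF tD]] by (simp add: eq)
      have pos: "0 < \<rho> x" using admissible_weight_pos[OF \<rho> x] .
      \<comment> \<open>The time \<open>t\<close> is split into \<open>a k\<close> and the short
        time \<open>h\<close>. The approximation at \<open>a k\<close> is applied at the point
        \<open>x + h * c\<close>, and passing from its weight to that of \<open>x\<close> costs the
        factor \<open>C\<close> allowed for in \<open>r / (2 * C)\<close>.\<close>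
      have "cmod (u (x + t * c) - v (x + h * c)) * \<rho> x \<le> cmod (u (x + t * c) - v (x + h * c)) * (C * \<rho> (x + h * c))"
        using C(2)[OF x hc(1)] hc(2) \<eta>(3) by (intro mult_left_mono) auto
      also have "\<dots> = C * (cmod (u (x + t * c) - v (x + h * c)) * \<rho> (x + h * c))" by simp
      also have "\<dots> \<le> C * (r / (2 * C))"
        using Sv[OF k y yt] C(1) by (intro mult_left_mono) (auto simp: eq)
      finally have 1: "cmod (u (x + t * c) - v (x + h * c)) * \<rho> x \<le> r / 2" using C(1) by simp
      have 2: "cmod (v (x + h * c) - v x) * \<rho> x \<le> r / 2"
        using d(2)[OF hc(1) _ x] hc(2) \<eta>(2) by simp
      have "cmod (u (x + t * c) - v x) \<le> cmod (u (x + t * c) - v (x + h * c)) + cmod (v (x + h * c) - v x)"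
        using norm_triangle_ineq[of "u (x + t * c) - v (x + h * c)" "v (x + h * c) - v x"] by simp
      from mult_right_mono[OF this, of "\<rho> x"] have "cmod (u (x + t * c) - v x) * \<rho> x \<le> r"
        using 1 2 pos by (simp add: distrib_right)
      then show "cmod (translation \<Delta> (t * c) u x - v x) * \<rho> x \<le> r" using x by (simp add: translation_def)
    qed
    then show "t \<in> ?W" using tD by simp
  qed
  have Bk_bound: "cmod t \<le> cmod s0 * f (real k + 1)" if k: "k \<in> S" and t: "t \<in> Bk k" for k t
  proof -
    have "cmod (t - a k - z) < q" using t by (simp add: Bk_def dist_norm norm_minus_commute algebra_simps)
    then have "cmod t \<le> cmod (a k) + cmod s0"
      using norm_triangle_ineq[of "t - a k - z" "a k + z"] norm_triangle_ineq[of "a k" z] q \<eta> by simp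
    also have "\<dots> = cmod s0 * (real (b k) + 1)" by (simp add: a_def norm_mult algebra_simps)
    \<comment> \<open>The strict increase of \<open>b\<close> after \<open>k\<close> gives
      \<open>b k + 1 \<le> b (Suc k)\<close>: the thickening is paid for by advancing the index by
      one.\<close>
    also have "\<dots> \<le> cmod s0 * f (real k + 1)"
      using S(2)[OF k] b(2)[of "Suc k"] by (intro mult_left_mono) (auto simp: add.commute)
    finally show ?thesis .
  qed
  have disj_less: "Bk k \<inter> Bk l = {}" if kl: "k \<in> S" "k < l" for k l
  proof (rule ccontr)
    assume "Bk k \<inter> Bk l \<noteq> {}"
    then obtain t where t: "cmod (t - a k - z) < q" "cmod (t - a l - z) < q"
      by (auto simp: Bk_def dist_norm norm_minus_commute algebra_simps)
    have bkl: "b k < b l" using S(2)[OF kl(1)] monoD[OF b(1), of "Suc k" l] kl(2) by simp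
    then have "cmod s0 * 1 \<le> cmod s0 * real (b l - b k)" by (intro mult_left_mono) auto
    also have "\<dots> = cmod (a l - a k)"
      using bkl by (simp add: a_def norm_mult of_nat_diff flip: right_diff_distrib)
        (metis norm_of_nat of_nat_diff less_imp_le)
    also have "\<dots> \<le> cmod (t - a k - z) + cmod (t - a l - z)"
      using norm_triangle_ineq4[of "t - a k - z" "t - a l - z"] by simp
    finally show False using t q \<eta> norm_ge_zero[of z] by linarith
  qed
  have disj: "disjoint_family_on Bk S"
    unfolding disjoint_family_on_def using disj_less by (metis Int_commute linorder_neqE_nat)
  \<comment> \<open>At least \<gamma> * t / (4 * D') pieces fit into the ball of radius
    \<open>f t\<close>, each of measure at least \<open>\<kappa>\<close>.\<close>
  define \<theta> where "\<theta> = \<kappa> * \<gamma> / (4 * real D')"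
  have \<theta>: "0 < \<theta>" using \<kappa> growth(1) D'(1) by (simp add: \<theta>_def)
  have "ennreal \<theta> \<le> lower_density D f ?W"
    unfolding lower_density_def
  proof (rule Liminf_bounded)
    have "\<forall>\<^sub>F t in at_top. max 1 ((4 * real D' + 4) / \<gamma>) \<le> (t::real)" by (rule eventually_ge_at_top)
    with growth(2) show "\<forall>\<^sub>F t in at_top. ennreal \<theta> \<le>
      emeasure (index_measure D) (?W \<inter> {z \<in> D. cmod z \<le> f t}) / ennreal t"
    proof eventually_elim
      case (elim t)
      have t: "1 \<le> t" "4 * real D' + 4 \<le> \<gamma> * t"
        using elim(2) growth(1) by (auto simp: pos_divide_le_eq mult.commute)
      \<comment> \<open>The piece of index \<open>k\<close> may reach
        \<open>cmod s0 * f (k + 1)\<close>, hence the subtracted 1. The lower bound on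
        \<open>t\<close> ensures n \<ge> \<gamma> * t - 2 \<ge> \<gamma> * t / 2 and n \<ge> 2 *
        D'.\<close>
      define n where "n = nat \<lfloor>\<gamma> * t\<rfloor> - 1"
      have n: "real n + 1 \<le> \<gamma> * t" "\<gamma> * t - 2 \<le> real n" using t unfolding n_def by linarith+
      let ?I = "S \<inter> {1..n}"
      have sub: "(\<Union>k\<in>?I. Bk k) \<subseteq> ?W \<inter> {z \<in> D. cmod z \<le> f t}"
      proof (intro UN_least IntI subsetI)
        fix k x assume k: "k \<in> ?I" and x: "x \<in> Bk k"
        show "x \<in> ?W" using BkW k x by blast
        have "cmod x \<le> cmod s0 * f (real k + 1)" using Bk_bound k x by blast
        also have "\<dots> \<le> cmod s0 * f (\<gamma> * t)"
          using k n by (intro mult_left_mono mono_onD[OF f]) auto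
        also have "\<dots> \<le> f t" by (rule elim(1))
        finally show "x \<in> {z \<in> D. cmod z \<le> f t}" using x by (simp add: Bk_def)
      qed
      have "2 * real D' \<le> real n" using n t by linarith
      then have "real n / (2 * real D') \<le> real (n div D')" by (rule div_ge_half_quotient[OF D'(1)])
      moreover have "\<gamma> * t / (4 * real D') \<le> real n / (2 * real D')"
        using n t D'(1) by (simp add: field_simps)
      moreover have "real (n div D') \<le> real (card ?I)" using D'(2)[of n] by simp
      ultimately have "\<gamma> * t / (4 * real D') * \<kappa> \<le> real (card ?I) * \<kappa>"
        using \<kappa> by (intro mult_right_mono) linarith+
      then have "ennreal (\<theta> * t) \<le> ennreal (real (card ?I) * \<kappa>)"
        by (intro ennreal_leI) (simp add: \<theta>_def mult_ac)
      also have "\<dots> = (\<Sum>k\<in>?I. ennreal \<kappa>)"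
        using \<kappa> by (simp add: ennreal_mult ennreal_of_nat_eq_real_of_nat)
      also have "\<dots> \<le> (\<Sum>k\<in>?I. emeasure (index_measure D) (Bk k))"
        unfolding Bk_def by (intro sum_mono em aD)
      also have "\<dots> = emeasure (index_measure D) (\<Union>k\<in>?I. Bk k)"
      proof (rule sum_emeasure)
        show "Bk ` ?I \<subseteq> sets (index_measure D)"
          unfolding Bk_def by (intro image_subsetI borel_Int_index_measure[OF D]) simp
        show "disjoint_family_on Bk ?I" by (rule disjoint_family_on_mono[OF _ disj]) simp
      qed simp
      also have "\<dots> \<le> emeasure (index_measure D) (?W \<inter> {z \<in> D. cmod z \<le> f t})"
        by (intro emeasure_mono sub return_set_measurable[OF \<Delta> \<rho> D c u V(1)])
      finally have "ennreal (\<theta> * t) / ennreal t \<le> emeasure (index_measure D) (?W \<inter> {z \<in> D. cmod z \<le> f t}) / ennreal t"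
        by (rule divide_right_mono_ennreal)
      moreover have "ennreal (\<theta> * t) / ennreal t = ennreal \<theta>"
        using t(1) \<theta> by (simp add: divide_ennreal)
      ultimately show ?case by simp
    qed
  qed
  moreover have "0 < ennreal \<theta>" using \<theta> by simp
  ultimately show "0 < lower_density D f ?W" by (rule less_le_trans[rotated])
qed


section \<open>Consequences of the conditions on the weight\<close>

text \<open>A singleton \<open>F\<close> turns the condition on suprema into a pointwise bound with
  a threshold uniform in \<open>k\<close>; the two lemmas that follow use the same choice.\<close>

lemma backward_conditionD:
  assumes "backward_condition \<Delta> \<rho> m t0 K" "0 < \<epsilon>"
  obtains N where "\<And>n k x. N \<le> n \<Longrightarrow> n \<le> k \<Longrightarrow> 1 \<le> k \<Longrightarrow> x \<in> K \<Longrightarrow>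
    extend0 \<Delta> \<rho> (x - t0 * of_int (\<lfloor>m k\<rfloor> - \<lfloor>m (k - n)\<rfloor>)) < \<epsilon>"
proof -
  obtain N where N: "\<And>F k. finite F \<and> F \<subseteq> {N..} \<and> 1 \<le> k \<Longrightarrow>
      (SUP (n, x) \<in> {(n, x). n \<in> F \<and> n \<le> k \<and> x \<in> K}.
         ennreal (extend0 \<Delta> \<rho> (x - t0 * of_int (\<lfloor>m k\<rfloor> - \<lfloor>m (k - n)\<rfloor>)))) < ennreal \<epsilon>"
    using assms unfolding backward_condition_def by blast
  have "extend0 \<Delta> \<rho> (x - t0 * of_int (\<lfloor>m k\<rfloor> - \<lfloor>m (k - n)\<rfloor>)) < \<epsilon>"
    if "N \<le> n" "n \<le> k" "1 \<le> k" "x \<in> K" for n k x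
  proof -
    have "ennreal (extend0 \<Delta> \<rho> (x - t0 * of_int (\<lfloor>m k\<rfloor> - \<lfloor>m (k - n)\<rfloor>))) < ennreal \<epsilon>"
      by (rule le_less_trans[OF SUP_upper2[of "(n, x)"] N[of "{n}" k]]) (use that in auto)
    then show ?thesis by (meson ennreal_leI linorder_not_less)
  qed
  then show ?thesis using that by blast
qed

lemma forward_conditionD:
  assumes "forward_condition \<Delta> \<rho> m t0 K" "0 < \<epsilon>"
  obtains N where "\<And>n k x. N \<le> n \<Longrightarrow> 1 \<le> k \<Longrightarrow> x \<in> K \<Longrightarrow>
    extend0 \<Delta> \<rho> (x + t0 * of_int (\<lfloor>m (k + n)\<rfloor> - \<lfloor>m k\<rfloor>)) < \<epsilon>"
proof -
  obtain N where N: "\<And>F k. finite F \<and> F \<subseteq> {N..} \<and> 1 \<le> k \<Longrightarrow>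
      (SUP (n, x) \<in> F \<times> K.
         ennreal (extend0 \<Delta> \<rho> (x + t0 * of_int (\<lfloor>m (k + n)\<rfloor> - \<lfloor>m k\<rfloor>)))) < ennreal \<epsilon>"
    using assms unfolding forward_condition_def by blast
  have "extend0 \<Delta> \<rho> (x + t0 * of_int (\<lfloor>m (k + n)\<rfloor> - \<lfloor>m k\<rfloor>)) < \<epsilon>"
    if "N \<le> n" "1 \<le> k" "x \<in> K" for n k x
  proof -
    have "ennreal (extend0 \<Delta> \<rho> (x + t0 * of_int (\<lfloor>m (k + n)\<rfloor> - \<lfloor>m k\<rfloor>))) < ennreal \<epsilon>"
      by (rule le_less_trans[OF SUP_upper2[of "(n, x)"] N[of "{n}" k]]) (use that in auto)
    then show ?thesis by (meson ennreal_leI linorder_not_less)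
  qed
  then show ?thesis using that by blast
qed

lemma orbit_conditionD:
  assumes "orbit_condition \<rho> m t0 K" "0 < \<epsilon>"
  obtains N where "\<And>n x. N \<le> n \<Longrightarrow> x \<in> K \<Longrightarrow> \<rho> (x + t0 * of_int \<lfloor>m n\<rfloor>) < \<epsilon>"
proof -
  obtain N where N: "\<And>F. finite F \<and> F \<subseteq> {N..} \<Longrightarrow>
      (SUP (n, x) \<in> F \<times> K. ennreal (\<rho> (x + t0 * of_int \<lfloor>m n\<rfloor>))) < ennreal \<epsilon>"
    using assms unfolding orbit_condition_def by blast
  have "\<rho> (x + t0 * of_int \<lfloor>m n\<rfloor>) < \<epsilon>" if "N \<le> n" "x \<in> K" for n x
  proof -
    have "ennreal (\<rho> (x + t0 * of_int \<lfloor>m n\<rfloor>)) < ennreal \<epsilon>"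
      by (rule le_less_trans[OF SUP_upper2[of "(n, x)"] N[of "{n}"]]) (use that in auto)
    then show ?thesis by (meson ennreal_leI linorder_not_less)
  qed
  then show ?thesis using that by blast
qed

text \<open>For points \<open>y\<close> outside \<open>\<Delta>\<close>, a fixed \<open>z \<in> \<Delta>\<close> moves them into a compact subset of
  \<open>\<Delta>\<close>, at the price of the constant from the admissibility of \<open>\<rho>\<close>.\<close>

lemma weight_conditions_off_index_set:
  fixes b :: "nat \<Rightarrow> nat"
  assumes \<Delta>: "\<Delta> \<in> index_sets" and \<rho>: "admissible_weight \<Delta> \<rho>" and t0: "t0 \<in> \<Delta>"
    and b: "mono b" "\<And>k. \<lfloor>m k\<rfloor> = int (b k)"
    and cond: "\<And>K. compact K \<Longrightarrow> K \<subseteq> \<Delta> \<Longrightarrow> backward_condition \<Delta> \<rho> m t0 K \<and>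
               forward_condition \<Delta> \<rho> m t0 K \<and> orbit_condition \<rho> m t0 K"
    and \<epsilon>: "0 < \<epsilon>"
  shows "\<exists>N. \<forall>i j y. 1 \<le> i \<and> 1 \<le> j \<and> (i + N \<le> j \<or> j + N \<le> i) \<and> cmod y \<le> R \<and>
      y + t0 * (of_nat (b j) - of_nat (b i)) \<in> \<Delta> \<longrightarrow> \<rho> (y + t0 * (of_nat (b j) - of_nat (b i))) < \<epsilon>"
    and "\<exists>N. \<forall>j y. N \<le> j \<and> cmod y \<le> R \<and>
      y + t0 * of_nat (b j) \<in> \<Delta> \<longrightarrow> \<rho> (y + t0 * of_nat (b j)) < \<epsilon>"
proof -
  obtain z where z: "z \<in> \<Delta>" "\<And>a b. a \<in> \<Delta> \<Longrightarrow> b \<in> \<Delta> \<Longrightarrow> cmod (a - b) \<le> max R 0 \<Longrightarrow> a - b + z \<in> \<Delta>"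
    using index_set_absorbs_diff[OF \<Delta>, of "max R 0"] by auto
  obtain C where C: "1 \<le> C" "\<And>x t. x \<in> \<Delta> \<Longrightarrow> t \<in> \<Delta> \<Longrightarrow> cmod t \<le> cmod z \<Longrightarrow> \<rho> x \<le> C * \<rho> (x + t)"
    using admissible_weight_shift[OF \<rho>, of "cmod z"] by auto
  define K where "K = \<Delta> \<inter> cball 0 (max R 0 + cmod z)"
  have K: "compact K" "K \<subseteq> \<Delta>" unfolding K_def using compact_index_set_Int_cball[OF \<Delta>] by auto
  have \<epsilon>C: "0 < \<epsilon> / C" using \<epsilon> C(1) by simp
  \<comment> \<open>Every \<open>y\<close> to be treated is a difference of two points of \<Delta>,
    even when it lies outside \<Delta> itself; this is exactly what the choice of \<open>z\<close>
    can repair.\<close>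
  have in_K: "y + z \<in> K" if "y = a - d" "a \<in> \<Delta>" "d \<in> \<Delta>" "cmod y \<le> R" for y a d
    using z(2)[of a d] that norm_triangle_ineq[of y z] by (simp add: K_def)
  have conclude: "\<rho> x < \<epsilon>" if "x \<in> \<Delta>" "\<rho> (x + z) < \<epsilon> / C" for x
    using C(2)[OF that(1) z(1)] that(2) C(1) by (simp add: field_simps)
  note t0n = index_set_of_nat[OF \<Delta> t0]
  note cond = cond[OF K]
  obtain N1 where N1: "\<And>n k x. N1 \<le> n \<Longrightarrow> n \<le> k \<Longrightarrow> 1 \<le> k \<Longrightarrow> x \<in> K \<Longrightarrow>
    extend0 \<Delta> \<rho> (x - t0 * of_int (\<lfloor>m k\<rfloor> - \<lfloor>m (k - n)\<rfloor>)) < \<epsilon> / C"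
    using backward_conditionD[OF _ \<epsilon>C, of \<Delta> \<rho> m t0 K] cond by blast
  obtain N2 where N2: "\<And>n k x. N2 \<le> n \<Longrightarrow> 1 \<le> k \<Longrightarrow> x \<in> K \<Longrightarrow>
    extend0 \<Delta> \<rho> (x + t0 * of_int (\<lfloor>m (k + n)\<rfloor> - \<lfloor>m k\<rfloor>)) < \<epsilon> / C"
    using forward_conditionD[OF _ \<epsilon>C, of \<Delta> \<rho> m t0 K] cond by blast
  obtain N3 where N3: "\<And>n x. N3 \<le> n \<Longrightarrow> x \<in> K \<Longrightarrow> \<rho> (x + t0 * of_int \<lfloor>m n\<rfloor>) < \<epsilon> / C"
    using orbit_conditionD[OF _ \<epsilon>C, of \<rho> m t0 K] cond by blast
  show "\<exists>N. \<forall>i j y. 1 \<le> i \<and> 1 \<le> j \<and> (i + N \<le> j \<or> j + N \<le> i) \<and> cmod y \<le> R \<and>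
      y + t0 * (of_nat (b j) - of_nat (b i)) \<in> \<Delta> \<longrightarrow> \<rho> (y + t0 * (of_nat (b j) - of_nat (b i))) < \<epsilon>"
  proof (intro exI[of _ "max N1 N2"] allI impI; elim conjE)
    fix i j y
    assume ij: "1 \<le> i" "1 \<le> j" "i + max N1 N2 \<le> j \<or> j + max N1 N2 \<le> i" and y: "cmod y \<le> R"
      and x: "y + t0 * (of_nat (b j) - of_nat (b i)) \<in> \<Delta>"
    define x' where "x' = y + t0 * (of_nat (b j) - of_nat (b i))"
    have xz: "x' + z \<in> \<Delta>" using index_set_add[OF \<Delta> x z(1)] by (simp add: x'_def)
    have "\<rho> (x' + z) < \<epsilon> / C"
    proof (cases "i + max N1 N2 \<le> j")
      case True
      \<comment> \<open>Here \<open>y\<close> is \<open>x'\<close> minus a nonnegative multiple of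
        \<open>t0\<close>, hence possibly outside \<Delta>. The shift from \<open>y + z\<close> to
        \<open>x' + z\<close> goes in direction \<open>t0\<close>, so the forward condition applies
        with \<open>k = i\<close>.\<close>
      then have "b i \<le> b j" using monoD[OF b(1), of i j] by simp
      then have "y + z \<in> K"
        using x y t0n[of "b j - b i"] by (intro in_K[of y x' "t0 * of_nat (b j - b i)"]) (auto simp: x'_def of_nat_diff)
      from N2[OF _ ij(1) this, of "j - i"] True show ?thesis
        using xz b(2) by (simp add: extend0_def x'_def algebra_simps)
    next
      case False
      \<comment> \<open>Now \<open>x'\<close> lies behind \<open>y\<close>, so \<open>y\<close>
        itself is in \<Delta>. The shift goes against \<open>t0\<close>, and the backward condition
        applies with \<open>k = i\<close>; the zero extension is harmless because
        \<open>x' + z\<close> is in \<Delta>.\<close>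
      then have ji: "j + max N1 N2 \<le> i" using ij by simp
      then have "b j \<le> b i" using monoD[OF b(1), of j i] by simp
      then have "x' + t0 * of_nat (b i - b j) \<in> \<Delta>" "y = x' + t0 * of_nat (b i - b j) - 0"
        using x index_set_add[OF \<Delta> x t0n[of "b i - b j"]] by (auto simp: x'_def of_nat_diff algebra_simps)
      then have "y + z \<in> K" using in_K index_set_zero[OF \<Delta>] y by blast
      from N1[OF _ _ ij(1) this, of "i - j"] ji show ?thesis
        using xz b(2) by (simp add: extend0_def x'_def algebra_simps)
    qed
    then show "\<rho> (y + t0 * (of_nat (b j) - of_nat (b i))) < \<epsilon>" using conclude[OF x] by (simp add: x'_def)
  qed
  show "\<exists>N. \<forall>j y. N \<le> j \<and> cmod y \<le> R \<and>
      y + t0 * of_nat (b j) \<in> \<Delta> \<longrightarrow> \<rho> (y + t0 * of_nat (b j)) < \<epsilon>"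
  proof (intro exI[of _ N3] allI impI; elim conjE)
    fix j y assume j: "N3 \<le> j" and y: "cmod y \<le> R" and x: "y + t0 * of_nat (b j) \<in> \<Delta>"
    have "y + z \<in> K" using x y t0n by (intro in_K[of y "y + t0 * of_nat (b j)" "t0 * of_nat (b j)"]) auto
    from N3[OF j this] show "\<rho> (y + t0 * of_nat (b j)) < \<epsilon>"
      using conclude[OF x] b(2) by (simp add: algebra_simps)
  qed
qed

text \<open>Pairs \<open>(j - 1, j)\<close> with \<open>j \<ge> 3\<close> are unaffected by the second half of \<open>(*)\<close> for \<open>k = 1\<close>.\<close>

lemma tuple_condition_gaps:
  assumes "tuple_condition m"
  shows "\<exists>N. \<forall>j. N \<le> Suc j \<longrightarrow> (C::real) < of_int \<bar>\<lfloor>m (Suc j)\<rfloor> - \<lfloor>m j\<rfloor>\<bar>"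
proof -
  define \<delta> where "\<delta> = max C 1"
  have "finite (close_tuples m 1 \<delta>)" using assms by (simp add: tuple_condition_def \<delta>_def)
  moreover have "(\<lambda>j. (j - 1, j)) ` {j. 3 \<le> j \<and> of_int \<bar>\<lfloor>m (Suc j)\<rfloor> - \<lfloor>m j\<rfloor>\<bar> \<le> \<delta>} \<subseteq> close_tuples m 1 \<delta>"
    by (auto simp: close_tuples_def abs_minus_commute)
  ultimately have "finite ((\<lambda>j. (j - 1, j)) ` {j. 3 \<le> j \<and> of_int \<bar>\<lfloor>m (Suc j)\<rfloor> - \<lfloor>m j\<rfloor>\<bar> \<le> \<delta>})"
    by (rule finite_subset[rotated])
  then have "finite {j. 3 \<le> j \<and> of_int \<bar>\<lfloor>m (Suc j)\<rfloor> - \<lfloor>m j\<rfloor>\<bar> \<le> \<delta>}"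
    by (rule finite_imageD) (auto simp: inj_on_def)
  then obtain N where N: "\<And>j. 3 \<le> j \<Longrightarrow> of_int \<bar>\<lfloor>m (Suc j)\<rfloor> - \<lfloor>m j\<rfloor>\<bar> \<le> \<delta> \<Longrightarrow> j \<le> N"
    by (auto simp: finite_nat_set_iff_bounded_le)
  show ?thesis
  proof (intro exI[of _ "N + 5"] allI impI)
    fix j assume "N + 5 \<le> Suc j"
    then have "\<not> of_int \<bar>\<lfloor>m (Suc j)\<rfloor> - \<lfloor>m j\<rfloor>\<bar> \<le> \<delta>" using N[of j] by auto
    then show "C < of_int \<bar>\<lfloor>m (Suc j)\<rfloor> - \<lfloor>m j\<rfloor>\<bar>" by (simp add: \<delta>_def)
  qed
qed

text \<open>One vector \<open>u\<close>, built for the integer times \<open>b k\<close>, witnesses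
  all three conclusions. The growth premise stands only before the two continuous ones, where times
  of modulus \<open>cmod t0 * b k\<close> are compared with \<open>f\<close>.\<close>

lemma translation_hypercyclicity:
  assumes \<Delta>: "\<Delta> \<in> index_sets" and \<Delta>': "\<Delta>' \<in> index_sets" "\<Delta>' \<subseteq> \<Delta>"
    and \<K>: "\<K> \<in> {\<real>, UNIV}" and \<rho>: "admissible_weight \<Delta> \<rho>"
    and f: "mono_on {0..} f" "\<And>t. 0 \<le> t \<Longrightarrow> 1 \<le> f t" and m: "m = (\<lambda>k. f (real k))"
    and tuple: "tuple_condition m" and t0: "t0 \<in> \<Delta>'" "t0 \<noteq> 0"
    and cond: "\<And>K. compact K \<Longrightarrow> K \<subseteq> \<Delta> \<Longrightarrow> backward_condition \<Delta> \<rho> m t0 K \<and>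
               forward_condition \<Delta> \<rho> m t0 K \<and> orbit_condition \<rho> m t0 K"
  shows "(\<exists>c>0. \<forall>\<^sub>F t in at_top. cmod t0 * f (c * t) \<le> f t) \<Longrightarrow>
      frequently_hypercyclic (C0_topology \<Delta> \<K> \<rho>) \<Delta>' f (translation \<Delta>)" (is "?G \<Longrightarrow> ?F1")
    and "(\<exists>c>0. \<forall>\<^sub>F t in at_top. cmod t0 * f (c * t) \<le> f t) \<Longrightarrow>
      frequently_hypercyclic (C0_topology \<Delta> \<K> \<rho>) \<real>\<^sub>\<ge>\<^sub>0 f (\<lambda>t. translation \<Delta> (t * cis (Arg t0)))" (is "_ \<Longrightarrow> ?F2")
    and "l_frequently_hypercyclic (C0_topology \<Delta> \<K> \<rho>) m (translation \<Delta> t0)"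
proof -
  define b where "b k = nat \<lfloor>m k\<rfloor>" for k
  have m1: "1 \<le> m k" for k using f(2) by (simp add: m)
  have mono_m: "mono m" unfolding m by (intro monoI mono_onD[OF f(1)]) auto
  have fl: "\<lfloor>m k\<rfloor> = int (b k)" for k using m1[of k] by (simp add: b_def)
  have b1: "1 \<le> b k" for k using m1[of k] by (simp add: b_def le_nat_iff le_floor_iff)
  have bm: "real (b k) \<le> m k" for k
    using of_int_floor_le[of "m k"] fl[of k] by simp
  have mono_b: "mono b" unfolding b_def using mono_m by (auto intro!: monoI nat_mono floor_mono dest: monoD)
  have t0\<Delta>: "t0 \<in> \<Delta>" using t0 \<Delta>' by blast
  have gaps: "\<exists>N. \<forall>j. N \<le> Suc j \<longrightarrow> C < real (b (Suc j)) - real (b j)" for C :: real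
  proof -
    have "of_int \<bar>\<lfloor>m (Suc j)\<rfloor> - \<lfloor>m j\<rfloor>\<bar> = real (b (Suc j)) - real (b j)" for j
      using monoD[OF mono_b, of j "Suc j"] by (simp add: fl)
    then show ?thesis using tuple_condition_gaps[OF tuple, of C] by simp
  qed
  obtain u where u: "u \<in> C0_weighted \<Delta> \<K> \<rho>"
    and approx: "\<And>v r. v \<in> C0_weighted \<Delta> \<K> \<rho> \<Longrightarrow> 0 < r \<Longrightarrow> \<exists>S D. 0 < D \<and> (\<forall>n. n div D \<le> card (S \<inter> {1..n})) \<and>
      (\<forall>k\<in>S. 1 \<le> k \<and> b k < b (Suc k) \<and>
        (\<forall>x\<in>\<Delta>. x + t0 * of_nat (b k) \<in> \<Delta> \<longrightarrow> cmod (u (x + t0 * of_nat (b k)) - v x) * \<rho> x \<le> r))"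
    using C0_weighted_frequently_approximating[OF \<Delta> \<K> \<rho> t0(2) mono_b gaps
        weight_conditions_off_index_set(1)[OF \<Delta> \<rho> t0\<Delta> mono_b fl cond]
        weight_conditions_off_index_set(2)[OF \<Delta> \<rho> t0\<Delta> mono_b fl cond]] by metis
  have bf: "real (b k) \<le> f (real k)" for k using bm by (simp add: m)
  show "l_frequently_hypercyclic (C0_topology \<Delta> \<K> \<rho>) m (translation \<Delta> t0)"
    by (rule l_frequently_hypercyclic_translation[OF \<Delta> \<rho> t0\<Delta> u mono_b b1 bm mono_m approx])
  show ?F1 if growth: ?G
  proof -
    obtain \<gamma> where \<gamma>: "0 < \<gamma>" "\<forall>\<^sub>F t in at_top. cmod t0 * f (\<gamma> * t) \<le> f t" using growth by blast
    have "frequently_hypercyclic (C0_topology \<Delta> \<K> \<rho>) \<Delta>' f (\<lambda>t. translation \<Delta> (t * 1))"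
      by (rule frequently_hypercyclic_translation[OF \<Delta> \<rho> \<Delta>'(1) _ _ t0 u mono_b bf f(1) \<gamma>])
        (use \<Delta>' approx in auto)
    then show ?thesis by simp
  qed
  show ?F2 if growth: ?G
  proof -
    obtain \<gamma> where \<gamma>: "0 < \<gamma>" "\<forall>\<^sub>F t in at_top. cmod t0 * f (\<gamma> * t) \<le> f t" using growth by blast
    let ?c = "cis (Arg t0)"
    have t0_eq: "of_real (cmod t0) * ?c = t0" using rcis_cmod_Arg[of t0] by (simp add: rcis_def)
    have "?c = t0 * of_real (1 / cmod t0)" using t0(2) t0_eq by (simp add: field_simps)
    then have c: "?c \<in> \<Delta>" using index_set_scale[OF \<Delta> t0\<Delta>, of "1 / cmod t0"] by simp
    have tc: "t * ?c \<in> \<Delta>" if "t \<in> \<real>\<^sub>\<ge>\<^sub>0" for t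
      using that index_set_scale[OF \<Delta> c] by (auto simp: nonneg_Reals_def mult.commute)
    have R: "\<real>\<^sub>\<ge>\<^sub>0 \<in> index_sets" by (simp add: index_sets_def)
    show ?thesis
    proof (rule frequently_hypercyclic_translation[of \<Delta> \<rho> "\<real>\<^sub>\<ge>\<^sub>0" ?c "of_real (cmod t0)" u \<K> b f \<gamma>,
          OF \<Delta> \<rho> R _ tc _ _ u mono_b bf f(1) \<gamma>(1)])
      show "\<forall>\<^sub>F t in at_top. cmod (of_real (cmod t0)) * f (\<gamma> * t) \<le> f t" using \<gamma>(2) by simp
      show "\<exists>S D. 0 < D \<and> (\<forall>n. n div D \<le> card (S \<inter> {1..n})) \<and> (\<forall>k\<in>S. 1 \<le> k \<and> b k < b (Suc k) \<and>
          (\<forall>x\<in>\<Delta>. x + of_real (cmod t0) * ?c * of_nat (b k) \<in> \<Delta> \<longrightarrow>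
            cmod (u (x + of_real (cmod t0) * ?c * of_nat (b k)) - v x) * \<rho> x \<le> r))"
        if "v \<in> C0_weighted \<Delta> \<K> \<rho>" "0 < r" for v r
        unfolding t0_eq by (rule approx[OF that])
    qed (use t0(2) in simp_all)
  qed
qed


section \<open>Power weights\<close>

text \<open>Write a^q as a * a^(q-1), enlarge the second factor to (a+b)^(q-1), and do the same for
  b.\<close>

lemma powr_superadditive:
  fixes a b q :: real
  assumes "0 \<le> a" "0 \<le> b" "1 \<le> q"
  shows "a powr q + b powr q \<le> (a + b) powr q"
proof -
  have *: "x powr q = x * x powr (q - 1)" if "0 \<le> x" for x :: real
    using powr_mult_base[OF that, of "q - 1"] by simp
  have "a * a powr (q - 1) + b * b powr (q - 1) \<le> a * (a + b) powr (q - 1) + b * (a + b) powr (q - 1)"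
    using assms by (intro add_mono mult_left_mono powr_mono2) auto
  then show ?thesis using assms by (simp add: * distrib_right)
qed

text \<open>An elementary substitute for the mean value theorem: (x+1)^q is at least (x+1) *
  x^(q-1), which is x^q + x^(q-1).\<close>

lemma powr_Suc_diff_ge:
  fixes x q :: real
  assumes "0 \<le> x" "1 \<le> q"
  shows "x powr (q - 1) \<le> (x + 1) powr q - x powr q"
proof -
  have *: "y powr q = y * y powr (q - 1)" if "0 \<le> y" for y :: real
    using powr_mult_base[OF that, of "q - 1"] by simp
  have "(x + 1) * x powr (q - 1) \<le> (x + 1) * (x + 1) powr (q - 1)"
    using assms by (intro mult_left_mono powr_mono2) auto
  then show ?thesis using assms by (simp add: * distrib_right)
qed

lemma filterlim_powr_at_top:
  fixes p :: real
  assumes "0 < p"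
  shows "filterlim (\<lambda>x. x powr p) at_top at_top"
  unfolding filterlim_at_top
proof (intro allI eventually_at_top_linorderI)
  fix Z x :: real
  assume x: "max 1 Z powr (1 / p) \<le> x"
  have "max 1 Z = (max 1 Z powr (1 / p)) powr p" using assms by (simp add: powr_powr)
  also have "\<dots> \<le> x powr p" using assms x by (intro powr_mono2) auto
  finally show "Z \<le> x powr p" by simp
qed

lemma measurable_index_measure:
  assumes D: "D \<in> index_sets" and g: "g \<in> borel_measurable borel"
  shows "g \<in> borel_measurable (index_measure D)"
proof (rule measurableI)
  have sp: "space (index_measure D) = D"
    by (auto simp: index_measure_def space_restrict_space space_embed_measure Reals_def)
  fix X :: "'a set" assume "X \<in> sets borel"
  then have "g -` X \<inter> D \<in> sets (index_measure D)"
    using measurable_sets[OF g] by (intro borel_Int_index_measure[OF D]) auto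
  then show "g -` X \<inter> space (index_measure D) \<in> sets (index_measure D)" by (simp add: sp)
qed simp

text \<open>From 1 + |t + t'| \<le> (1 + |t|)(1 + |t'|) \<le> (1 + |t|) exp |t'|, raised to the
  power \<open>s\<close>, one reads off M = 1 and \<omega> = s.\<close>

lemma admissible_weight_powr:
  assumes \<Delta>: "\<Delta> \<in> index_sets" and s: "0 < s"
  shows "admissible_weight \<Delta> (\<lambda>t. (1 + cmod t) powr (- s))"
  unfolding admissible_weight_def
proof (intro conjI)
  have pos: "1 + cmod t \<noteq> 0" for t using norm_ge_zero[of t] by linarith
  show "\<forall>t\<in>\<Delta>. 0 < (1 + cmod t) powr - s" using pos by simp
  show "(\<lambda>t. (1 + cmod t) powr - s) \<in> borel_measurable (index_measure \<Delta>)"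
    by (rule measurable_index_measure[OF \<Delta>]) measurable
  have "(1 + cmod t) powr - s \<le> 1 * exp (s * cmod t') * (1 + cmod (t + t')) powr - s" for t t'
  proof -
    have "(1 + cmod t) * (1 + cmod t') = 1 + cmod t + cmod t' + cmod t * cmod t'"
      by (simp add: algebra_simps)
    moreover have "0 \<le> cmod t * cmod t'" by simp
    ultimately have "1 + cmod (t + t') \<le> (1 + cmod t) * (1 + cmod t')"
      using norm_triangle_ineq[of t t'] by linarith
    also have "\<dots> \<le> (1 + cmod t) * exp (cmod t')"
      by (intro mult_left_mono) (auto simp: add.commute)
    finally have "(1 + cmod (t + t')) powr s \<le> ((1 + cmod t) * exp (cmod t')) powr s"
      using s by (intro powr_mono2) auto
    also have "\<dots> = (1 + cmod t) powr s * exp (s * cmod t')"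
      by (simp add: powr_mult powr_def[of "exp _"])
    finally have "(1 + cmod (t + t')) powr s \<le> (1 + cmod t) powr s * exp (s * cmod t')" .
    moreover have "0 < (1 + cmod t) powr s" "0 < (1 + cmod (t + t')) powr s"
      using pos by simp_all
    ultimately show ?thesis by (simp add: powr_minus field_simps)
  qed
  then show "\<exists>M \<omega>. 1 \<le> M \<and> (\<forall>t\<in>\<Delta>. \<forall>t'\<in>\<Delta>. (1 + cmod t) powr - s
      \<le> M * exp (\<omega> * cmod t') * (1 + cmod (t + t')) powr - s)"
    by (intro exI[of _ 1] exI[of _ s]) simp
qed

context
  fixes q :: real and m :: "nat \<Rightarrow> real"
  assumes q: "1 < q" and m: "m = (\<lambda>k. real k powr q + 1)"
begin

text \<open>Superadditivity bounds the difference before rounding by (j - i)^q \<ge> j - i, and the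
  two floors cost at most 1. The bound depends on j - i alone, which gives thresholds uniform in
  \<open>k\<close>.\<close>

lemma powr_floor_diff:
  assumes "i \<le> j"
  shows "real (j - i) - 1 \<le> of_int (\<lfloor>m j\<rfloor> - \<lfloor>m i\<rfloor>)"
proof (cases "i = j")
  case False
  have "1 \<le> real (j - i)" using assms False by simp
  then have "real (j - i) powr 1 \<le> real (j - i) powr q" using q by (intro powr_mono) auto
  moreover have "real i powr q + real (j - i) powr q \<le> real j powr q"
    using powr_superadditive[of "real i" "real (j - i)" q] q assms by (simp add: of_nat_diff)
  ultimately have "real (j - i) \<le> m j - m i" by (simp add: m)
  then show ?thesis by linarith
qed simp

text \<open>The gap below \<open>b\<close> is at least (b - 1)^(q-1) and tends to infinity because q
  > 1. Hence close values at \<open>k + n1\<close> and \<open>k + n2\<close> force both indices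
  below one \<open>J\<close> depending on \<delta> only; the same box gives finiteness and the bound
  uniform in \<open>k\<close>. The threshold \<delta> + 1 allows for rounding.\<close>

lemma powr_tuple_condition: "tuple_condition m"
  unfolding tuple_condition_def
proof (intro allI impI)
  fix \<delta> :: real assume "0 < \<delta>"
  have "filterlim (\<lambda>x::real. x powr (q - 1)) at_top at_top"
    using q by (intro filterlim_powr_at_top) simp
  then have "filterlim (\<lambda>j. real j powr (q - 1)) at_top sequentially"
    by (rule filterlim_compose[OF _ filterlim_real_sequentially])
  then obtain J where J: "\<And>j. J \<le> j \<Longrightarrow> \<delta> + 1 < real j powr (q - 1)"
    unfolding filterlim_at_top_dense eventually_sequentially by meson
  have large: "\<delta> < of_int \<bar>\<lfloor>m a\<rfloor> - \<lfloor>m b\<rfloor>\<bar>" if "a < b" "J < b" for a b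
  proof -
    obtain b' where b': "b = Suc b'" "a \<le> b'" using \<open>a < b\<close> by (cases b) auto
    have "real a powr q \<le> real b' powr q" using b' q by (intro powr_mono2) auto
    then have "real b' powr (q - 1) \<le> m b - m a"
      using powr_Suc_diff_ge[of "real b'" q] q b' by (simp add: m add.commute)
    then have "\<delta> + 1 < m b - m a" using J[of b'] b' that by simp
    then show ?thesis by linarith
  qed
  have sub: "close_tuples m k \<delta> \<subseteq> {..J} \<times> {..J}" for k
  proof
    fix p assume "p \<in> close_tuples m k \<delta>"
    then obtain n1 n2 where p: "p = (n1, n2)" "n1 \<noteq> n2" "of_int \<bar>\<lfloor>m (k + n1)\<rfloor> - \<lfloor>m (k + n2)\<rfloor>\<bar> \<le> \<delta>"
      by (auto simp: close_tuples_def)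
    have "max (k + n1) (k + n2) \<le> J"
    proof (rule ccontr)
      assume "\<not> ?thesis"
      then show False using p large[of "k + n1" "k + n2"] large[of "k + n2" "k + n1"]
        by (cases n1 n2 rule: linorder_cases) (auto simp: abs_minus_commute)
    qed
    then show "p \<in> {..J} \<times> {..J}" using p(1) by simp
  qed
  have "finite (close_tuples m k \<delta>)" for k by (rule finite_subset[OF sub]) simp
  moreover have "card (close_tuples m k \<delta>) \<le> card ({..J} \<times> {..J})" for k by (rule card_mono[OF _ sub]) simp
  ultimately show "(\<forall>k\<ge>1. finite (close_tuples m k \<delta>)) \<and> (\<exists>C. \<forall>k\<ge>1. card (close_tuples m k \<delta>) \<le> C)"
    by blast
qed

text \<open>All three conditions reduce to \<open>decay\<close>: a bounded set shifted in either
  direction by a multiple \<open>a * t0\<close> with a \<ge> n - 1 moves uniformly to infinity,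
  where the weight vanishes.\<close>

lemma powr_weight_conditions:
  assumes s: "0 < s" and \<rho>: "\<rho> = (\<lambda>t. (1 + cmod t) powr (- s))" and t0: "t0 \<noteq> 0" and K: "compact K"
  shows "backward_condition \<Delta> \<rho> m t0 K \<and> forward_condition \<Delta> \<rho> m t0 K \<and> orbit_condition \<rho> m t0 K"
proof -
  have decay: "\<exists>N\<ge>1. \<forall>n\<ge>N. \<forall>x\<in>K. \<forall>a :: int. real n - 1 \<le> of_int a \<longrightarrow>
      \<rho> (x + t0 * of_int a) \<le> \<epsilon> \<and> \<rho> (x - t0 * of_int a) \<le> \<epsilon>" if \<epsilon>: "0 < \<epsilon>" for \<epsilon>
  proof -
    obtain R where R: "\<And>x. x \<in> K \<Longrightarrow> cmod x \<le> R" using compact_imp_bounded[OF K] by (auto simp: bounded_iff)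
    have "((\<lambda>y::real. y powr (- s)) \<longlongrightarrow> 0) at_top" using s by (intro tendsto_neg_powr filterlim_ident) simp
    then have "\<forall>\<^sub>F y in at_top. y powr (- s) < \<epsilon>" using \<epsilon> by (rule order_tendstoD)
    then obtain Q where Q: "\<And>y. Q \<le> y \<Longrightarrow> y powr (- s) < \<epsilon>" unfolding eventually_at_top_linorder by blast
    obtain N :: nat where N: "(Q + R) / cmod t0 + 2 \<le> real N" using real_arch_simple by blast
    have far: "\<rho> y \<le> \<epsilon>" if "Q \<le> cmod y" for y
      using Q[of "1 + cmod y"] that by (simp add: \<rho>)
    show ?thesis
    proof (intro exI[of _ "max 1 N"] conjI allI impI ballI)
      fix n x and a :: int
      assume n: "max 1 N \<le> n" and x: "x \<in> K" and a: "real n - 1 \<le> of_int a"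
      have "(Q + R) / cmod t0 \<le> of_int a" using N n a by simp
      then have "Q + R \<le> cmod t0 * of_int a" using t0 by (simp add: pos_divide_le_eq mult.commute)
      moreover have "cmod t0 * of_int a \<le> cmod (t0 * of_int a)" by (simp add: norm_mult mult_left_mono)
      ultimately have "Q \<le> cmod (x + t0 * of_int a)" "Q \<le> cmod (x - t0 * of_int a)"
        using R[OF x] norm_diff_ineq[of "t0 * of_int a" x] norm_triangle_ineq2[of "t0 * of_int a" x]
        by (simp_all add: add.commute norm_minus_commute)
      then show "\<rho> (x + t0 * of_int a) \<le> \<epsilon>" "\<rho> (x - t0 * of_int a) \<le> \<epsilon>" using far by auto
    qed simp
  qed
  have ext: "extend0 \<Delta> \<rho> y \<le> \<rho> y" for y by (simp add: extend0_def \<rho>)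
  \<comment> \<open>A pointwise bound passes to the supremum only as a weak inequality; working with
    \<epsilon>/2 restores strictness.\<close>
  have half: "ennreal (\<epsilon> / 2) < ennreal \<epsilon>" if "0 < \<epsilon>" for \<epsilon> :: real
    using that by (simp add: ennreal_less_iff)
  show ?thesis
  proof (intro conjI)
    show "backward_condition \<Delta> \<rho> m t0 K"
      unfolding backward_condition_def
    proof (intro allI impI)
      fix \<epsilon> :: real assume \<epsilon>: "0 < \<epsilon>"
      then obtain N where N: "1 \<le> N" "\<forall>n\<ge>N. \<forall>x\<in>K. \<forall>a :: int. real n - 1 \<le> of_int a \<longrightarrow>
        \<rho> (x + t0 * of_int a) \<le> \<epsilon>/2 \<and> \<rho> (x - t0 * of_int a) \<le> \<epsilon>/2" using decay[of "\<epsilon>/2"] by auto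
      have "(SUP (n, x) \<in> {(n, x). n \<in> F \<and> n \<le> k \<and> x \<in> K}.
           ennreal (extend0 \<Delta> \<rho> (x - t0 * of_int (\<lfloor>m k\<rfloor> - \<lfloor>m (k - n)\<rfloor>)))) < ennreal \<epsilon>"
        if F: "F \<subseteq> {N..}" for F k
      proof (rule le_less_trans[OF SUP_least half[OF \<epsilon>]], clarify)
        fix n x assume n: "n \<in> F" "n \<le> k" and x: "x \<in> K"
        have "real n - 1 \<le> of_int (\<lfloor>m k\<rfloor> - \<lfloor>m (k - n)\<rfloor>)" using powr_floor_diff[of "k - n" k] n by simp
        then have "\<rho> (x - t0 * of_int (\<lfloor>m k\<rfloor> - \<lfloor>m (k - n)\<rfloor>)) \<le> \<epsilon>/2" using N(2) n F x by blast
        then show "ennreal (extend0 \<Delta> \<rho> (x - t0 * of_int (\<lfloor>m k\<rfloor> - \<lfloor>m (k - n)\<rfloor>))) \<le> ennreal (\<epsilon>/2)"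
          using ext order_trans by (intro ennreal_leI) blast
      qed
      then show "\<exists>N\<ge>1. \<forall>F k. finite F \<and> F \<subseteq> {N..} \<and> 1 \<le> k \<longrightarrow>
        (SUP (n, x) \<in> {(n, x). n \<in> F \<and> n \<le> k \<and> x \<in> K}.
           ennreal (extend0 \<Delta> \<rho> (x - t0 * of_int (\<lfloor>m k\<rfloor> - \<lfloor>m (k - n)\<rfloor>)))) < ennreal \<epsilon>"
        using N(1) by blast
    qed
    show "forward_condition \<Delta> \<rho> m t0 K"
      unfolding forward_condition_def
    proof (intro allI impI)
      fix \<epsilon> :: real assume \<epsilon>: "0 < \<epsilon>"
      then obtain N where N: "1 \<le> N" "\<forall>n\<ge>N. \<forall>x\<in>K. \<forall>a :: int. real n - 1 \<le> of_int a \<longrightarrow>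
        \<rho> (x + t0 * of_int a) \<le> \<epsilon>/2 \<and> \<rho> (x - t0 * of_int a) \<le> \<epsilon>/2" using decay[of "\<epsilon>/2"] by auto
      have "(SUP (n, x) \<in> F \<times> K.
           ennreal (extend0 \<Delta> \<rho> (x + t0 * of_int (\<lfloor>m (k + n)\<rfloor> - \<lfloor>m k\<rfloor>)))) < ennreal \<epsilon>"
        if F: "F \<subseteq> {N..}" for F k
      proof (rule le_less_trans[OF SUP_least half[OF \<epsilon>]], clarify)
        fix n x assume n: "n \<in> F" and x: "x \<in> K"
        have "real n - 1 \<le> of_int (\<lfloor>m (k + n)\<rfloor> - \<lfloor>m k\<rfloor>)" using powr_floor_diff[of k "k + n"] by simp
        then have "\<rho> (x + t0 * of_int (\<lfloor>m (k + n)\<rfloor> - \<lfloor>m k\<rfloor>)) \<le> \<epsilon>/2" using N(2) n F x by blast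
        then show "ennreal (extend0 \<Delta> \<rho> (x + t0 * of_int (\<lfloor>m (k + n)\<rfloor> - \<lfloor>m k\<rfloor>))) \<le> ennreal (\<epsilon>/2)"
          using ext order_trans by (intro ennreal_leI) blast
      qed
      then show "\<exists>N\<ge>1. \<forall>F k. finite F \<and> F \<subseteq> {N..} \<and> 1 \<le> k \<longrightarrow>
        (SUP (n, x) \<in> F \<times> K. ennreal (extend0 \<Delta> \<rho> (x + t0 * of_int (\<lfloor>m (k + n)\<rfloor> - \<lfloor>m k\<rfloor>)))) < ennreal \<epsilon>"
        using N(1) by blast
    qed
    show "orbit_condition \<rho> m t0 K"
      unfolding orbit_condition_def
    proof (intro allI impI)
      fix \<epsilon> :: real assume \<epsilon>: "0 < \<epsilon>"
      then obtain N where N: "1 \<le> N" "\<forall>n\<ge>N. \<forall>x\<in>K. \<forall>a :: int. real n - 1 \<le> of_int a \<longrightarrow>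
        \<rho> (x + t0 * of_int a) \<le> \<epsilon>/2 \<and> \<rho> (x - t0 * of_int a) \<le> \<epsilon>/2" using decay[of "\<epsilon>/2"] by auto
      have "(SUP (n, x) \<in> F \<times> K. ennreal (\<rho> (x + t0 * of_int \<lfloor>m n\<rfloor>))) < ennreal \<epsilon>" if F: "F \<subseteq> {N..}" for F
      proof (rule le_less_trans[OF SUP_least half[OF \<epsilon>]], clarify)
        fix n x assume n: "n \<in> F" and x: "x \<in> K"
        have "real n - 1 \<le> of_int (\<lfloor>m n\<rfloor> - \<lfloor>m 0\<rfloor>)" using powr_floor_diff[of 0 n] by simp
        then have "real n - 1 \<le> of_int \<lfloor>m n\<rfloor>" by (simp add: m)
        then have "\<rho> (x + t0 * of_int \<lfloor>m n\<rfloor>) \<le> \<epsilon>/2" using N(2) n F x by blast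
        then show "ennreal (\<rho> (x + t0 * of_int \<lfloor>m n\<rfloor>)) \<le> ennreal (\<epsilon>/2)" by (rule ennreal_leI)
      qed
      then show "\<exists>N\<ge>1. \<forall>F. finite F \<and> F \<subseteq> {N..} \<longrightarrow>
        (SUP (n, x) \<in> F \<times> K. ennreal (\<rho> (x + t0 * of_int \<lfloor>m n\<rfloor>))) < ennreal \<epsilon>"
        using N(1) by blast
    qed
  qed
qed

end

text \<open>With c \<le> 1 and T * c \<le> 1/2 one has T * c^q \<le> 1/2, so T * (c * t)^q uses up
  at most half of t^q; the constant \<open>T\<close> fits into the other half for large
  \<open>t\<close>.\<close>

lemma powr_growth:
  fixes q T :: real
  assumes q: "1 < q" and T: "0 < T"
  shows "\<exists>c>0. \<forall>\<^sub>F t in at_top. T * ((c * t) powr q + 1) \<le> t powr q + 1"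
proof -
  define c where "c = min 1 (1 / (2 * T))"
  have c: "0 < c" "c \<le> 1" "T * c \<le> 1/2" using T by (auto simp: c_def min_def field_simps)
  have "c powr q \<le> c powr 1" using c q by (intro powr_mono') auto
  then have "T * c powr q \<le> T * c" using T c by simp
  then have Tc: "T * c powr q \<le> 1/2" using c(3) by simp
  have "filterlim (\<lambda>x::real. x powr q) at_top at_top" using q by (intro filterlim_powr_at_top) simp
  then have "\<forall>\<^sub>F t in at_top. 2 * T \<le> t powr q" by (simp add: filterlim_at_top)
  moreover have "\<forall>\<^sub>F t::real in at_top. 0 \<le> t" by (rule eventually_ge_at_top)
  ultimately have "\<forall>\<^sub>F t in at_top. T * ((c * t) powr q + 1) \<le> t powr q + 1"
  proof eventually_elim
    case (elim t)
    have "T * c powr q * t powr q \<le> 1/2 * t powr q" using Tc by (intro mult_right_mono) auto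
    then show ?case using elim c by (simp add: powr_mult algebra_simps)
  qed
  then show ?thesis using c(1) by blast
qed


theorem theorem3p4:
  fixes \<Delta> \<Delta>' \<K> :: "complex set"
  assumes "\<Delta> \<in> index_sets" and "\<Delta>' \<in> index_sets" and "\<Delta>' \<subseteq> \<Delta>"
    and "\<K> \<in> {\<real>, UNIV}"
  shows "(\<forall>(\<rho> :: complex \<Rightarrow> real) (f :: real \<Rightarrow> real) (m :: nat \<Rightarrow> real) t0.
            admissible_weight \<Delta> \<rho> \<and>
            mono_on {0..} f \<and> (\<forall>t\<ge>0. 1 \<le> f t) \<and> m = (\<lambda>k. f (real k)) \<and>
            tuple_condition m \<and> t0 \<in> \<Delta>' - {0} \<and>
            (\<forall>K. compact K \<and> K \<subseteq> \<Delta> \<longrightarrow>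
               backward_condition \<Delta> \<rho> m t0 K \<and>
               forward_condition \<Delta> \<rho> m t0 K \<and>
               orbit_condition \<rho> m t0 K)
          \<longrightarrow>
            ((\<exists>c>0. \<forall>\<^sub>F t in at_top. cmod t0 * f (c * t) \<le> f t) \<longrightarrow>
               frequently_hypercyclic (C0_topology \<Delta> \<K> \<rho>) \<Delta>' f (translation \<Delta>) \<and>
               frequently_hypercyclic (C0_topology \<Delta> \<K> \<rho>) \<real>\<^sub>\<ge>\<^sub>0 f
                 (\<lambda>t. translation \<Delta> (t * cis (Arg t0)))) \<and>
            l_frequently_hypercyclic (C0_topology \<Delta> \<K> \<rho>) m (translation \<Delta> t0))
       \<and> (\<forall>(\<rho> :: complex \<Rightarrow> real) (f :: real \<Rightarrow> real) (m :: nat \<Rightarrow> real) q s t0.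
            1 < q \<and> 1 < q * s \<and>
            f = (\<lambda>t. t powr q + 1) \<and> m = (\<lambda>k. f (real k)) \<and>
            \<rho> = (\<lambda>t. (1 + cmod t) powr (- s)) \<and> t0 \<in> \<Delta>' - {0}
          \<longrightarrow>
            admissible_weight \<Delta> \<rho> \<and> tuple_condition m \<and>
            (\<forall>K. compact K \<and> K \<subseteq> \<Delta> \<longrightarrow>
               backward_condition \<Delta> \<rho> m t0 K \<and>
               forward_condition \<Delta> \<rho> m t0 K \<and>
               orbit_condition \<rho> m t0 K) \<and>
            frequently_hypercyclic (C0_topology \<Delta> \<K> \<rho>) \<Delta>' f (translation \<Delta>) \<and>
            frequently_hypercyclic (C0_topology \<Delta> \<K> \<rho>) \<real>\<^sub>\<ge>\<^sub>0 f
              (\<lambda>t. translation \<Delta> (t * cis (Arg t0))) \<and>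
            l_frequently_hypercyclic (C0_topology \<Delta> \<K> \<rho>) m (translation \<Delta> t0))"
proof (intro conjI[where P = "All _"] allI impI; elim conjE)
  fix \<rho> f m t0
  assume \<rho>: "admissible_weight \<Delta> \<rho>" and f: "mono_on {0..} f" "\<forall>t\<ge>0. 1 \<le> f t"
    and m: "m = (\<lambda>k. f (real k))" and tuple: "tuple_condition m" and t0: "t0 \<in> \<Delta>' - {0}"
    and cond: "\<forall>K. compact K \<and> K \<subseteq> \<Delta> \<longrightarrow> backward_condition \<Delta> \<rho> m t0 K \<and>
      forward_condition \<Delta> \<rho> m t0 K \<and> orbit_condition \<rho> m t0 K"
  note * = translation_hypercyclicity[OF assms \<rho> f(1) _ m tuple]
  show "((\<exists>c>0. \<forall>\<^sub>F t in at_top. cmod t0 * f (c * t) \<le> f t) \<longrightarrow>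
       frequently_hypercyclic (C0_topology \<Delta> \<K> \<rho>) \<Delta>' f (translation \<Delta>) \<and>
       frequently_hypercyclic (C0_topology \<Delta> \<K> \<rho>) \<real>\<^sub>\<ge>\<^sub>0 f (\<lambda>t. translation \<Delta> (t * cis (Arg t0)))) \<and>
     l_frequently_hypercyclic (C0_topology \<Delta> \<K> \<rho>) m (translation \<Delta> t0)"
    using *[of t0] f(2) t0 cond by simp
next
  fix \<rho> f m q s t0
  assume q: "1 < q" "1 < q * s" and f: "f = (\<lambda>t. t powr q + 1)" and m: "m = (\<lambda>k. f (real k))"
    and \<rho>: "\<rho> = (\<lambda>t. (1 + cmod t) powr (- s))" and t0: "t0 \<in> \<Delta>' - {0}"
  have "0 < q * s" using q by simp
  then have s: "0 < s" by (rule zero_less_mult_pos) (use q in simp)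
  have m': "m = (\<lambda>k. real k powr q + 1)" by (simp add: m f)
  have adm: "admissible_weight \<Delta> \<rho>" unfolding \<rho> by (rule admissible_weight_powr[OF assms(1) s])
  have tuple: "tuple_condition m" by (rule powr_tuple_condition[OF q(1) m'])
  have cond: "backward_condition \<Delta> \<rho> m t0 K \<and> forward_condition \<Delta> \<rho> m t0 K \<and> orbit_condition \<rho> m t0 K"
    if "compact K" for K
    using powr_weight_conditions[OF q(1) m' s \<rho> _ that] t0 by simp
  have mono: "mono_on {0..} f" unfolding f using q by (auto intro!: mono_onI powr_mono2)
  have ge1: "1 \<le> f t" for t by (simp add: f)
  have growth: "\<exists>c>0. \<forall>\<^sub>F t in at_top. cmod t0 * f (c * t) \<le> f t"
    unfolding f using t0 by (intro powr_growth[OF q(1)]) simp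
  have t0': "t0 \<in> \<Delta>'" "t0 \<noteq> 0" using t0 by auto
  note * = translation_hypercyclicity[OF assms adm mono ge1 m tuple t0']
  show "admissible_weight \<Delta> \<rho> \<and> tuple_condition m \<and>
     (\<forall>K. compact K \<and> K \<subseteq> \<Delta> \<longrightarrow> backward_condition \<Delta> \<rho> m t0 K \<and>
        forward_condition \<Delta> \<rho> m t0 K \<and> orbit_condition \<rho> m t0 K) \<and>
     frequently_hypercyclic (C0_topology \<Delta> \<K> \<rho>) \<Delta>' f (translation \<Delta>) \<and>
     frequently_hypercyclic (C0_topology \<Delta> \<K> \<rho>) \<real>\<^sub>\<ge>\<^sub>0 f (\<lambda>t. translation \<Delta> (t * cis (Arg t0))) \<and>
     l_frequently_hypercyclic (C0_topology \<Delta> \<K> \<rho>) m (translation \<Delta> t0)"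
    using adm tuple cond *(1)[OF cond growth] *(2)[OF cond growth] *(3)[OF cond] by blast
qed

end
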